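(* Let $G$ be a group. Then $\mathcal{P}(G)$ is almost-planar if and only if $\omega(G)\subseteq\{1,2,3,4\}$ or $G$ is isomorphic to one of the groups $\mathbb{Z}_5$, $\mathbb{Z}_6$, $D_{10}$, $D_{12}$, $\mathbb{Z}_3\rtimes\mathbb{Z}_4$ or $\mathbb{Z}_5\rtimes_F\mathbb{Z}_4$.
   Context: The power graph $\mathcal{P}(G)$ of a group $G$ is the simple graph with vertex set $G$ in which two distinct vertices $x,y$ are adjacent if and only if $x\in\langle y\rangle$ or $y\in\langle x\rangle$. $\omega(G)=\{|x| : x\in G\}$ is the set of orders of all elements of $G$. An almost-planar graph is a graph having an edge $e$ whose removal yields a planar graph; planar graphs (including those without edges) are regarded as almost-planar. $\mathbb{Z}_n$ is the cyclic group of order $n$ and $D_{2n}$ is the dihedral group of order $2n$. $\mathbb{Z}_3\rtimes\mathbb{Z}_4$ denotes the nonabelian semidirect product (the dicyclic group of order $12$). $K\rtimes_F H$ denotes a Frobenius group with kernel $K$ and complement $H$; so $\mathbb{Z}_5\rtimes_F\mathbb{Z}_4$ is the Frobenius group of order $20$. *)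

theory Defs
  imports
    "HOL-Analysis.Analysis"
    "HOL-Algebra.Elementary_Groups"
    "HOL-Algebra.Multiplicative_Group"
begin

section \<open>Planar and almost-planar graphs\<close>

text \<open>
  A simple graph is given by a vertex set \<open>V\<close> and a set \<open>E\<close> of two-element subsets of \<open>V\<close>.
  In a drawing in the plane \<open>\<complex>\<close>, \<open>p\<close> places the vertices and \<open>\<gamma> e\<close> is a Jordan arc joining the
  two ends of the edge \<open>e\<close>.  An arc meets no vertex other than its ends, and two arcs meet at
  most in the position of a common end.
\<close>

definition plane_drawing ::
    "'a set \<Rightarrow> 'a set set \<Rightarrow> ('a \<Rightarrow> complex) \<Rightarrow> ('a set \<Rightarrow> real \<Rightarrow> complex) \<Rightarrow> bool" where
  "plane_drawing V E p \<gamma> \<longleftrightarrow>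
     inj_on p V \<and>
     (\<forall>e\<in>E. arc (\<gamma> e) \<and> {pathstart (\<gamma> e), pathfinish (\<gamma> e)} = p ` e) \<and>
     (\<forall>e\<in>E. \<forall>v\<in>V. p v \<in> path_image (\<gamma> e) \<longrightarrow> v \<in> e) \<and>
     (\<forall>e\<in>E. \<forall>f\<in>E. e \<noteq> f \<longrightarrow> path_image (\<gamma> e) \<inter> path_image (\<gamma> f) \<subseteq> p ` (e \<inter> f))"

text \<open>
  For a finite graph, planarity is the existence of a plane drawing (lemma \<open>planar_finite\<close>).
  An infinite graph is called planar if all its finite subgraphs are: a drawing of the whole graph
  would impose cardinality restrictions that have nothing to do with its structure.  For instance,
  a graph with more vertices than the continuum has no drawing, even if it has no edges.
\<close>

definition planar :: "'a set \<Rightarrow> 'a set set \<Rightarrow> bool" where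
  "planar V E \<longleftrightarrow>
     (\<forall>W F. finite W \<and> W \<subseteq> V \<and> F \<subseteq> E \<and> F \<subseteq> Pow W \<longrightarrow> (\<exists>p \<gamma>. plane_drawing W F p \<gamma>))"

lemma plane_drawing_subgraph:
  assumes "plane_drawing V E p \<gamma>" "W \<subseteq> V" "F \<subseteq> E"
  shows "plane_drawing W F p \<gamma>"
proof -
  have "inj_on p W" using assms by (auto simp: plane_drawing_def intro: inj_on_subset)
  moreover have "\<forall>e\<in>F. arc (\<gamma> e) \<and> {pathstart (\<gamma> e), pathfinish (\<gamma> e)} = p ` e"
    "\<forall>e\<in>F. \<forall>v\<in>W. p v \<in> path_image (\<gamma> e) \<longrightarrow> v \<in> e"
    "\<forall>e\<in>F. \<forall>f\<in>F. e \<noteq> f \<longrightarrow> path_image (\<gamma> e) \<inter> path_image (\<gamma> f) \<subseteq> p ` (e \<inter> f)"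
    using assms unfolding plane_drawing_def by (meson subsetD)+
  ultimately show ?thesis
    unfolding plane_drawing_def by (intro conjI)
qed

lemma planar_finite:
  assumes "finite V" "E \<subseteq> Pow V"
  shows "planar V E \<longleftrightarrow> (\<exists>p \<gamma>. plane_drawing V E p \<gamma>)"
  using assms plane_drawing_subgraph unfolding planar_def by (metis subset_refl)

definition almost_planar :: "'a set \<Rightarrow> 'a set set \<Rightarrow> bool" where
  "almost_planar V E \<longleftrightarrow> planar V E \<or> (\<exists>e\<in>E. planar V (E - {e}))"


section \<open>The power graph and the spectrum of a group\<close>

definition power_graph_edges :: "('a, 'b) monoid_scheme \<Rightarrow> 'a set set" where
  "power_graph_edges G =
     {{x, y} | x y. x \<in> carrier G \<and> y \<in> carrier G \<and> x \<noteq> y \<and>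
        (x \<in> generate G {y} \<or> y \<in> generate G {x})}"

text \<open>
  \<^const>\<open>group.ord\<close> is \<open>0\<close> on elements of infinite order, so such an element contributes
  \<open>0\<close> to the spectrum.
\<close>

definition element_orders :: "('a, 'b) monoid_scheme \<Rightarrow> nat set" where
  "element_orders G = group.ord G ` carrier G"


section \<open>The groups in the classification\<close>

definition semidirect_product ::
    "('a, 'c) monoid_scheme \<Rightarrow> ('b, 'd) monoid_scheme \<Rightarrow> ('b \<Rightarrow> 'a \<Rightarrow> 'a) \<Rightarrow> ('a \<times> 'b) monoid" where
  "semidirect_product K H \<phi> =
     \<lparr>carrier = carrier K \<times> carrier H,
      monoid.mult = (\<lambda>(a, h) (b, k). (a \<otimes>\<^bsub>K\<^esub> \<phi> h b, h \<otimes>\<^bsub>H\<^esub> k)),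
      one = (\<one>\<^bsub>K\<^esub>, \<one>\<^bsub>H\<^esub>)\<rparr>"

text \<open>
  A generator of \<open>\<int>\<^sub>m\<close> (with \<open>m\<close> even) acts on \<open>\<int>\<^sub>n\<close> by inversion.  For \<open>m = 2\<close> this is the
  dihedral group of order \<open>2 n\<close>; for \<open>n = 3\<close>, \<open>m = 4\<close> it is the only nonabelian semidirect
  product \<open>\<int>\<^sub>3 \<rtimes> \<int>\<^sub>4\<close>, since inversion is the only nontrivial automorphism of \<open>\<int>\<^sub>3\<close>.
\<close>

definition inversion_action :: "nat \<Rightarrow> int \<Rightarrow> int \<Rightarrow> int" where
  "inversion_action n h x = (if even h then x else inv\<^bsub>integer_mod_group n\<^esub> x)"

definition dihedral_group :: "nat \<Rightarrow> (int \<times> int) monoid" where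
  "dihedral_group n =
     semidirect_product (integer_mod_group n) (integer_mod_group 2) (inversion_action n)"

definition dicyclic_group_12 :: "(int \<times> int) monoid" where
  "dicyclic_group_12 =
     semidirect_product (integer_mod_group 3) (integer_mod_group 4) (inversion_action 3)"

text \<open>
  The Frobenius group \<open>\<int>\<^sub>5 \<rtimes>\<^sub>F \<int>\<^sub>4\<close>: the generator \<open>1\<close> of \<open>\<int>\<^sub>4\<close> acts on \<open>\<int>\<^sub>5\<close> by multiplication
  by \<open>2\<close>, an automorphism of order \<open>4\<close>.  Nontrivial elements of \<open>\<int>\<^sub>4\<close> fix only \<open>0\<close> (lemma
  \<open>frobenius_action_fixed_point_free\<close>), which is what makes the product Frobenius with kernel
  \<open>\<int>\<^sub>5\<close> and complement \<open>\<int>\<^sub>4\<close>.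
\<close>

definition frobenius_action_5_4 :: "int \<Rightarrow> int \<Rightarrow> int" where
  "frobenius_action_5_4 h x = (2 ^ nat h * x) mod 5"

definition frobenius_group_20 :: "(int \<times> int) monoid" where
  "frobenius_group_20 =
     semidirect_product (integer_mod_group 5) (integer_mod_group 4) frobenius_action_5_4"

lemma group_semidirect_product:
  assumes K: "group K" and H: "group H"
    and hom: "\<And>h. h \<in> carrier H \<Longrightarrow> \<phi> h \<in> hom K K"
    and one: "\<And>x. x \<in> carrier K \<Longrightarrow> \<phi> \<one>\<^bsub>H\<^esub> x = x"
    and mult: "\<And>h k x. \<lbrakk>h \<in> carrier H; k \<in> carrier H; x \<in> carrier K\<rbrakk> \<Longrightarrow>
                 \<phi> (h \<otimes>\<^bsub>H\<^esub> k) x = \<phi> h (\<phi> k x)"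
  shows "group (semidirect_product K H \<phi>)"
proof -
  interpret K: group K by fact
  interpret H: group H by fact
  have closed: "\<phi> h x \<in> carrier K" if "h \<in> carrier H" "x \<in> carrier K" for h x
    using hom[OF that(1)] that(2) by (auto simp: hom_def)
  have distrib: "\<phi> h (x \<otimes>\<^bsub>K\<^esub> y) = \<phi> h x \<otimes>\<^bsub>K\<^esub> \<phi> h y"
    if "h \<in> carrier H" "x \<in> carrier K" "y \<in> carrier K" for h x y
    using hom[OF that(1)] that by (auto simp: hom_def)
  show ?thesis
  proof (rule groupI)
    fix x assume x: "x \<in> carrier (semidirect_product K H \<phi>)"
    then obtain a h where ah: "x = (a, h)" "a \<in> carrier K" "h \<in> carrier H"
      by (auto simp: semidirect_product_def)
    let ?y = "(\<phi> (inv\<^bsub>H\<^esub> h) (inv\<^bsub>K\<^esub> a), inv\<^bsub>H\<^esub> h)"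
    have "\<phi> (inv\<^bsub>H\<^esub> h) (inv\<^bsub>K\<^esub> a) \<otimes>\<^bsub>K\<^esub> \<phi> (inv\<^bsub>H\<^esub> h) a = \<phi> (inv\<^bsub>H\<^esub> h) \<one>\<^bsub>K\<^esub>"
      using ah by (simp flip: distrib)
    moreover have "\<phi> (inv\<^bsub>H\<^esub> h) \<one>\<^bsub>K\<^esub> = \<one>\<^bsub>K\<^esub>"
      using distrib[of "inv\<^bsub>H\<^esub> h" "\<one>\<^bsub>K\<^esub>" "\<one>\<^bsub>K\<^esub>"] closed[of "inv\<^bsub>H\<^esub> h" "\<one>\<^bsub>K\<^esub>"] ah
      by (metis H.inv_closed K.l_cancel_one K.one_closed K.r_one)
    ultimately show "\<exists>y\<in>carrier (semidirect_product K H \<phi>).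
        y \<otimes>\<^bsub>semidirect_product K H \<phi>\<^esub> x = \<one>\<^bsub>semidirect_product K H \<phi>\<^esub>"
      using ah closed by (intro bexI[of _ ?y]) (auto simp: semidirect_product_def)
  qed (auto simp: semidirect_product_def closed distrib one mult K.m_assoc H.m_assoc)
qed

lemma inversion_action_hom:
  "inversion_action n h \<in> hom (integer_mod_group n) (integer_mod_group n)"
proof -
  interpret comm_group "integer_mod_group n" by simp
  show ?thesis
    unfolding inversion_action_def hom_def Pi_def
    by (auto simp del: mult_integer_mod_group inv_integer_mod_group simp: inv_mult)
qed

lemma group_inversion_semidirect_product:
  assumes "even m" "m > 0"
  shows "group (semidirect_product (integer_mod_group n) (integer_mod_group m) (inversion_action n))"
proof (rule group_semidirect_product)
  fix h k x
  assume "h \<in> carrier (integer_mod_group m)" "k \<in> carrier (integer_mod_group m)"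
    and x: "x \<in> carrier (integer_mod_group n)"
  have "even ((h + k) mod int m) \<longleftrightarrow> even (h + k)"
    using assms by (simp add: dvd_mod_iff)
  then show "inversion_action n (h \<otimes>\<^bsub>integer_mod_group m\<^esub> k) x =
      inversion_action n h (inversion_action n k x)"
    using x group.inv_inv[OF group_integer_mod_group x]
    by (simp add: inversion_action_def del: inv_integer_mod_group)
qed (auto intro: inversion_action_hom simp: inversion_action_def)

lemma group_dihedral_group: "group (dihedral_group n)"
  unfolding dihedral_group_def by (rule group_inversion_semidirect_product) auto

lemma group_dicyclic_group_12: "group dicyclic_group_12"
  unfolding dicyclic_group_12_def by (rule group_inversion_semidirect_product) auto

lemma dicyclic_group_12_nonabelian: "\<not> comm_group dicyclic_group_12"
proof
  assume "comm_group dicyclic_group_12"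
  then interpret comm_group dicyclic_group_12 .
  have "(1, 0) \<otimes>\<^bsub>dicyclic_group_12\<^esub> (0, 1) = (0, 1) \<otimes>\<^bsub>dicyclic_group_12\<^esub> (1, 0)"
    by (rule m_comm) (auto simp: dicyclic_group_12_def semidirect_product_def carrier_integer_mod_group)
  then show False
    by (simp add: dicyclic_group_12_def semidirect_product_def inversion_action_def carrier_integer_mod_group)
qed

lemma group_frobenius_group_20: "group frobenius_group_20"
  unfolding frobenius_group_20_def
proof (rule group_semidirect_product)
  fix h k x
  assume hk: "h \<in> carrier (integer_mod_group 4)" "k \<in> carrier (integer_mod_group 4)"
    and "x \<in> carrier (integer_mod_group 5)"
  then have "h \<in> {0, 1, 2, 3}" "k \<in> {0, 1, 2, 3}" "x \<in> {0, 1, 2, 3, 4}"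
    by (auto simp: carrier_integer_mod_group)
  then show "frobenius_action_5_4 (h \<otimes>\<^bsub>integer_mod_group 4\<^esub> k) x =
      frobenius_action_5_4 h (frobenius_action_5_4 k x)"
    by (elim insertE emptyE; simp add: frobenius_action_5_4_def)
qed (auto simp: frobenius_action_5_4_def hom_def carrier_integer_mod_group mod_simps distrib_left)

lemma frobenius_action_fixed_point_free:
  assumes "h \<in> carrier (integer_mod_group 4)" "h \<noteq> 0" "x \<in> carrier (integer_mod_group 5)"
    and "frobenius_action_5_4 h x = x"
  shows "x = 0"
proof -
  have "h \<in> {1, 2, 3}" "x \<in> {0, 1, 2, 3, 4}"
    using assms by (auto simp: carrier_integer_mod_group)
  then show ?thesis
    using assms(4) by (auto simp: frobenius_action_5_4_def)
qed

end

theory Submission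
  imports Defs "HOL-Number_Theory.Cong"
begin

text \<open>
  An edge of the power graph lies within a cyclic subgroup.  Elements of infinite order or of order at
  least \<open>7\<close> yield six pairwise adjacent vertices, so removing one edge leaves a \<open>K\<^sub>5\<close>.  A cyclic
  subgroup of order \<open>5\<close> is itself a \<open>K\<^sub>5\<close>, and one of order \<open>6\<close> contains \<open>K\<^sub>3\<^sub>,\<^sub>3\<close>.  Two such subgroups
  cannot be made planar by the removal of one edge, not even of an edge in their intersection (lemma
  \<open>two_subgroups_not_almost_planar\<close>).  Conversely, elements of orders at most \<open>4\<close> contribute, besides
  edges to the identity, only windmills of triangles, and these together with at most one cyclic subgroup
  of order \<open>5\<close> or \<open>6\<close>, minus an edge, can be drawn (lemma \<open>windmill_planar\<close>).  Thus the power graph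
  is almost planar if and only if all orders are at most \<open>4\<close>, with the possible exception of the
  elements of one cyclic subgroup of order \<open>5\<close> or \<open>6\<close> (lemma \<open>almost_planar_iff_orders\<close>).

  Such an exceptional subgroup is normal and is its own centralizer.  So the group is determined by the
  action on it by conjugation, up to the choice between a split and a nonsplit extension for order \<open>6\<close>
  (lemmas \<open>order_5_classification\<close> and \<open>order_6_classification\<close>).

  The nonplanarity of \<open>K\<^sub>5\<close> and \<open>K\<^sub>3\<^sub>,\<^sub>3\<close> comes from the Jordan curve theorem: two chords of a cycle whose
  ends alternate on the cycle are drawn on opposite sides of it (lemma \<open>crossing_chords_alternate\<close>).
  For planarity, the identity is placed at the origin and the other elements on a branch of a hyperbola,
  where it only matters that the edges between them do not interleave (lemma \<open>hyperbola_fan_drawing\<close>).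
\<close>

section \<open>The sides of a Jordan curve\<close>

lemma connected_inside_or_outside:
  fixes S J :: "complex set"
  assumes "connected S" "closed J" "S \<inter> J = {}"
  shows "S \<subseteq> inside J \<or> S \<subseteq> outside J"
proof -
  have "S \<subseteq> inside J \<union> outside J"
    using assms inside_Un_outside[of J] by auto
  then show ?thesis
    using connectedD[OF assms(1) open_inside[OF assms(2)] open_outside[OF assms(2)]]
      inside_Int_outside[of J] by blast
qed

text \<open>
  A point of a Jordan arc is a limit of points of the arc other than its two ends.
\<close>

lemma endpoints_in_closure_endless:
  fixes g :: "real \<Rightarrow> complex"
  assumes "arc g"
  shows "path_image g \<subseteq> closure (path_image g - {pathstart g, pathfinish g})"
proof -
  have "g ` closure {0<..<1} \<subseteq> closure (g ` {0<..<1})"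
    using arc_imp_path[OF assms]
    by (intro image_closure_subset) (auto simp: path_def closure_subset)
  moreover have "path_image g - {pathstart g, pathfinish g} = g ` {0<..<1}"
    using simple_path_endless[OF arc_imp_simple_path[OF assms]] .
  ultimately show ?thesis by (simp add: path_image_def)
qed

text \<open>
  Let the closed curve formed by two arcs \<open>c1\<close>, \<open>c2\<close> from \<open>a\<close> to \<open>b\<close> enclose a chord \<open>c\<close> from \<open>a\<close> to \<open>b\<close>
  and a chord \<open>d\<close> from \<open>c1\<close> to \<open>c2\<close>.  The chord \<open>c\<close> cuts the interior into the interiors of
  \<open>c1 \<union> c\<close> and \<open>c2 \<union> c\<close>.  If \<open>d\<close> avoided \<open>c\<close>, it would lie in one of these two, and then one of
  its ends would be out of reach.
\<close>

lemma inside_chords_meet: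
  fixes c1 c2 c d :: "real \<Rightarrow> complex"
  assumes c1: "arc c1" "pathstart c1 = a" "pathfinish c1 = b"
    and c2: "arc c2" "pathstart c2 = a" "pathfinish c2 = b"
    and c: "arc c" "pathstart c = a" "pathfinish c = b"
    and c12: "path_image c1 \<inter> path_image c2 = {a, b}"
    and c_in: "path_image c - {a, b} \<subseteq> inside (path_image c1 \<union> path_image c2)"
    and d: "arc d" "pathstart d \<in> path_image c1 - {a, b}" "pathfinish d \<in> path_image c2 - {a, b}"
    and d_in: "path_image d - {pathstart d, pathfinish d} \<subseteq> inside (path_image c1 \<union> path_image c2)"
  shows "path_image c \<inter> path_image d \<noteq> {}"
proof
  assume disj: "path_image c \<inter> path_image d = {}"
  let ?J = "path_image c1 \<union> path_image c2"
  let ?D = "path_image d - {pathstart d, pathfinish d}"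
  have no: "inside ?J \<inter> ?J = {}" by (rule inside_no_overlap)
  have ab: "a \<noteq> b" using c1 arc_distinct_ends by blast
  have ends: "{a, b} \<subseteq> path_image c1" "{a, b} \<subseteq> path_image c2" "{a, b} \<subseteq> path_image c"
    using pathstart_in_path_image[of c1] pathfinish_in_path_image[of c1]
      pathstart_in_path_image[of c2] pathfinish_in_path_image[of c2]
      pathstart_in_path_image[of c] pathfinish_in_path_image[of c] c1 c2 c by auto
  have c1c: "path_image c1 \<inter> path_image c = {a, b}" and c2c: "path_image c2 \<inter> path_image c = {a, b}"
    using no c_in ends by blast+
  have "path_image c - {a, b} \<noteq> {}"
    using nonempty_simple_path_endless[OF arc_imp_simple_path[OF c(1)]] c by simp
  then have ne: "path_image c \<inter> inside ?J \<noteq> {}" using c_in by blast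
  let ?I1 = "inside (path_image c1 \<union> path_image c)" and ?I2 = "inside (path_image c2 \<union> path_image c)"
  have "?I1 \<inter> ?I2 = {} \<and> ?I1 \<union> ?I2 \<union> (path_image c - {a, b}) = inside ?J"
    by (rule split_inside_simple_closed_curve[OF arc_imp_simple_path[OF c1(1)] c1(2,3)
        arc_imp_simple_path[OF c2(1)] c2(2,3) arc_imp_simple_path[OF c(1)] c(2,3) ab c12 c1c c2c ne])
      (rule conjI)
  then have I12: "?I1 \<inter> ?I2 = {}" and IU: "?I1 \<union> ?I2 \<union> (path_image c - {a, b}) = inside ?J"
    by (rule conjunct1, rule conjunct2)
  have cl: "closed (path_image c1 \<union> path_image c)" "closed (path_image c2 \<union> path_image c)"
    using c1 c2 c by (auto intro!: closed_Un closed_arc_image)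
  have conn: "connected ?D" by (rule connected_simple_path_endless[OF arc_imp_simple_path[OF d(1)]])
  have "?D \<subseteq> ?I1 \<union> ?I2" using d_in IU disj by blast
  then have "?D \<subseteq> ?I1 \<or> ?D \<subseteq> ?I2"
    using connectedD[OF conn open_inside[OF cl(1)] open_inside[OF cl(2)]] I12 by blast
  moreover have dcl: "path_image d \<subseteq> closure ?D" by (rule endpoints_in_closure_endless[OF d(1)])
  moreover have "pathfinish d \<notin> path_image c1 \<union> path_image c \<union> ?I1"
    using d c12 c2c IU no by blast
  moreover have "pathstart d \<notin> path_image c2 \<union> path_image c \<union> ?I2"
    using d c12 c1c IU no by blast
  moreover have "closure ?I1 \<subseteq> path_image c1 \<union> path_image c \<union> ?I1"
    "closure ?I2 \<subseteq> path_image c2 \<union> path_image c \<union> ?I2"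
    using closure_inside_subset[OF cl(1)] closure_inside_subset[OF cl(2)] by blast+
  ultimately show False
    by (meson closure_mono in_mono pathfinish_in_path_image pathstart_in_path_image)
qed

text \<open>
  Inversion at a point \<open>w\<close> inside a Jordan curve takes the exterior to the interior of the image
  curve.  Indeed the punctured interior is mapped to a connected unbounded set, hence outside.  If the
  exterior also went outside, the interior of the image could contain no point except \<open>0\<close>.
\<close>

lemma inversion_outside_subset_inside:
  fixes g :: "real \<Rightarrow> complex"
  defines "J \<equiv> path_image g"
  assumes g: "simple_path g" "pathfinish g = pathstart g" and w: "w \<in> inside J"
  shows "(\<lambda>z. inverse (z - w)) ` outside J \<subseteq> inside ((\<lambda>z. inverse (z - w)) ` J)"
proof -
  define f where "f = (\<lambda>z::complex. inverse (z - w))"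
  have inj: "inj f" by (auto simp: f_def inj_def)
  have cont: "continuous_on (- {w}) f" unfolding f_def by (intro continuous_intros) auto
  have wJ: "w \<notin> J" "w \<notin> outside J"
    using w inside_no_overlap[of J] inside_Int_outside[of J] by blast+
  have JO: "open (inside J)" "connected (inside J)" "connected (outside J)"
    using Jordan_inside_outside[OF g] by (auto simp: J_def)
  have IO: "inside J \<union> outside J = - J" by simp
  have sp: "simple_path (f \<circ> g)"
  proof (rule simple_path_continuous_image[OF g(1)])
    show "continuous_on (path_image g) f"
      by (rule continuous_on_subset[OF cont]) (use wJ J_def in auto)
    show "inj_on f (path_image g)" using inj by (rule inj_on_subset) simp
  qed
  have loop: "pathfinish (f \<circ> g) = pathstart (f \<circ> g)"
    using g(2) by (simp add: pathfinish_def pathstart_def)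
  have img: "path_image (f \<circ> g) = f ` J" by (simp add: J_def path_image_compose)
  have K: "inside (f ` J) \<noteq> {}" "open (inside (f ` J))" "bounded (inside (f ` J))" "closed (f ` J)"
    using Jordan_inside_outside[OF sp loop] closed_simple_path_image[OF sp] unfolding img by auto
  have side: "f ` S \<subseteq> inside (f ` J) \<or> f ` S \<subseteq> outside (f ` J)"
    if "connected S" "w \<notin> S" "S \<inter> J = {}" for S
  proof (rule connected_inside_or_outside[OF _ K(4)])
    show "connected (f ` S)"
      by (rule connected_continuous_image[OF continuous_on_subset[OF cont]]) (use that in auto)
    show "f ` S \<inter> f ` J = {}" using that inj by (auto simp: inj_def)
  qed
  have "connected (inside J - {w})"
    by (rule connected_open_delete) (use JO in auto)
  then have "f ` (inside J - {w}) \<subseteq> inside (f ` J) \<or> f ` (inside J - {w}) \<subseteq> outside (f ` J)"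
    by (rule side) (use inside_no_overlap[of J] in blast)+
  moreover have "\<not> f ` (inside J - {w}) \<subseteq> inside (f ` J)"
  proof
    assume "f ` (inside J - {w}) \<subseteq> inside (f ` J)"
    then obtain B where B: "\<And>z. z \<in> inside J - {w} \<Longrightarrow> norm (f z) \<le> B"
      using K(3) unfolding bounded_iff by blast
    obtain e where e: "e > 0" "ball w e \<subseteq> inside J"
      using JO(1) w open_contains_ball by blast
    (* points near w have images of large norm *)
    define r where "r = min (e / 2) (1 / (\<bar>B\<bar> + 1))"
    have r: "r > 0" "r < e" "r \<le> 1 / (\<bar>B\<bar> + 1)" using e by (auto simp: r_def min_def)
    then have "w + of_real r \<in> inside J - {w}"
      using e(2) by (auto simp: dist_norm intro!: subsetD[OF e(2)])
    then have "norm (f (w + of_real r)) \<le> B" by (rule B)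
    then have "1 / r \<le> B" using r by (simp add: f_def norm_inverse divide_inverse)
    moreover have "1 / r \<ge> \<bar>B\<bar> + 1" using r by (simp add: field_simps)
    ultimately show False by linarith
  qed
  ultimately have in_out: "f ` (inside J - {w}) \<subseteq> outside (f ` J)" by blast
  have "f ` outside J \<subseteq> inside (f ` J) \<or> f ` outside J \<subseteq> outside (f ` J)"
    by (rule side[OF JO(3) wJ(2) outside_no_overlap])
  moreover have "\<not> f ` outside J \<subseteq> outside (f ` J)"
  proof
    assume out: "f ` outside J \<subseteq> outside (f ` J)"
    have "inside (f ` J) \<subseteq> {0}"
    proof (rule subsetI, rule ccontr)
      fix y assume y: "y \<in> inside (f ` J)" "y \<notin> {0}"
      let ?z = "w + inverse y"
      have fz: "f ?z = y" by (simp add: f_def)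
      have "?z \<noteq> w" using y by simp
      moreover have "?z \<notin> J" using y(1) fz inside_no_overlap[of "f ` J"] by (metis disjoint_iff imageI)
      ultimately have "?z \<in> (inside J - {w}) \<union> outside J" using IO by blast
      then have "y \<in> outside (f ` J)" using in_out out fz by (metis UnE imageI subsetD)
      then show False using y(1) inside_Int_outside by blast
    qed
    then have "inside (f ` J) = {0}" using K(1) by blast
    then show False using K(2) by (metis not_open_singleton)
  qed
  ultimately show ?thesis by (simp add: f_def)
qed

text \<open>
  The same for two chords outside the closed curve, by an inversion at a point inside it.
\<close>

lemma outside_chords_meet:
  fixes c1 c2 c d :: "real \<Rightarrow> complex"
  assumes c1: "arc c1" "pathstart c1 = a" "pathfinish c1 = b"
    and c2: "arc c2" "pathstart c2 = a" "pathfinish c2 = b"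
    and c: "arc c" "pathstart c = a" "pathfinish c = b"
    and c12: "path_image c1 \<inter> path_image c2 = {a, b}"
    and c_out: "path_image c - {a, b} \<subseteq> outside (path_image c1 \<union> path_image c2)"
    and d: "arc d" "pathstart d \<in> path_image c1 - {a, b}" "pathfinish d \<in> path_image c2 - {a, b}"
    and d_out: "path_image d - {pathstart d, pathfinish d} \<subseteq> outside (path_image c1 \<union> path_image c2)"
  shows "path_image c \<inter> path_image d \<noteq> {}"
proof -
  let ?J = "path_image c1 \<union> path_image c2"
  define g where "g = c1 +++ reversepath c2"
  have g: "simple_path g" "pathfinish g = pathstart g" "path_image g = ?J"
    unfolding g_def using c1 c2 c12
    by (auto simp: simple_path_join_loop_eq arc_reversepath path_image_join)
  obtain w where w: "w \<in> inside ?J"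
    using Jordan_inside_outside[OF g(1,2)] g(3) by auto
  define f where "f = (\<lambda>z::complex. inverse (z - w))"
  have inj: "inj f" by (auto simp: f_def inj_def)
  have w_out: "w \<notin> ?J" "w \<notin> outside ?J"
    using w inside_no_overlap[of ?J] inside_Int_outside[of ?J] by blast+
  have arcf: "arc (f \<circ> h)" if "arc h" "w \<notin> path_image h" for h
  proof -
    have "continuous_on (path_image h) f"
      unfolding f_def by (intro continuous_intros) (use that in auto)
    then show ?thesis
      using that inj by (auto simp: arc_def path_continuous_image comp_inj_on path_image_def inj_on_subset)
  qed
  have wc: "w \<notin> path_image c"
    using c_out w_out c12 by blast
  have wd: "w \<notin> path_image d"
    using d_out w_out d(2,3) by blast
  have inside: "f ` S \<subseteq> inside (f ` path_image c1 \<union> f ` path_image c2)" if "S \<subseteq> outside ?J" for S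
  proof -
    have "f ` outside ?J \<subseteq> inside (f ` ?J)"
      unfolding f_def using inversion_outside_subset_inside[OF g(1,2), unfolded g(3), OF w] .
    then show ?thesis using that unfolding image_Un by blast
  qed
  have "path_image (f \<circ> c) \<inter> path_image (f \<circ> d) \<noteq> {}"
  proof (rule inside_chords_meet)
    show "arc (f \<circ> c1)" "arc (f \<circ> c2)" "arc (f \<circ> c)" "arc (f \<circ> d)"
      using c1 c2 c d w_out wc wd by (auto intro!: arcf)
    show "pathstart (f \<circ> c1) = f a" "pathfinish (f \<circ> c1) = f b"
      "pathstart (f \<circ> c2) = f a" "pathfinish (f \<circ> c2) = f b"
      "pathstart (f \<circ> c) = f a" "pathfinish (f \<circ> c) = f b"
      using c1 c2 c by (auto simp: pathstart_compose pathfinish_compose)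
    show "path_image (f \<circ> c1) \<inter> path_image (f \<circ> c2) = {f a, f b}"
      using c12 inj by (metis image_Int image_empty image_insert path_image_compose)
    have *: "f ` S - {f x, f y} = f ` (S - {x, y})" for S x y
      using inj by (auto simp: inj_def)
    show "path_image (f \<circ> c) - {f a, f b} \<subseteq> inside (path_image (f \<circ> c1) \<union> path_image (f \<circ> c2))"
      "path_image (f \<circ> d) - {pathstart (f \<circ> d), pathfinish (f \<circ> d)}
         \<subseteq> inside (path_image (f \<circ> c1) \<union> path_image (f \<circ> c2))"
      unfolding path_image_compose pathstart_compose pathfinish_compose *
      using c_out d_out by (auto intro!: inside simp del: image_subset_iff)
    show "pathstart (f \<circ> d) \<in> path_image (f \<circ> c1) - {f a, f b}"
      "pathfinish (f \<circ> d) \<in> path_image (f \<circ> c2) - {f a, f b}"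
      unfolding path_image_compose pathstart_compose pathfinish_compose * using d by auto
  qed
  then show ?thesis by (auto simp: path_image_compose inj_eq[OF inj])
qed

section \<open>Crossing chords of a cycle in a plane drawing\<close>

text \<open>
  The edges of the walk that visits the vertices of a list in their order.
\<close>

fun walk_edges :: "'a list \<Rightarrow> 'a set set" where
  "walk_edges (x # y # zs) = insert {x, y} (walk_edges (y # zs))"
| "walk_edges _ = {}"

lemma walk_edges_subset: "e \<in> walk_edges vs \<Longrightarrow> e \<subseteq> set vs"
  by (induction vs rule: walk_edges.induct) auto

lemma walk_edges_append:
  "walk_edges (xs @ y # zs) = walk_edges (xs @ [y]) \<union> walk_edges (y # zs)"
  by (induction xs rule: walk_edges.induct) auto

lemma ends_not_walk_edge:
  assumes "distinct (u # as @ [w])" "as \<noteq> []"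
  shows "{u, w} \<notin> walk_edges (u # as @ [w])"
proof
  assume e: "{u, w} \<in> walk_edges (u # as @ [w])"
  obtain a as' where as: "as = a # as'" using assms(2) by (cases as) auto
  have "{u, w} = {u, a} \<or> {u, w} \<in> walk_edges (a # as' @ [w])" using e as by simp
  then show False
    using walk_edges_subset[of "{u, w}" "a # as' @ [w]"] assms as by (auto simp: doubleton_eq_iff)
qed

lemma walk_edges_card: "e \<in> walk_edges vs \<Longrightarrow> distinct vs \<Longrightarrow> card e = 2"
  by (induction vs rule: walk_edges.induct) auto

lemma plane_drawing_Int:
  assumes "plane_drawing V E p \<gamma>" "e \<in> E" "f \<in> E" "e \<noteq> f"
  shows "path_image (\<gamma> e) \<inter> path_image (\<gamma> f) \<subseteq> p ` (e \<inter> f)"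
  using assms unfolding plane_drawing_def by blast

lemma plane_drawing_arc:
  assumes "plane_drawing V E p \<gamma>" "{x, y} \<in> E"
  obtains g where "arc g" "pathstart g = p x" "pathfinish g = p y"
    "path_image g = path_image (\<gamma> {x, y})"
proof -
  have "arc (\<gamma> {x, y})" "{pathstart (\<gamma> {x, y}), pathfinish (\<gamma> {x, y})} = {p x, p y}"
    using assms unfolding plane_drawing_def by auto
  then consider "pathstart (\<gamma> {x, y}) = p x" "pathfinish (\<gamma> {x, y}) = p y"
    | "pathstart (\<gamma> {x, y}) = p y" "pathfinish (\<gamma> {x, y}) = p x"
    by (auto simp: doubleton_eq_iff)
  then show ?thesis
  proof cases
    case 1
    then show ?thesis using that \<open>arc (\<gamma> {x, y})\<close> by blast
  next
    case 2
    then show ?thesis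
      using that[of "reversepath (\<gamma> {x, y})"] \<open>arc (\<gamma> {x, y})\<close> by (simp add: arc_reversepath)
  qed
qed

lemma plane_drawing_walk_arc:
  assumes "plane_drawing V E p \<gamma>" "distinct (x # y # zs)" "walk_edges (x # y # zs) \<subseteq> E"
  shows "\<exists>g. arc g \<and> pathstart g = p x \<and> pathfinish g = p (last (y # zs)) \<and>
           path_image g = (\<Union>e\<in>walk_edges (x # y # zs). path_image (\<gamma> e))"
  using assms(2,3)
proof (induction zs arbitrary: x y)
  case Nil
  then have "{x, y} \<in> E" by simp
  from plane_drawing_arc[OF assms(1) this] show ?case by auto
next
  case (Cons z zs)
  from Cons.IH[of y z] Cons.prems obtain h where
    h: "arc h" "pathstart h = p y" "pathfinish h = p (last (z # zs))"
       "path_image h = (\<Union>e\<in>walk_edges (y # z # zs). path_image (\<gamma> e))"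
    by auto
  have xy: "{x, y} \<in> E" using Cons.prems by simp
  obtain g where g: "arc g" "pathstart g = p x" "pathfinish g = p y"
    "path_image g = path_image (\<gamma> {x, y})"
    using plane_drawing_arc[OF assms(1) xy] .
  have "path_image g \<inter> path_image h \<subseteq> {p y}"
  proof
    fix q assume "q \<in> path_image g \<inter> path_image h"
    then obtain f where f: "f \<in> walk_edges (y # z # zs)" "q \<in> path_image (\<gamma> {x, y})" "q \<in> path_image (\<gamma> f)"
      using g h by auto
    have "x \<notin> f" using walk_edges_subset[OF f(1)] Cons.prems by auto
    then have "{x, y} \<inter> f \<subseteq> {y}" "{x, y} \<noteq> f" by auto
    moreover have "f \<in> E" using f Cons.prems by auto
    ultimately show "q \<in> {p y}"
      using plane_drawing_Int[OF assms(1) xy, of f] f by blast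
  qed
  then have "arc (g +++ h)" using g h by (intro arc_join) auto
  then show ?case
    using g h by (intro exI[of _ "g +++ h"]) (auto simp: path_image_join)
qed

text \<open>
  In a plane drawing, the arc of \<open>e\<close> runs, apart from its ends, inside the closed curve drawn by the
  edges of the cycle \<open>C\<close>.
\<close>

definition inner_chord :: "('a \<Rightarrow> complex) \<Rightarrow> ('a set \<Rightarrow> real \<Rightarrow> complex) \<Rightarrow> 'a set set \<Rightarrow> 'a set \<Rightarrow> bool" where
  "inner_chord p \<gamma> C e \<longleftrightarrow> path_image (\<gamma> e) - p ` e \<subseteq> inside (\<Union>f\<in>C. path_image (\<gamma> f))"

text \<open>
  Two walks from \<open>u\<close> to \<open>w\<close>, with inner vertices \<open>as\<close> and \<open>bs\<close>, form a cycle \<open>C\<close>.  A chord that joins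
  an inner vertex of the first walk to one of the second crosses the chord \<open>{u, w}\<close> combinatorially;
  so in a plane drawing exactly one of the two chords is drawn inside \<open>C\<close>.
\<close>

lemma crossing_chords_alternate:
  assumes D: "plane_drawing V E p \<gamma>"
    and dist: "distinct (u # w # as @ bs)" "set (u # w # as @ bs) \<subseteq> V"
    and a: "a \<in> set as" and b: "b \<in> set bs"
    and C: "C = walk_edges (u # as @ [w]) \<union> walk_edges (u # bs @ [w])"
    and CE: "C \<subseteq> E" and chords: "{u, w} \<in> E" "{a, b} \<in> E"
  shows "inner_chord p \<gamma> C {u, w} \<longleftrightarrow> \<not> inner_chord p \<gamma> C {a, b}"
proof -
  let ?W = "\<lambda>as. walk_edges (u # as @ [w])" let ?I = "\<lambda>F. \<Union>e\<in>F. path_image (\<gamma> e)"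
  let ?J = "?I C"
  have inj: "inj_on p V" using D by (simp add: plane_drawing_def)
  have peq: "p x = p y \<longleftrightarrow> x = y" if "x \<in> V" "y \<in> V" for x y
    using inj that by (auto simp: inj_on_def)
  have walk: "\<exists>g. arc g \<and> pathstart g = p u \<and> pathfinish g = p w \<and> path_image g = ?I (?W as)"
    if as: "distinct (u # w # as)" "as \<noteq> []" "?W as \<subseteq> E" for as
  proof -
    obtain a' as' where "as = a' # as'" using as(2) by (cases as) auto
    then show ?thesis
      using plane_drawing_walk_arc[OF D, of u a' "as' @ [w]"] as by auto
  qed
  have ne: "as \<noteq> []" "bs \<noteq> []" using a b by auto
  obtain c1 where c1: "arc c1" "pathstart c1 = p u" "pathfinish c1 = p w" "path_image c1 = ?I (?W as)"
    using walk[of as] dist ne CE C by auto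
  obtain c2 where c2: "arc c2" "pathstart c2 = p u" "pathfinish c2 = p w" "path_image c2 = ?I (?W bs)"
    using walk[of bs] dist ne CE C by auto
  obtain c where c: "arc c" "pathstart c = p u" "pathfinish c = p w" "path_image c = path_image (\<gamma> {u, w})"
    using plane_drawing_arc[OF D chords(1)] .
  obtain d where d: "arc d" "pathstart d = p a" "pathfinish d = p b" "path_image d = path_image (\<gamma> {a, b})"
    using plane_drawing_arc[OF D chords(2)] .
  have J: "?J = path_image c1 \<union> path_image c2" by (simp add: c1 c2 C)
  have closedJ: "closed ?J" unfolding J using c1 c2 by (intro closed_Un closed_arc_image)
  have sub: "e \<subseteq> insert u (insert w (set as))" if "e \<in> ?W as" for e as
    using walk_edges_subset[OF that] by auto
  have uw: "{u, w} \<notin> C" using C ends_not_walk_edge[of u _ w] dist ne by auto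
  have ab: "{a, b} \<notin> C" using C sub[of "{a, b}"] a b dist by auto
  have vertex_on_walk: "p x \<in> ?I (?W as)" if x: "x \<in> set as" "?W as \<subseteq> E" for x as
  proof -
    have "x \<in> \<Union> (walk_edges (y # as @ [w]))" for y
      using x(1)
    proof (induction as arbitrary: y)
      case (Cons z as)
      then show ?case by (cases "x = z") auto
    qed simp
    then obtain e where e: "e \<in> ?W as" "x \<in> e" by blast
    then have "e \<in> E" using x(2) by blast
    then have "p ` e = {pathstart (\<gamma> e), pathfinish (\<gamma> e)}"
      using D by (simp add: plane_drawing_def)
    then have "p x \<in> {pathstart (\<gamma> e), pathfinish (\<gamma> e)}" using e(2) by (metis imageI)
    then have "p x \<in> path_image (\<gamma> e)"
      using pathstart_in_path_image[of "\<gamma> e"] pathfinish_in_path_image[of "\<gamma> e"]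
      by (metis insertE singletonD)
    then show ?thesis using e by auto
  qed
  have pa: "p a \<in> path_image c1" "p b \<in> path_image c2"
    unfolding c1(4) c2(4) using CE unfolding C by (intro vertex_on_walk[OF a] vertex_on_walk[OF b]; simp)+
  have off: "(path_image (\<gamma> e) - p ` e) \<inter> ?J = {}" if e: "e \<in> E" "e \<notin> C" for e
  proof -
    have "(path_image (\<gamma> e) - p ` e) \<inter> path_image (\<gamma> f) = {}" if f: "f \<in> C" for f
    proof -
      have "f \<in> E" "e \<noteq> f" using f e CE by auto
      then have "path_image (\<gamma> e) \<inter> path_image (\<gamma> f) \<subseteq> p ` (e \<inter> f)"
        by (rule plane_drawing_Int[OF D e(1)])
      then show ?thesis by blast
    qed
    then show ?thesis unfolding Int_UN_distrib by simp
  qed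
  have c_conn: "path_image (\<gamma> {u, w}) - p ` {u, w} = path_image c - {pathstart c, pathfinish c}"
    and d_conn: "path_image (\<gamma> {a, b}) - p ` {a, b} = path_image d - {pathstart d, pathfinish d}"
    using c d by auto
  have side: "path_image (\<gamma> e) - p ` e \<subseteq> inside ?J \<or> path_image (\<gamma> e) - p ` e \<subseteq> outside ?J"
    if e: "e \<in> {{u, w}, {a, b}}" for e
  proof (rule connected_inside_or_outside[OF _ closedJ])
    show "connected (path_image (\<gamma> e) - p ` e)"
      using e connected_simple_path_endless[OF arc_imp_simple_path[OF c(1)], folded c_conn]
        connected_simple_path_endless[OF arc_imp_simple_path[OF d(1)], folded d_conn] by blast
    show "(path_image (\<gamma> e) - p ` e) \<inter> ?J = {}" using off[of e] e uw ab chords by blast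
  qed
  have "{u, w} \<noteq> {a, b}" "{u, w} \<inter> {a, b} = {}" using a b dist by (auto simp: doubleton_eq_iff)
  then have disj: "path_image c \<inter> path_image d = {}"
    using plane_drawing_Int[OF D chords] unfolding c(4) d(4) by simp
  have c12: "path_image c1 \<inter> path_image c2 = {p u, p w}"
  proof
    show "path_image c1 \<inter> path_image c2 \<subseteq> {p u, p w}"
    proof
      fix q assume "q \<in> path_image c1 \<inter> path_image c2"
      then obtain e f where ef: "e \<in> ?W as" "f \<in> ?W bs" "q \<in> path_image (\<gamma> e)" "q \<in> path_image (\<gamma> f)"
        unfolding c1(4) c2(4) by blast
      have int: "e \<inter> f \<subseteq> {u, w}" using sub[OF ef(1)] sub[OF ef(2)] dist by auto
      have "e \<noteq> f"
      proof
        assume "e = f"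
        then have "e \<subseteq> {u, w}" using int by auto
        moreover have "e \<in> E" using ef(1) C CE by blast
        moreover have "card e = 2"
          using walk_edges_card[OF ef(1)] dist by auto
        ultimately have "e = {u, w}"
          using dist by (intro card_subset_eq) auto
        then show False using uw ef(1) C by blast
      qed
      moreover have "e \<in> E" "f \<in> E" using ef C CE by blast+
      ultimately have "q \<in> p ` (e \<inter> f)" using plane_drawing_Int[OF D, of e f] ef by blast
      then show "q \<in> {p u, p w}" using int by blast
    qed
    show "{p u, p w} \<subseteq> path_image c1 \<inter> path_image c2"
      using c1 c2 pathstart_in_path_image[of c1] pathfinish_in_path_image[of c1]
        pathstart_in_path_image[of c2] pathfinish_in_path_image[of c2] by simp
  qed
  have d_ends: "pathstart d \<in> path_image c1 - {p u, p w}" "pathfinish d \<in> path_image c2 - {p u, p w}"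
    using d pa a b dist by (auto simp: peq)
  let ?c = "path_image c - {p u, p w}" and ?d = "path_image d - {pathstart d, pathfinish d}"
  have "?c \<subseteq> inside ?J \<or> ?c \<subseteq> outside ?J" "?d \<subseteq> inside ?J \<or> ?d \<subseteq> outside ?J"
    using side[of "{u, w}"] side[of "{a, b}"] unfolding c_conn d_conn c(2,3) by simp_all
  moreover have False if h: "?c \<subseteq> inside ?J" "?d \<subseteq> inside ?J"
    using inside_chords_meet[OF c1(1-3) c2(1-3) c(1-3) c12 h(1)[unfolded J] d(1) d_ends h(2)[unfolded J]] disj
    by simp
  moreover have False if h: "?c \<subseteq> outside ?J" "?d \<subseteq> outside ?J"
    using outside_chords_meet[OF c1(1-3) c2(1-3) c(1-3) c12 h(1)[unfolded J] d(1) d_ends h(2)[unfolded J]] disj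
    by simp
  moreover have False if h: "?c \<subseteq> inside ?J" "?c \<subseteq> outside ?J"
  proof -
    have "?c \<noteq> {}"
      using nonempty_simple_path_endless[OF arc_imp_simple_path[OF c(1)]] c by simp
    then show False using h inside_Int_outside[of ?J] by blast
  qed
  ultimately show ?thesis
    unfolding inner_chord_def c_conn d_conn c(2,3) by argo
qed

lemma planarD:
  assumes "planar V E" "finite W" "W \<subseteq> V" "F \<subseteq> E" "F \<subseteq> Pow W"
  obtains p \<gamma> where "plane_drawing W F p \<gamma>"
proof -
  have "finite W \<and> W \<subseteq> V \<and> F \<subseteq> E \<and> F \<subseteq> Pow W" using assms(2-) by simp
  then have "\<exists>p \<gamma>. plane_drawing W F p \<gamma>" using assms(1) unfolding planar_def by metis
  then show ?thesis using that by metis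
qed

section \<open>Nonplanar graphs\<close>

text \<open>
  Each diagonal of a pentagon crosses the next one, so around the odd cycle of the five diagonals the
  sides would have to alternate.
\<close>

lemma complete_5_not_planar:
  assumes S: "S \<subseteq> V" "card S = 5" and E: "\<And>x y. x \<in> S \<Longrightarrow> y \<in> S \<Longrightarrow> x \<noteq> y \<Longrightarrow> {x, y} \<in> E"
  shows "\<not> planar V E"
proof
  assume pl: "planar V E"
  have fin: "finite S" using S(2) by (simp add: card_ge_0_finite)
  define F where "F = {{x, y} | x y. x \<in> S \<and> y \<in> S \<and> x \<noteq> y}"
  have F: "{x, y} \<in> F" if "x \<in> S" "y \<in> S" "x \<noteq> y" for x y using that by (auto simp: F_def)
  obtain p \<gamma> where D: "plane_drawing S F p \<gamma>"
    by (rule planarD[OF pl fin S(1), of F]) (auto simp: F_def E)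
  obtain vs where vs: "set vs = S" "distinct vs" using finite_distinct_list[OF fin] by blast
  then have "length vs = 5" using S(2) distinct_card by fastforce
  then obtain v0 v1 v2 v3 v4 where "vs = [v0, v1, v2, v3, v4]"
    by (auto simp: length_Suc_conv numeral_eq_Suc)
  then have v: "S = {v0, v1, v2, v3, v4}" "distinct [v0, v1, v2, v3, v4]" using vs by auto
  (* the definition is symmetric under rotation of the pentagon *)
  define C where "C = {{v0, v1}, {v1, v2}, {v2, v3}, {v3, v4}, {v4, v0}}"
  have alt: "inner_chord p \<gamma> C {a, c} \<longleftrightarrow> \<not> inner_chord p \<gamma> C {b, d}"
    if h: "distinct [a, b, c, d, e]" "set [a, b, c, d, e] \<subseteq> S" "C = {{a, b}, {b, c}, {c, d}, {d, e}, {e, a}}"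
    for a b c d e
  proof (rule crossing_chords_alternate[OF D, of a c "[b]" "[e, d]"])
    show "C = walk_edges (a # [b] @ [c]) \<union> walk_edges (a # [e, d] @ [c])"
      unfolding h(3) by (simp add: insert_commute)
    show "C \<subseteq> F" unfolding h(3) using h(1,2) by (auto intro!: F)
  qed (use h(1,2) in \<open>auto intro!: F\<close>)
  have "inner_chord p \<gamma> C {v0, v2} \<longleftrightarrow> \<not> inner_chord p \<gamma> C {v1, v3}"
    by (rule alt[where e = v4]) (use v(2) in \<open>auto simp: C_def v(1) insert_commute\<close>)
  moreover have "inner_chord p \<gamma> C {v1, v3} \<longleftrightarrow> \<not> inner_chord p \<gamma> C {v2, v4}"
    by (rule alt[where e = v0]) (use v(2) in \<open>auto simp: C_def v(1) insert_commute\<close>)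
  moreover have "inner_chord p \<gamma> C {v2, v4} \<longleftrightarrow> \<not> inner_chord p \<gamma> C {v3, v0}"
    by (rule alt[where e = v1]) (use v(2) in \<open>auto simp: C_def v(1) insert_commute\<close>)
  moreover have "inner_chord p \<gamma> C {v3, v0} \<longleftrightarrow> \<not> inner_chord p \<gamma> C {v4, v1}"
    by (rule alt[where e = v2]) (use v(2) in \<open>auto simp: C_def v(1) insert_commute\<close>)
  moreover have "inner_chord p \<gamma> C {v4, v1} \<longleftrightarrow> \<not> inner_chord p \<gamma> C {v0, v2}"
    by (rule alt[where e = v3]) (use v(2) in \<open>auto simp: C_def v(1) insert_commute\<close>)
  ultimately show False by argo
qed

text \<open>
  The three long chords of a hexagon cross pairwise, but there are only two sides to draw them on.
  For \<open>ys = []\<close> the graph is \<open>K\<^sub>3\<^sub>,\<^sub>3\<close>; in general \<open>ys\<close> subdivides one edge of it.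
\<close>

lemma hexagon_with_long_chords_not_planar:
  assumes dist: "distinct (a0 # ys @ [a1, a2, a3, a4, a5])"
    and V: "set (a0 # ys @ [a1, a2, a3, a4, a5]) \<subseteq> V"
    and E: "walk_edges (a0 # ys @ [a1, a2, a3, a4, a5, a0]) \<subseteq> E"
    and chords: "{a0, a3} \<in> E" "{a1, a4} \<in> E" "{a2, a5} \<in> E"
  shows "\<not> planar V E"
proof
  assume pl: "planar V E"
  define C where "C = walk_edges (a0 # ys @ [a1, a2, a3, a4, a5, a0])"
  define W where "W = set (a0 # ys @ [a1, a2, a3, a4, a5])"
  define F where "F = insert {a0, a3} (insert {a1, a4} (insert {a2, a5} C))"
  have FW: "F \<subseteq> Pow W"
  proof -
    have "e \<subseteq> W" if "e \<in> C" for e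
      using walk_edges_subset[of e "a0 # ys @ [a1, a2, a3, a4, a5, a0]"] that by (auto simp: C_def W_def)
    then show ?thesis by (auto simp: F_def W_def)
  qed
  have WV: "finite W" "W \<subseteq> V" "F \<subseteq> E" using V E chords by (auto simp: F_def C_def W_def)
  obtain p \<gamma> where D: "plane_drawing W F p \<gamma>"
    using planarD[OF pl WV FW] .
  define Y where "Y = walk_edges (a0 # ys @ [a1])"
  have Y: "walk_edges (a0 # ys @ a1 # zs) = Y \<union> walk_edges (a1 # zs)" for zs
    using walk_edges_append[of "a0 # ys" a1 zs] by (simp add: Y_def)
  have Cd: "C = Y \<union> {{a1, a2}, {a2, a3}, {a3, a4}, {a4, a5}, {a5, a0}}"
    by (simp add: C_def Y)
  have CF: "C \<subseteq> F" by (auto simp: F_def)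
  have d: "distinct (a0 # a3 # (ys @ [a1, a2]) @ [a5, a4])"
    "set (a0 # a3 # (ys @ [a1, a2]) @ [a5, a4]) \<subseteq> W"
    "distinct (a5 # a2 # (a0 # ys @ [a1]) @ [a4, a3])"
    "set (a5 # a2 # (a0 # ys @ [a1]) @ [a4, a3]) \<subseteq> W"
    using dist by (auto simp: W_def)
  have C1: "C = walk_edges (a0 # (ys @ [a1, a2]) @ [a3]) \<union> walk_edges (a0 # [a5, a4] @ [a3])"
    using Y[of "[a2, a3]"] by (auto simp: Cd insert_commute)
  have C2: "C = walk_edges (a5 # (a0 # ys @ [a1]) @ [a2]) \<union> walk_edges (a5 # [a4, a3] @ [a2])"
    using Y[of "[a2]"] by (auto simp: Cd insert_commute)
  have ch: "{a0, a3} \<in> F" "{a1, a4} \<in> F" "{a2, a5} \<in> F" "{a5, a2} \<in> F" by (auto simp: F_def insert_commute)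
  have "inner_chord p \<gamma> C {a0, a3} \<longleftrightarrow> \<not> inner_chord p \<gamma> C {a1, a4}"
    by (rule crossing_chords_alternate[OF D d(1,2) _ _ C1 CF ch(1,2)]) simp_all
  moreover have "inner_chord p \<gamma> C {a0, a3} \<longleftrightarrow> \<not> inner_chord p \<gamma> C {a2, a5}"
    by (rule crossing_chords_alternate[OF D d(1,2) _ _ C1 CF ch(1,3)]) simp_all
  moreover have "inner_chord p \<gamma> C {a5, a2} \<longleftrightarrow> \<not> inner_chord p \<gamma> C {a1, a4}"
    by (rule crossing_chords_alternate[OF D d(3,4) _ _ C2 CF ch(4,2)]) simp_all
  ultimately show False unfolding insert_commute[of a5 a2] by argo
qed

section \<open>Straight-line drawings\<close>

lemma straight_line_drawing:
  assumes edges: "\<And>e. e \<in> E \<Longrightarrow> \<exists>x\<in>V. \<exists>y\<in>V. e = {x, y} \<and> x \<noteq> y"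
    and inj: "inj_on p V"
    and vert: "\<And>x y v. {x, y} \<in> E \<Longrightarrow> x \<noteq> y \<Longrightarrow> v \<in> V \<Longrightarrow> p v \<in> closed_segment (p x) (p y) \<Longrightarrow> v \<in> {x, y}"
    and cross: "\<And>a b c d q. {a, b} \<in> E \<Longrightarrow> {c, d} \<in> E \<Longrightarrow> a \<noteq> b \<Longrightarrow> c \<noteq> d \<Longrightarrow> {a, b} \<noteq> {c, d} \<Longrightarrow>
        q \<in> closed_segment (p a) (p b) \<Longrightarrow> q \<in> closed_segment (p c) (p d) \<Longrightarrow> q \<in> p ` ({a, b} \<inter> {c, d})"
  shows "\<exists>\<gamma>. plane_drawing V E p \<gamma>"
proof -
  have "\<forall>e\<in>E. \<exists>xy. fst xy \<in> V \<and> snd xy \<in> V \<and> e = {fst xy, snd xy} \<and> fst xy \<noteq> snd xy"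
    using edges by fastforce
  then obtain k where k: "\<And>e. e \<in> E \<Longrightarrow> fst (k e) \<in> V \<and> snd (k e) \<in> V \<and> e = {fst (k e), snd (k e)} \<and> fst (k e) \<noteq> snd (k e)"
    by metis
  define \<gamma> where "\<gamma> e = linepath (p (fst (k e))) (p (snd (k e)))" for e
  have arc: "arc (\<gamma> e)" if "e \<in> E" for e
    using k[OF that] inj unfolding \<gamma>_def by (intro arc_linepath) (auto dest: inj_onD)
  have ends: "{pathstart (\<gamma> e), pathfinish (\<gamma> e)} = p ` e" if "e \<in> E" for e
    using arg_cong[of e _ "image p", OF conjunct1[OF conjunct2[OF conjunct2[OF k[OF that]]]]]
    by (simp add: \<gamma>_def)
  have v: "v \<in> e" if "e \<in> E" "v \<in> V" "p v \<in> path_image (\<gamma> e)" for e v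
    using vert[of "fst (k e)" "snd (k e)" v] k[OF that(1)] that by (simp add: \<gamma>_def)
  have c: "path_image (\<gamma> e) \<inter> path_image (\<gamma> f) \<subseteq> p ` (e \<inter> f)" if "e \<in> E" "f \<in> E" "e \<noteq> f" for e f
    using cross[of "fst (k e)" "snd (k e)" "fst (k f)" "snd (k f)"] k[OF that(1)] k[OF that(2)] that
    by (auto simp: \<gamma>_def)
  show ?thesis
    unfolding plane_drawing_def using inj arc ends v c by (intro exI[of _ \<gamma>]) simp
qed

text \<open>
  Positions on the branch \<open>y = 1 / x\<close> of the hyperbola, \<open>x > 0\<close>.  The branch is convex and meets every
  ray from the origin into the open positive quadrant once.  Hence the segments from the origin to its
  points stay below it, and its chords above.
\<close>

definition hyperbola :: "real \<Rightarrow> complex" where "hyperbola s = Complex s (1 / s)"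

text \<open>
  An affine function that vanishes on the secant through the points of the branch at \<open>a\<close> and \<open>b\<close>, or
  on the tangent if \<open>a = b\<close>.  Its signs separate the segments of the drawings below.
\<close>

definition secant :: "real \<Rightarrow> real \<Rightarrow> complex \<Rightarrow> real" where
  "secant a b q = a * b * Im q + Re q - (a + b)"

lemma secant_hyperbola: "t > 0 \<Longrightarrow> secant a b (hyperbola t) = (t - a) * (t - b) / t"
  by (simp add: secant_def hyperbola_def field_simps)

lemma secant_0: "secant a b 0 = - (a + b)"
  by (simp add: secant_def)

lemma secant_affine: "secant a b ((1 - t) *\<^sub>R x + t *\<^sub>R y) = (1 - t) * secant a b x + t * secant a b y"
  by (simp add: secant_def algebra_simps)

lemma secant_segment:
  assumes "q \<in> closed_segment x y"
  obtains t where "0 \<le> t" "t \<le> 1" "q = (1 - t) *\<^sub>R x + t *\<^sub>R y"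
    "\<And>a b. secant a b q = (1 - t) * secant a b x + t * secant a b y"
  using assms secant_affine unfolding in_segment by metis

lemma secant_centroid:
  "secant a b ((x + y + z) /\<^sub>R 3) = (secant a b x + secant a b y + secant a b z) / 3"
  by (simp add: secant_def field_simps)

lemma nonneg_combination_zero:
  fixes t h k :: real
  assumes "0 \<le> t" "t \<le> 1" "0 \<le> h" "0 \<le> k" "(1 - t) * h + t * k \<le> 0"
  shows "t = 0 \<and> h = 0 \<or> t = 1 \<and> k = 0 \<or> h = 0 \<and> k = 0"
proof -
  have "0 \<le> (1 - t) * h" "0 \<le> t * k" using assms by auto
  then have "(1 - t) * h = 0" "t * k = 0" using assms by linarith+
  then show ?thesis by auto
qed

lemma secant_zero_on_segment:
  assumes "q \<in> closed_segment x y"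
    and "0 \<le> s * secant a b x" "0 \<le> s * secant a b y" "s * secant a b q \<le> 0"
  shows "q = x \<and> s * secant a b x = 0 \<or> q = y \<and> s * secant a b y = 0 \<or>
         s * secant a b x = 0 \<and> s * secant a b y = 0"
proof -
  obtain t where t: "0 \<le> t" "t \<le> 1" "q = (1 - t) *\<^sub>R x + t *\<^sub>R y"
    "secant a b q = (1 - t) * secant a b x + t * secant a b y"
    using secant_segment[OF assms(1)] by metis
  have "(1 - t) * (s * secant a b x) + t * (s * secant a b y) \<le> 0"
    using assms(4) t(4) by (simp add: algebra_simps)
  from nonneg_combination_zero[OF t(1,2) assms(2,3) this] show ?thesis using t(3) by auto
qed

lemma hyperbola_rays_meet:
  assumes "s > 0" "t > 0" "s \<noteq> t" "q \<in> closed_segment 0 (hyperbola s)" "q \<in> closed_segment 0 (hyperbola t)"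
  shows "q = 0"
proof -
  obtain k where k: "q = k *\<^sub>R hyperbola s" using assms(4) by (auto simp: in_segment)
  obtain l where l: "q = l *\<^sub>R hyperbola t" using assms(5) by (auto simp: in_segment)
  note kl = k l
  have e: "k * s = l * t" "k * (1 / s) = l * (1 / t)"
    using arg_cong[OF kl(1), of Re] arg_cong[OF kl(2), of Re] arg_cong[OF kl(1), of Im] arg_cong[OF kl(2), of Im]
    by (simp_all add: hyperbola_def)
  then have "k * t = l * s" using assms by (simp add: field_simps)
  then have "(k + l) * (s - t) = 0" "(k - l) * (s + t) = 0" using e(1) by (simp_all add: algebra_simps)
  then have "k + l = 0" "k - l = 0" using assms by auto
  then show ?thesis using kl by simp
qed

text \<open>
  A straight-line drawing: the vertex \<open>c\<close> is at the origin, the other vertices are on the hyperbola at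
  the positions \<open>f\<close>, and the edges between them are chords, none of which interleave.  There may be one
  extra vertex \<open>z\<close> whose neighbours are among the corners of a triangle \<open>u\<close>, \<open>v\<close>, \<open>w\<close> of chords; it is
  placed at the centroid of this triangle.  The set \<open>Z\<close> is \<open>{z}\<close> or, if there is no such vertex, empty.
\<close>

lemma hyperbola_fan_drawing:
  fixes f :: "'a \<Rightarrow> real"
  assumes edges: "\<And>e. e \<in> E \<Longrightarrow> \<exists>x\<in>V. \<exists>y\<in>V. e = {x, y} \<and> x \<noteq> y"
    and f: "\<And>x. x \<in> V - {c} - Z \<Longrightarrow> f x > 0" "inj_on f (V - {c} - Z)"
    and noncrossing: "\<And>x y x' y'. {x, y} \<in> E \<Longrightarrow> {x', y'} \<in> E \<Longrightarrow> {x, y, x', y'} \<subseteq> V - {c} - Z \<Longrightarrow>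
        \<not> (f x < f x' \<and> f x' < f y \<and> f y < f y')"
    and Z: "Z = {} \<or> Z = {z} \<and> z \<noteq> c \<and> {u, v, w} \<subseteq> V - {c} - Z \<and> distinct [u, v, w] \<and>
        {u, v} \<in> E \<and> {v, w} \<in> E \<and> {u, w} \<in> E \<and> (\<forall>y. {z, y} \<in> E \<longrightarrow> y \<in> {u, v, w})"
  shows "\<exists>p \<gamma>. plane_drawing V E p \<gamma>"
proof -
  let ?R = "V - {c} - Z"
  define zz where "zz = (hyperbola (f u) + hyperbola (f v) + hyperbola (f w)) /\<^sub>R 3"
  define p where "p x = (if x = c then 0 else if x \<in> Z then zz else hyperbola (f x))" for x
  have p_c: "p c = 0" by (simp add: p_def)
  have p_R: "p x = hyperbola (f x)" if "x \<in> ?R" for x using that by (auto simp: p_def)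
  have p_Z: "p x = zz" if "x \<in> Z" for x using that Z by (auto simp: p_def)
  have feq: "f x = f y \<longleftrightarrow> x = y" if "x \<in> ?R" "y \<in> ?R" for x y
    using f(2) that by (auto simp: inj_on_def)
  have sec: "secant (f a) (f b) (p x) = (f x - f a) * (f x - f b) / f x" if "x \<in> ?R" for a b x
    using f(1)[OF that] by (simp add: p_R[OF that] secant_hyperbola)
  have uvw: "u \<in> ?R" "v \<in> ?R" "w \<in> ?R" "u \<noteq> v" "v \<noteq> w" "u \<noteq> w"
    "{u, v} \<in> E" "{v, w} \<in> E" "{u, w} \<in> E" if "y \<in> Z" for y
    using Z that by auto
  have Zy: "y \<in> {u, v, w}" "z \<noteq> c" if "{x, y} \<in> E" "x \<in> Z" for x y using Z that by auto
  have Zsing: "x = y" if "x \<in> Z" "y \<in> Z" for x y using Z that by auto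
  have zz: "secant a b zz = (secant a b (p u) + secant a b (p v) + secant a b (p w)) / 3" if "y \<in> Z" for a b y
    using uvw(1-3)[OF that] unfolding zz_def by (simp only: secant_centroid p_R)
  have VR: "x = c \<or> x \<in> Z \<or> x \<in> ?R" if "x \<in> V" for x using that by blast
  (* the tangent at a vertex has all vertices except c weakly on its upper side *)
  have tangent_R: "secant (f a) (f a) (p x) \<ge> 0" "secant (f a) (f a) (p x) = 0 \<longleftrightarrow> x = a"
    if "a \<in> ?R" "x \<in> ?R" for a x
    using sec[OF that(2), of a a] f(1)[OF that(2)] feq[OF that(2,1)] by auto
  have tangent_Z: "secant (f a) (f a) zz > 0" if "a \<in> ?R" "y \<in> Z" for a y
  proof -
    have "0 \<le> secant (f a) (f a) (p u)" "0 \<le> secant (f a) (f a) (p v)" "0 \<le> secant (f a) (f a) (p w)"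
      using tangent_R(1)[OF that(1)] uvw[OF that(2)] by blast+
    moreover have "secant (f a) (f a) (p u) \<noteq> 0 \<or> secant (f a) (f a) (p v) \<noteq> 0"
      using tangent_R(2)[OF that(1)] uvw(1,2,4)[OF that(2)] by blast
    ultimately show ?thesis using zz[OF that(2), of "f a" "f a"] by auto
  qed
  have tangent: "secant (f a) (f a) (p x) \<ge> 0" "secant (f a) (f a) (p x) = 0 \<Longrightarrow> x = a"
    if a: "a \<in> ?R" and x: "x \<in> V" "x \<noteq> c" for a x
    using VR[OF x(1)] tangent_R[OF a, of x] tangent_Z[OF a, of x] p_Z x(2) by force+
  (* a segment between vertices other than c meets the edge from c to a at most in a *)
  have ray: "q = p a \<and> a \<in> {x, y}"
    if a: "a \<in> ?R" and xy: "x \<in> V" "y \<in> V" "x \<noteq> c" "y \<noteq> c" "x \<noteq> y"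
      and q: "q \<in> closed_segment (p x) (p y)" "secant (f a) (f a) q \<le> 0" for a x y q
  proof -
    consider "q = p x" "x = a" | "q = p y" "y = a" | "x = a" "y = a"
      using secant_zero_on_segment[OF q(1), of 1 "f a" "f a"] q(2) tangent[OF a xy(1,3)] tangent[OF a xy(2,4)]
      by auto
    then show ?thesis using xy(5) by cases auto
  qed
  have on_ray: "secant (f a) (f a) q \<le> 0" if a: "a \<in> ?R" and q: "q \<in> closed_segment (p c) (p a)" for a q
  proof -
    obtain t where t: "0 \<le> t" "t \<le> 1" "secant (f a) (f a) q = (1 - t) * secant (f a) (f a) (p c) + t * secant (f a) (f a) (p a)"
      using secant_segment[OF q] by metis
    then show ?thesis
      using tangent_R(2)[OF a a] f(1)[OF a] by (simp add: p_c secant_0 mult_le_0_iff)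
  qed
  (* as chords do not interleave, the secant of one does not separate the ends of another *)
  have side: "0 \<le> secant (f a) (f b) (p x) * secant (f a) (f b) (p y)"
    if "{a, b} \<in> E" "{x, y} \<in> E" "a \<in> ?R" "b \<in> ?R" "x \<in> ?R" "y \<in> ?R" for a b x y
  proof -
    have "0 \<le> ((f x - f a) * (f x - f b)) * ((f y - f a) * (f y - f b))"
    proof (rule ccontr)
      have E: "{a, b} \<in> E" "{b, a} \<in> E" "{x, y} \<in> E" "{y, x} \<in> E" using that by (simp_all add: insert_commute)
      have R: "{a, b, x, y} \<subseteq> ?R" using that by blast
      assume "\<not> ?thesis"
      then have neg: "((f x - f a) * (f x - f b)) * ((f y - f a) * (f y - f b)) < 0" by simp
      have *: False if "(f x - f a) * (f x - f b) < 0" "0 < (f y - f a) * (f y - f b)"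
        "{x, y} \<in> E" "{y, x} \<in> E" "{a, b, x, y} \<subseteq> ?R" for x y
      proof -
        have "f a < f x \<and> f x < f b \<or> f b < f x \<and> f x < f a" using that(1) by (auto simp: mult_less_0_iff)
        moreover have "f y < f a \<and> f y < f b \<or> f y > f a \<and> f y > f b" using that(2) by (auto simp: zero_less_mult_iff)
        ultimately show False
          using noncrossing[of a b x y] noncrossing[of b a x y] noncrossing[of y x a b] noncrossing[of y x b a]
            E(1,2) that(3-5) by (auto simp: insert_commute)
      qed
      from neg have "(f x - f a) * (f x - f b) < 0 \<and> 0 < (f y - f a) * (f y - f b) \<or>
          (f y - f a) * (f y - f b) < 0 \<and> 0 < (f x - f a) * (f x - f b)"
        unfolding mult_less_0_iff[of "(f x - f a) * (f x - f b)"] by blast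
      then show False using *[of x y] *[of y x] E R by (auto simp: insert_commute)
    qed
    then show ?thesis
      using f(1)[OF that(5)] f(1)[OF that(6)] that by (simp add: sec)
  qed
  have secant_zero: "secant (f a) (f b) (p x) = 0 \<longleftrightarrow> x = a \<or> x = b" if "a \<in> ?R" "b \<in> ?R" "x \<in> ?R" for a b x
    using sec[OF that(3), of a b] f(1)[OF that(3)] feq that by auto
  have on_chord: "secant (f a) (f b) q = 0" if "a \<in> ?R" "b \<in> ?R" "q \<in> closed_segment (p a) (p b)" for a b q
    using secant_segment[OF that(3)] secant_zero[of a b a] secant_zero[of a b b] that(1,2)
    by (metis add_cancel_right_left mult_zero_right)
  have chord_side: "0 \<le> s * secant (f a) (f b) (p x) \<and> 0 \<le> s * secant (f a) (f b) (p y)"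
    if "s = (if secant (f a) (f b) (p x) + secant (f a) (f b) (p y) \<ge> 0 then 1 else -1)"
      "{a, b} \<in> E" "{x, y} \<in> E" "a \<in> ?R" "b \<in> ?R" "x \<in> ?R" "y \<in> ?R" for a b x y s
    using side[OF that(2-)] that(1) by (auto simp: zero_le_mult_iff)
  (* the corners of the triangle are weakly on one side of any chord, so the centroid lies strictly on that side *)
  have z_side: "\<exists>s. 0 < s * secant (f a) (f b) zz \<and> (\<forall>x\<in>{u, v, w}. 0 \<le> s * secant (f a) (f b) (p x))"
    if "{a, b} \<in> E" "a \<in> ?R" "b \<in> ?R" "y \<in> Z" for a b y
  proof -
    let ?h = "\<lambda>x. secant (f a) (f b) (p x)"
    note U = uvw[OF that(4)]
    have "0 \<le> ?h u * ?h v" "0 \<le> ?h v * ?h w" "0 \<le> ?h u * ?h w"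
      using side[OF that(1) _ that(2,3)] U by blast+
    moreover have "?h u \<noteq> 0 \<or> ?h v \<noteq> 0 \<or> ?h w \<noteq> 0"
      using secant_zero[OF that(2,3)] U by metis
    ultimately consider "0 \<le> ?h u" "0 \<le> ?h v" "0 \<le> ?h w" "0 < ?h u + ?h v + ?h w"
      | "?h u \<le> 0" "?h v \<le> 0" "?h w \<le> 0" "?h u + ?h v + ?h w < 0"
      unfolding zero_le_mult_iff by linarith
    then show ?thesis
    proof cases
      case 1
      then show ?thesis using zz[OF that(4), of "f a" "f b"] by (intro exI[of _ 1]) auto
    next
      case 2
      then show ?thesis using zz[OF that(4), of "f a" "f b"] by (intro exI[of _ "-1"]) auto
    qed
  qed
  have chord_z: "q = p x \<and> x \<in> {a, b}"
    if E: "{a, b} \<in> E" "a \<in> ?R" "b \<in> ?R" "a \<noteq> b" and y: "y \<in> Z" and x: "x \<in> {u, v, w}"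
      and q: "q \<in> closed_segment (p a) (p b)" "q \<in> closed_segment (p y) (p x)" for a b x y q
  proof -
    obtain s where s: "0 < s * secant (f a) (f b) zz" "0 \<le> s * secant (f a) (f b) (p x)"
      using z_side[OF E(1-3) y] x by blast
    have xR: "x \<in> ?R" using x uvw[OF y] by blast
    have "q = p x \<and> s * secant (f a) (f b) (p x) = 0"
      using secant_zero_on_segment[OF q(2), of s "f a" "f b"] s on_chord[OF E(2,3) q(1)] p_Z[OF y] by auto
    moreover have "s \<noteq> 0" using s by auto
    ultimately show ?thesis using secant_zero[OF E(2,3) xR] by auto
  qed
  have z_z: "q = zz" if y: "y \<in> Z" and x: "x \<in> {u, v, w}" "x' \<in> {u, v, w}" "x \<noteq> x'"
    and q: "q \<in> closed_segment zz (p x)" "q \<in> closed_segment zz (p x')" for x x' y q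
  proof -
    note U = uvw[OF y]
    obtain x'' where x'': "x'' \<in> {u, v, w}" "x'' \<noteq> x" "x'' \<noteq> x'" "{x, x', x''} = {u, v, w}"
      using x U by auto
    have R: "x \<in> ?R" "x' \<in> ?R" "x'' \<in> ?R" using x x'' U by blast+
    let ?h = "secant (f x) (f x'')"
    have h: "?h (p x) = 0" "?h (p x'') = 0" "?h (p x') \<noteq> 0"
      using secant_zero[OF R(1,3)] R x x'' by auto
    have "?h (p u) + ?h (p v) + ?h (p w) = (\<Sum>i\<in>{u, v, w}. ?h (p i))" using U by simp
    also have "\<dots> = ?h (p x')" unfolding x''(4)[symmetric] using x x'' h by auto
    finally have hz: "?h zz = ?h (p x') / 3" using zz[OF y] by simp
    obtain t where t: "t \<le> 1" "0 \<le> t" "q = (1 - t) *\<^sub>R zz + t *\<^sub>R p x" "?h q = (1 - t) * ?h zz + t * ?h (p x)"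
      using secant_segment[OF q(1)] by metis
    obtain t' where t': "t' \<le> 1" "0 \<le> t'" "?h q = (1 - t') * ?h zz + t' * ?h (p x')"
      using secant_segment[OF q(2)] by metis
    have "?h (p x') * (1 - t) = ?h (p x') * (1 + 2 * t')"
      using t(4) t'(3) h(1) hz by (simp add: field_simps)
    then have "t = 0" using h(3) t t' by simp
    then show ?thesis using t(3) by simp
  qed
  (* every edge is a ray from c, a chord, or an edge at z *)
  have edge_cases: "(\<exists>a. {x, y} = {c, a} \<and> a \<in> ?R) \<or> (x \<in> ?R \<and> y \<in> ?R) \<or>
      (\<exists>a k. {x, y} = {k, a} \<and> k \<in> Z \<and> a \<in> {u, v, w} \<and> a \<in> ?R)" if "{x, y} \<in> E" "x \<noteq> y" for x y
  proof -
    have xyV: "x \<in> V" "y \<in> V" using edges[OF that(1)] by (auto simp: doubleton_eq_iff)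
    have yx: "{y, x} \<in> E" using that by (simp add: insert_commute)
    show ?thesis
    proof (cases "x \<in> Z \<or> y \<in> Z")
      case True
      then obtain k a where ka: "{x, y} = {k, a}" "{k, a} \<in> E" "k \<in> Z"
        using that yx by (metis insert_commute)
      have "a \<in> {u, v, w}" using Zy(1)[OF ka(2,3)] .
      moreover from this have "a \<in> ?R" using uvw(1-3)[OF ka(3)] by (elim insertE emptyE) simp_all
      ultimately show ?thesis using ka by (intro disjI2 exI conjI)
    next
      case False
      then show ?thesis using xyV that by blast
    qed
  qed
  have seg: "closed_segment (p x) (p y) = closed_segment (p x') (p y')" if "{x, y} = {x', y'}" for x y x' y'
    using that by (auto simp: doubleton_eq_iff closed_segment_commute)
  have Zc: "k \<noteq> c" "k \<in> V \<Longrightarrow> k \<notin> ?R" if "k \<in> Z" for k using that Z by auto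
  have chord_chord: "q \<in> p ` ({a, b} \<inter> {x, y})"
    if R: "a \<in> ?R" "b \<in> ?R" "x \<in> ?R" "y \<in> ?R" and E: "{a, b} \<in> E" "{x, y} \<in> E" "x \<noteq> y" "{a, b} \<noteq> {x, y}"
      and q: "q \<in> closed_segment (p a) (p b)" "q \<in> closed_segment (p x) (p y)" for a b x y q
  proof -
    define s :: real where "s = (if secant (f a) (f b) (p x) + secant (f a) (f b) (p y) \<ge> 0 then 1 else -1)"
    have s: "0 \<le> s * secant (f a) (f b) (p x)" "0 \<le> s * secant (f a) (f b) (p y)"
      using chord_side[OF s_def E(1,2) R] by auto
    have "s \<noteq> 0" by (simp add: s_def)
    then consider "q = p x" "x \<in> {a, b}" | "q = p y" "y \<in> {a, b}" | "x \<in> {a, b}" "y \<in> {a, b}"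
      using secant_zero_on_segment[OF q(2) s] on_chord[OF R(1,2) q(1)]
        secant_zero[OF R(1,2,3)] secant_zero[OF R(1,2,4)] by auto
    then show ?thesis
    proof cases
      case 3
      then have "{a, b} = {x, y}" using E(3) by auto
      then show ?thesis using E(4) by blast
    qed auto
  qed
  have ray_other: "q \<in> p ` ({c, a} \<inter> {x, y})"
    if a: "a \<in> ?R" and xy: "{x, y} \<in> E" "x \<noteq> y" "{c, a} \<noteq> {x, y}"
      and q: "q \<in> closed_segment (p c) (p a)" "q \<in> closed_segment (p x) (p y)" for a x y q
    using edge_cases[OF xy(1,2)]
  proof (elim disjE exE conjE)
    fix b assume b: "{x, y} = {c, b}" "b \<in> ?R"
    then have "a \<noteq> b" using xy by auto
    then have "q = 0"
      using hyperbola_rays_meet[of "f a" "f b" q] f(1) a b(2) feq[OF a b(2)] q seg[OF b(1)]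
      by (simp add: p_c p_R)
    then show ?thesis unfolding b(1) by (simp add: p_c)
  next
    assume xyR: "x \<in> ?R" "y \<in> ?R"
    have "q = p a \<and> a \<in> {x, y}"
      by (rule ray[OF a _ _ _ _ xy(2) q(2) on_ray[OF a q(1)]]) (use xyR in auto)
    then show ?thesis by blast
  next
    fix b k assume b: "{x, y} = {k, b}" "k \<in> Z" "b \<in> ?R"
    have "k \<in> V" using edges[OF xy(1)] b(1) by (auto simp: doubleton_eq_iff)
    then have "q = p a \<and> a \<in> {k, b}"
      using q seg[OF b(1)] on_ray[OF a q(1)] b Zc(1)[OF b(2)]
      by (intro ray[OF a]) auto
    then show ?thesis using b(1) by blast
  qed
  have z_other: "q \<in> p ` ({k, a} \<inter> {x, y})"
    if k: "k \<in> Z" "a \<in> {u, v, w}" and xy: "{x, y} \<in> E" "x \<noteq> y" "{k, a} \<noteq> {x, y}" "c \<notin> {x, y}"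
      and q: "q \<in> closed_segment (p k) (p a)" "q \<in> closed_segment (p x) (p y)" for a k x y q
    using edge_cases[OF xy(1,2)]
  proof (elim disjE exE conjE)
    fix b assume b: "{x, y} = {c, b}"
    then show ?thesis using xy(4) by auto
  next
    assume xyR: "x \<in> ?R" "y \<in> ?R"
    have "q = p a \<and> a \<in> {x, y}" using chord_z[OF xy(1) xyR xy(2) k q(2,1)] .
    then show ?thesis by blast
  next
    fix b k' assume b: "{x, y} = {k', b}" "k' \<in> Z" "b \<in> {u, v, w}"
    have "k' = k" using Zsing b k by blast
    then have "b \<noteq> a" using b(1) xy(3) by auto
    then have "a \<noteq> b" by simp
    moreover have "q \<in> closed_segment zz (p a)" "q \<in> closed_segment zz (p b)"
      using q(1) q(2)[unfolded seg[OF b(1)]] by (simp_all add: p_Z k(1) b(2))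
    ultimately have "q = p k"
      using z_z[OF k(1,2) b(3)] p_Z[OF k(1)] by simp
    then show ?thesis unfolding b(1) \<open>k' = k\<close> by blast
  qed
  have edge_c: "\<exists>a\<in>?R. {x, y} = {c, a}" if E: "{x, y} \<in> E" "x \<noteq> y" and c: "c \<in> {x, y}" for x y
    using edge_cases[OF E]
  proof (elim disjE exE conjE)
    fix k a assume k: "{x, y} = {k, a}" "k \<in> Z" "a \<in> ?R"
    then show ?thesis using c Zc(1)[OF k(2)] by auto
  qed (use c in auto)
  have edge_nc: "x \<in> ?R \<and> y \<in> ?R \<or> (\<exists>k\<in>Z. \<exists>a\<in>{u, v, w}. {x, y} = {k, a} \<and> a \<in> ?R)"
    if E: "{x, y} \<in> E" "x \<noteq> y" and c: "c \<notin> {x, y}" for x y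
    using edge_cases[OF E]
  proof (elim disjE exE conjE)
    fix k a assume k: "{x, y} = {k, a}" "k \<in> Z" "a \<in> {u, v, w}" "a \<in> ?R"
    then show ?thesis by (intro disjI2 bexI[of _ k] bexI[of _ a] conjI)
  qed (use c in simp_all)
  have cross: "q \<in> p ` ({a, b} \<inter> {x, y})"
    if E: "{a, b} \<in> E" "{x, y} \<in> E" "a \<noteq> b" "x \<noteq> y" "{a, b} \<noteq> {x, y}"
      and q: "q \<in> closed_segment (p a) (p b)" "q \<in> closed_segment (p x) (p y)" for a b x y q
  proof -
    consider (ray1) d where "{a, b} = {c, d}" "d \<in> ?R" | (ray2) d where "{x, y} = {c, d}" "d \<in> ?R"
      | (no) "c \<notin> {a, b}" "c \<notin> {x, y}"
      using edge_c[OF E(1,3)] edge_c[OF E(2,4)] by meson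
    then show ?thesis
    proof cases
      case ray1
      have "{c, d} \<noteq> {x, y}" using ray1(1) E(5) by simp
      then have "q \<in> p ` ({c, d} \<inter> {x, y})"
        using ray_other[OF ray1(2) E(2,4) _ _ q(2)] q(1)[unfolded seg[OF ray1(1)]] by simp
      then show ?thesis unfolding ray1(1) .
    next
      case ray2
      have "{c, d} \<noteq> {a, b}" using ray2(1) E(5) by simp
      then have "q \<in> p ` ({c, d} \<inter> {a, b})"
        using ray_other[OF ray2(2) E(1,3) _ _ q(1)] q(2)[unfolded seg[OF ray2(1)]] by simp
      then show ?thesis unfolding ray2(1) by (simp add: Int_commute)
    next
      case no
      consider (z1) k d where "{a, b} = {k, d}" "k \<in> Z" "d \<in> {u, v, w}"
        | (z2) k d where "{x, y} = {k, d}" "k \<in> Z" "d \<in> {u, v, w}" | (c) "a \<in> ?R" "b \<in> ?R" "x \<in> ?R" "y \<in> ?R"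
        using edge_nc[OF E(1,3) no(1)] edge_nc[OF E(2,4) no(2)] by meson
      then show ?thesis
      proof cases
        case z1
        have "{k, d} \<noteq> {x, y}" using z1(1) E(5) by simp
        then have "q \<in> p ` ({k, d} \<inter> {x, y})"
          using z_other[OF z1(2,3) E(2,4) _ no(2) _ q(2)] q(1)[unfolded seg[OF z1(1)]] by simp
        then show ?thesis unfolding z1(1) .
      next
        case z2
        have "{k, d} \<noteq> {a, b}" using z2(1) E(5) by simp
        then have "q \<in> p ` ({k, d} \<inter> {a, b})"
          using z_other[OF z2(2,3) E(1,3) _ no(1) _ q(1)] q(2)[unfolded seg[OF z2(1)]] by simp
        then show ?thesis unfolding z2(1) by (simp add: Int_commute)
      next
        case c
        then show ?thesis by (rule chord_chord[OF _ _ _ _ E(1,2,4,5) q])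
      qed
    qed
  qed
  have neg_c: "secant (f a) (f a) (p c) < 0" if "a \<in> ?R" for a
    using f(1)[OF that] by (simp add: p_c secant_0)
  have vert: "m \<in> {x, y}"
    if E: "{x, y} \<in> E" "x \<noteq> y" and m: "m \<in> V" "p m \<in> closed_segment (p x) (p y)" for x y m
  proof (cases "c \<in> {x, y}")
    case True
    obtain a where a: "a \<in> ?R" "{x, y} = {c, a}" using edge_c[OF E True] by (elim bexE)
    have "secant (f a) (f a) (p m) \<le> 0"
      using on_ray[OF a(1)] m(2)[unfolded seg[OF a(2)]] .
    then have "m = c \<or> m = a" using tangent[OF a(1) m(1)] by force
    then show ?thesis unfolding a(2) by simp
  next
    case False
    then have cxy: "x \<noteq> c" "y \<noteq> c" by auto
    have xyV: "x \<in> V" "y \<in> V" using edges[OF E(1)] by (auto simp: doubleton_eq_iff)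
    obtain a where a: "a \<in> ?R" "a \<in> {x, y}"
      using edge_nc[OF E False]
    proof (elim disjE bexE conjE)
      fix k a assume "{x, y} = {k, a}" "a \<in> ?R"
      then show ?thesis using that[of a] by simp
    qed (use that[of x] in simp)
    have "m \<noteq> c"
    proof
      assume "m = c"
      then show False
        using ray[OF a(1) xyV cxy E(2) m(2)] neg_c[OF a(1)] tangent(1)[OF a(1), of a] a(1) by auto
    qed
    then consider "m \<in> ?R" | "m \<in> Z" using m(1) by blast
    then show ?thesis
    proof cases
      case 1
      have "secant (f m) (f m) (p m) \<le> 0" using tangent_R(2)[OF 1 1] by simp
      then show ?thesis using ray[OF 1 xyV cxy E(2) m(2)] by blast
    next
      case 2
      show ?thesis
        using edge_nc[OF E False]
      proof (elim disjE bexE conjE)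
        assume R: "x \<in> ?R" "y \<in> ?R"
        obtain s where "0 < s * secant (f x) (f y) zz" using z_side[OF E(1) R 2] by blast
        then show ?thesis using on_chord[OF R m(2)] p_Z[OF 2] by simp
      next
        fix k a assume k: "k \<in> Z" "{x, y} = {k, a}"
        then show ?thesis using Zsing[OF 2 k(1)] by simp
      qed
    qed
  qed
  have inj: "inj_on p V"
  proof (rule inj_onI, rule ccontr)
    have no: "p x \<noteq> p y" if "x \<in> ?R" "y \<in> V" "x \<noteq> y" for x y
      using tangent[OF that(1,2)] tangent_R(2)[OF that(1) that(1)] neg_c[OF that(1)] that(3) by force
    fix x y assume xy: "x \<in> V" "y \<in> V" "p x = p y" "x \<noteq> y"
    then have xR: "x \<notin> ?R" "y \<notin> ?R" using no[of x y] no[of y x] by auto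
    have "p k \<noteq> p c" if "k \<in> Z" for k
      using tangent_Z[OF uvw(1)[OF that] that] neg_c[OF uvw(1)[OF that]] p_Z[OF that] by force
    then show False using VR[OF xy(1)] VR[OF xy(2)] xR xy(3,4) Zsing[of x y] by metis
  qed
  have "\<exists>\<gamma>. plane_drawing V E p \<gamma>"
    by (rule straight_line_drawing[OF edges inj vert cross])
  then show ?thesis by blast
qed

text \<open>
  The vertices other than \<open>c\<close> and \<open>z\<close> are grouped into blocks, \<open>r\<close> being the number of the block of a
  vertex and \<open>q\<close> its place in the block.  Edges stay within blocks and are of three kinds: they join
  consecutive places, or start at place \<open>2\<close>, or go from place \<open>0\<close> or \<open>1\<close> to the end of the block.
  Such chords do not interleave if the vertices are placed in lexicographic order.
\<close>

lemma block_fan_drawing: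
  fixes r q :: "'a \<Rightarrow> nat"
  assumes fin: "finite V"
    and edges: "\<And>e. e \<in> E \<Longrightarrow> \<exists>x\<in>V. \<exists>y\<in>V. e = {x, y} \<and> x \<noteq> y"
    and inj: "inj_on (\<lambda>x. (r x, q x)) (V - {c} - Z)"
    and block: "\<And>x y. {x, y} \<in> E \<Longrightarrow> {x, y} \<subseteq> V - {c} - Z \<Longrightarrow> r x = r y"
    and chord: "\<And>x y. {x, y} \<in> E \<Longrightarrow> {x, y} \<subseteq> V - {c} - Z \<Longrightarrow> q x < q y \<Longrightarrow>
        q y = Suc (q x) \<or> q x = 2 \<or> q x < 2 \<and> (\<forall>m\<in>V - {c} - Z. r m = r x \<longrightarrow> q m \<le> q y)"
    and Z: "Z = {} \<or> Z = {z} \<and> z \<noteq> c \<and> {u, v, w} \<subseteq> V - {c} - Z \<and> distinct [u, v, w] \<and>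
        {u, v} \<in> E \<and> {v, w} \<in> E \<and> {u, w} \<in> E \<and> (\<forall>y. {z, y} \<in> E \<longrightarrow> y \<in> {u, v, w})"
  shows "\<exists>p \<gamma>. plane_drawing V E p \<gamma>"
proof -
  (* M exceeds all places, so k encodes the lexicographic order of (r, q) *)
  define M where "M = Suc (\<Sum>x\<in>V. q x)"
  have qM: "q x < M" if "x \<in> V" for x
    using member_le_sum[of x V q] that fin by (simp add: M_def)
  define k where "k x = r x * M + q x" for x
  have k_less: "k x < k y \<longleftrightarrow> r x < r y \<or> r x = r y \<and> q x < q y" if "x \<in> V" "y \<in> V" for x y
  proof -
    have less: "k x < k y" if "r x < r y" "x \<in> V" for x y
    proof -
      have "k x < Suc (r x) * M" using qM[OF that(2)] by (simp add: k_def)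
      also have "\<dots> \<le> r y * M" using that(1) by (intro mult_le_mono1) simp
      finally show ?thesis by (simp add: k_def)
    qed
    show ?thesis
    proof (cases "r x = r y")
      case False
      then show ?thesis using less[of x y] less[of y x] that by force
    qed (simp add: k_def)
  qed
  define f where "f x = real (Suc (k x))" for x
  show ?thesis
  proof (rule hyperbola_fan_drawing[where f = f, OF edges _ _ _ Z])
    show "f x > 0" for x by (simp add: f_def)
    show "inj_on f (V - {c} - Z)"
    proof (rule inj_onI)
      fix x y assume xy: "x \<in> V - {c} - Z" "y \<in> V - {c} - Z" "f x = f y"
      then have "r x = r y \<and> q x = q y"
        using k_less[of x y] k_less[of y x] by (auto simp: f_def)
      then show "x = y" using inj xy by (auto simp: inj_on_def)
    qed
    fix x y x' y'
    assume E: "{x, y} \<in> E" "{x', y'} \<in> E" and R: "{x, y, x', y'} \<subseteq> V - {c} - Z"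
    show "\<not> (f x < f x' \<and> f x' < f y \<and> f y < f y')"
    proof
      assume "f x < f x' \<and> f x' < f y \<and> f y < f y'"
      then have "k x < k x'" "k x' < k y" "k y < k y'" by (auto simp: f_def)
      moreover have "r x = r y" "r x' = r y'" using block E R by auto
      moreover have "k x < k x' \<longleftrightarrow> r x < r x' \<or> r x = r x' \<and> q x < q x'"
        "k x' < k y \<longleftrightarrow> r x' < r y \<or> r x' = r y \<and> q x' < q y"
        "k y < k y' \<longleftrightarrow> r y < r y' \<or> r y = r y' \<and> q y < q y'"
        using R by (auto intro!: k_less)
      ultimately have lt: "q x < q x'" "q x' < q y" "q y < q y'" "r x' = r x" "r y' = r x"
        by linarith+
      have "q y = Suc (q x) \<or> q x = 2 \<or> q x < 2 \<and> (\<forall>m\<in>V - {c} - Z. r m = r x \<longrightarrow> q m \<le> q y)"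
        by (rule chord[OF E(1)]) (use R lt in simp_all)
      moreover have "q y' = Suc (q x') \<or> q x' = 2 \<or> q x' < 2 \<and> (\<forall>m\<in>V - {c} - Z. r m = r x' \<longrightarrow> q m \<le> q y')"
        by (rule chord[OF E(2)]) (use R lt in simp_all)
      moreover have "q y' \<le> q y" if "\<forall>m\<in>V - {c} - Z. r m = r x \<longrightarrow> q m \<le> q y"
        using bspec[OF that, of y'] R lt(5) by simp
      ultimately show False using lt by linarith
    qed
  qed
qed

section \<open>Power graphs with few large orders\<close>

context group
begin

lemma generate_singleton_subset:
  assumes "x \<in> carrier G" "y \<in> generate G {x}"
  shows "generate G {y} \<subseteq> generate G {x}"
  by (rule generate_subgroup_incl[OF _ generate_is_subgroup]) (use assms in auto)

lemma mem_generate_self: "x \<in> generate G {x}"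
  by (rule generate.incl) simp

lemma generate_singleton_carrier: "x \<in> carrier G \<Longrightarrow> generate G {x} \<subseteq> carrier G"
  by (rule generate_incl) simp

lemma pow_mem_generate: "x \<in> carrier G \<Longrightarrow> x [^] (k::nat) \<in> generate G {x}"
  using generate_pow[of x] int_pow_int[of G x k] by (metis (mono_tags, lifting) UNIV_I mem_Collect_eq)

lemma inv_mem_generate: "x \<in> carrier G \<Longrightarrow> inv x \<in> generate G {x}"
  by (rule generate.inv) simp

lemma generate_singleton_eq_pow_image:
  assumes "x \<in> carrier G" "ord x \<noteq> 0"
  shows "generate G {x} = (\<lambda>k. x [^] k) ` {..<ord x}"
  using generate_pow_nat[OF assms] ord_elems_inf_carrier[OF assms] assms(2)
  by (auto simp: image_iff)

lemma finite_generate_singleton: "x \<in> carrier G \<Longrightarrow> ord x \<noteq> 0 \<Longrightarrow> finite (generate G {x})"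
  by (simp add: generate_singleton_eq_pow_image)

lemma pow_ord_minus_1:
  assumes "x \<in> carrier G" "ord x = Suc n"
  shows "x [^] n = inv x"
  using pow_ord_eq_1[OF assms(1)] assms by (intro inv_equality[symmetric]) auto

lemma power_graph_edge_iff:
  "{x, y} \<in> power_graph_edges G \<longleftrightarrow> x \<in> carrier G \<and> y \<in> carrier G \<and> x \<noteq> y \<and>
     (x \<in> generate G {y} \<or> y \<in> generate G {x})"
  unfolding power_graph_edges_def by (auto simp: doubleton_eq_iff)

lemma small_order_generate_cases:
  assumes w: "w \<in> carrier G" "ord w \<in> {1, 2, 3, 4}"
    and v: "v \<in> generate G {w}" "v \<noteq> \<one>" "v \<noteq> w"
  shows "ord w \<in> {3, 4} \<and> v = inv w \<or> ord w = 4 \<and> v = w \<otimes> w"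
proof -
  have "ord w \<noteq> 0" using w(2) by auto
  then obtain k where k: "v = w [^] k" "k < ord w"
    using v(1) generate_singleton_eq_pow_image[OF w(1)] by auto
  have "k \<noteq> 0" using k v(2) by (metis nat_pow_0)
  moreover have "k \<noteq> 1" using k v(3) w(1) by auto
  ultimately consider "ord w = 3" "k = 2" | "ord w = 4" "k = 2" | "ord w = 4" "k = 3"
    using w(2) k(2) by force
  then show ?thesis
    using pow_ord_minus_1[OF w(1), of 2] pow_ord_minus_1[OF w(1), of 3] k(1) w(1)
    by cases (auto simp: numeral_2_eq_2)
qed

lemma inv_neq_self: "x \<in> carrier G \<Longrightarrow> ord x > 2 \<Longrightarrow> inv x \<noteq> x"
proof
  assume x: "x \<in> carrier G" "ord x > 2" "inv x = x"
  then have "x [^] (2::nat) = \<one>" using r_inv[OF x(1)] by (simp add: numeral_2_eq_2)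
  then show False using x pow_eq_id[OF x(1), of 2] by (auto dest: dvd_imp_le)
qed

text \<open>
  Let all elements outside \<open>X\<close> have order at most \<open>4\<close>, where \<open>X\<close> is finite and closed under passing to
  generated subgroups.  Apart from the identity, which is adjacent to everything, an element \<open>x\<close> of order \<open>3\<close>
  outside \<open>X\<close> is adjacent to its inverse only, and one of order \<open>4\<close> to its inverse and its square.  So the
  pairs \<open>{x, inv x}\<close> of order \<open>4\<close> are blades of windmills, whose centres are the involutions.  An involution
  has place \<open>2\<close> in its block, followed by its pairs.  The elements of \<open>X\<close> belong to the block of \<open>t\<close>; their
  places are given by \<open>pos\<close>, where \<open>3\<close> stands for the end of the block.  Any two of these four places may
  be joined, except \<open>0\<close> and \<open>2\<close>.
\<close>

lemma windmill_planar:
  assumes X: "X \<subseteq> carrier G" "finite X" "\<one> \<in> X" "\<And>x. x \<in> X \<Longrightarrow> generate G {x} \<subseteq> X"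
    and outer: "\<And>g. g \<in> carrier G - X \<Longrightarrow> ord g \<in> {1, 2, 3, 4}"
    and E: "E \<subseteq> power_graph_edges G"
    and t: "t \<in> X"
    and pos: "inj_on pos (X - {\<one>} - Z)" "pos ` (X - {\<one>} - Z) \<subseteq> {0, 1, 2, 3::nat}"
    and involution: "\<And>x. x \<in> X \<Longrightarrow> ord x = 2 \<Longrightarrow> x = t \<and> x \<notin> Z \<and> pos x = 2"
    and pos02: "\<And>x y. x \<in> X - {\<one>} - Z \<Longrightarrow> y \<in> X - {\<one>} - Z \<Longrightarrow> pos x = 0 \<Longrightarrow> pos y = 2 \<Longrightarrow> {x, y} \<notin> E"
    and Z: "Z = {} \<or> Z = {z} \<and> z \<in> X \<and> z \<noteq> \<one> \<and> {u, v, w} \<subseteq> X - {\<one>} - Z \<and> distinct [u, v, w] \<and>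
        {u, v} \<in> E \<and> {v, w} \<in> E \<and> {u, w} \<in> E \<and> (\<forall>y\<in>X. {z, y} \<in> E \<longrightarrow> y \<in> {u, v, w})"
  shows "planar (carrier G) E"
  unfolding planar_def
proof (intro allI impI, elim conjE)
  fix W F assume W: "finite W" "W \<subseteq> carrier G" and F: "F \<subseteq> E" "F \<subseteq> Pow W"
  (* squares and inverses must be present for the blades to be complete *)
  define V where "V = (\<Union>x\<in>W \<union> X. generate G {x})"
  have WV: "W \<subseteq> V" "X \<subseteq> V" unfolding V_def using mem_generate_self by auto
  have VG: "V \<subseteq> carrier G" using generate_singleton_carrier W X(1) by (auto simp: V_def)
  have Vgen: "generate G {x} \<subseteq> V" if x: "x \<in> V" for x
  proof -
    obtain y where y: "y \<in> W \<union> X" "x \<in> generate G {y}" using x unfolding V_def by blast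
    then have "generate G {x} \<subseteq> generate G {y}" using W X(1) by (intro generate_singleton_subset) auto
    then show ?thesis using y(1) by (auto simp: V_def)
  qed
  have "finite (generate G {x})" if "x \<in> W \<union> X" for x
  proof (cases "x \<in> X")
    case True
    then show ?thesis using X(2,4) finite_subset by blast
  next
    case False
    then have "x \<in> carrier G - X" using that W(2) by blast
    then show ?thesis using outer[of x] by (intro finite_generate_singleton) auto
  qed
  then have finV: "finite V" unfolding V_def using W(1) X(2) by blast
  obtain c :: "'a \<Rightarrow> nat" and n where c: "c ` V = {i. i < n}" "inj_on c V"
    using finite_imp_inj_to_nat_seg[OF finV] by blast
  have ceq: "c x = c y \<longleftrightarrow> x = y" if "x \<in> V" "y \<in> V" for x y
    using c(2) that by (auto simp: inj_on_def)
  have cn: "c x < n" if "x \<in> V" for x using c(1) that by blast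
  have invV: "inv x \<in> V" if "x \<in> V" for x
    using Vgen[OF that] inv_mem_generate VG that by blast
  have sqV: "x \<otimes> x \<in> V" if "x \<in> V" for x
    using Vgen[OF that] pow_mem_generate[of x 2] VG that by (auto simp: numeral_2_eq_2)
  have invX: "inv x \<in> X \<longleftrightarrow> x \<in> X" if "x \<in> V" for x
    using X(1,4) inv_mem_generate[of x] inv_mem_generate[of "inv x"] VG that inv_inv[of x] by (metis inv_closed subsetD)
  (* a number for each pair of mutually inverse elements *)
  define mi where "mi x = min (c x) (c (inv x))" for x
  define r where "r x = (if x \<in> X then c t else if ord x = 4 then c (x \<otimes> x) else if ord x = 2 then c x else mi x)" for x
  (* c takes values below n, so 2 * n + 6 exceeds the places of all elements outside X *)
  define q where "q x = (if x \<in> X then (if pos x = 3 then 2 * n + 6 else pos x) else if ord x = 2 then 2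
      else 4 + 2 * mi x + (if c x < c (inv x) then 0 else 1))" for x
  let ?R = "V - {\<one>} - Z"
  have ordR: "ord x \<in> {2, 3, 4}" if "x \<in> ?R" "x \<notin> X" for x
    using outer[of x] that VG ord_eq_1[of x] by auto
  have ord_sq: "ord (x \<otimes> x) = 2" if "x \<in> V" "ord x = 4" for x
  proof -
    have x: "x \<in> carrier G" using that(1) VG by blast
    have "x \<otimes> x = x [^] (2::nat)" using x by (simp add: numeral_2_eq_2)
    then show ?thesis using ord_pow[OF x, of 2] that(2) by simp
  qed
  have mi_eq: "mi x = mi y \<longleftrightarrow> x = y \<or> x = inv y" if "x \<in> V" "y \<in> V" for x y
  proof -
    have "inv x \<in> V" "inv y \<in> V" "inv (inv x) = x" "inv (inv y) = y" using that invV VG by auto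
    then have "c x = c y \<longleftrightarrow> x = y" "c x = c (inv y) \<longleftrightarrow> x = inv y" "c (inv x) = c y \<longleftrightarrow> x = inv y"
      "c (inv x) = c (inv y) \<longleftrightarrow> x = y"
      using that ceq by metis+
    then show ?thesis unfolding mi_def min_def by auto
  qed
  have mi_inv: "mi (inv x) = mi x" if "x \<in> V" for x
    using that VG inv_inv[of x] by (auto simp: mi_def min.commute)
  have mi_n: "mi x < n" if "x \<in> V" for x using cn[OF that] by (simp add: mi_def)
  have bit: "c (inv x) < c x \<longleftrightarrow> \<not> c x < c (inv x)" if "x \<in> V" "ord x > 2" for x
    using inv_neq_self[of x] that VG ceq[OF invV[OF that(1)] that(1)] by auto
  (* an edge that is not within X joins an element to its inverse or to its square *)
  have chord_cases: "x \<in> X \<and> y \<in> X \<or> x \<notin> X \<and> y = inv x \<and> ord x \<in> {3, 4} \<or>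
      x \<notin> X \<and> y = x \<otimes> x \<and> ord x = 4 \<or> y \<notin> X \<and> x = y \<otimes> y \<and> ord y = 4"
    if e: "{x, y} \<in> E" and xy: "x \<in> V" "y \<in> V" "x \<noteq> \<one>" "y \<noteq> \<one>" for x y
  proof -
    have *: "x \<in> X \<and> y \<in> X \<or> x \<notin> X \<and> y = inv x \<and> ord x \<in> {3, 4} \<or> x \<notin> X \<and> y = x \<otimes> x \<and> ord x = 4"
      if "x \<in> V" "y \<noteq> \<one>" "y \<noteq> x" "y \<in> generate G {x}" for x y
      using small_order_generate_cases[of x y] outer[of x] X(4)[of x] that VG by blast
    have inv: "x = inv y \<Longrightarrow> y = inv x \<and> ord x = ord y \<and> (x \<notin> X \<longleftrightarrow> y \<notin> X)"
      using xy VG invX[OF xy(2)] by auto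
    have ne: "x \<noteq> y" and or: "x \<in> generate G {y} \<or> y \<in> generate G {x}"
      using e E power_graph_edge_iff by blast+
    show ?thesis
    proof (cases "y \<in> generate G {x}")
      case True
      then show ?thesis using *[OF xy(1,4) ne[symmetric] True] by argo
    next
      case False
      then have "x \<in> generate G {y}" using or by simp
      from *[OF xy(2,3) ne this] show ?thesis
        by (elim disjE) (use inv in simp_all)
    qed
  qed
  have rq_inv: "r (inv x) = r x \<and> (q (inv x) = Suc (q x) \<or> q x = Suc (q (inv x)))"
    if x: "x \<in> ?R" "x \<notin> X" "ord x \<in> {3, 4}" for x
  proof -
    have xV: "x \<in> V" "x \<in> carrier G" using x VG by auto
    have "inv x \<otimes> inv x = x \<otimes> x" if "ord x = 4"
    proof -
      have "(x \<otimes> x) \<otimes> (x \<otimes> x) = \<one>"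
        using pow_ord_eq_1[OF xV(2)] that xV(2) by (simp add: numeral_eq_Suc m_assoc)
      then have "inv (x \<otimes> x) = x \<otimes> x" using xV(2) by (intro inv_equality) auto
      then show ?thesis using xV(2) by (simp add: inv_mult_group)
    qed
    then show ?thesis
      using x(2,3) xV bit[OF xV(1)] invX[OF xV(1)] mi_inv[OF xV(1)] by (auto simp: r_def q_def)
  qed
  have q_ge4: "4 \<le> q x" "q x < 2 * n + 6" if "x \<in> V" "x \<notin> X" "ord x \<noteq> 2" for x
    using mi_n[OF that(1)] that by (auto simp: q_def)
  have rq_sq: "r (x \<otimes> x) = r x" "q (x \<otimes> x) = 2" "2 < q x" if x: "x \<in> ?R" "x \<notin> X" "ord x = 4" for x
  proof -
    have xV: "x \<in> V" using x VG by auto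
    show "r (x \<otimes> x) = r x" "q (x \<otimes> x) = 2"
      using involution[of "x \<otimes> x"] ord_sq[OF xV x(3)] x by (auto simp: r_def q_def)
    show "2 < q x" using q_ge4[OF xV x(2)] x(3) by simp
  qed
  have "\<exists>p \<gamma>. plane_drawing V {e \<in> E. e \<subseteq> V} p \<gamma>"
  proof (rule block_fan_drawing[OF finV, where c = \<one> and r = r and q = q and Z = Z])
    show "\<exists>x\<in>V. \<exists>y\<in>V. e = {x, y} \<and> x \<noteq> y" if "e \<in> {e \<in> E. e \<subseteq> V}" for e
    proof -
      have "e \<in> power_graph_edges G" using that E by blast
      then show ?thesis using that unfolding power_graph_edges_def by blast
    qed
    show "inj_on (\<lambda>x. (r x, q x)) ?R"
    proof (rule inj_onI)
      fix x y assume x: "x \<in> ?R" and y: "y \<in> ?R" and eq: "(r x, q x) = (r y, q y)"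
      have qX: "q x \<in> {0, 1, 2, 2 * n + 6}" if "x \<in> X" "x \<in> ?R" for x
        using pos(2) that by (auto simp: q_def)
      have mixed: False if "x \<in> X" "y \<notin> X" "x \<in> ?R" "y \<in> ?R" "r x = r y" "q x = q y" for x y
      proof (cases "ord y = 2")
        case True
        then have "c t = c y" using that by (auto simp: r_def)
        then show False using ceq[of t y] t WV that by auto
      next
        case False
        then show False using q_ge4[of y] qX[of x] that by auto
      qed
      have outside: "x = y" if "x \<in> ?R" "y \<in> ?R" "x \<notin> X" "y \<notin> X" "r x = r y" "q x = q y" for x y
      proof (cases "ord x = 2")
        case True
        then have "q x = 2" using that by (simp add: q_def)
        then have "ord y = 2" using q_ge4(1)[of y] that(2,4,6) by force
        then have "c x = c y" using that True by (auto simp: r_def)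
        then show ?thesis using ceq that by auto
      next
        case False
        then have "4 \<le> q y" using q_ge4(1)[of x] that by force
        then have y2: "ord y \<noteq> 2" using that(4) by (auto simp: q_def)
        have q: "2 * mi x + (if c x < c (inv x) then 0 else 1) = 2 * mi y + (if c y < c (inv y) then 0 else 1)"
          using that False y2 by (simp add: q_def)
        then have "mi x = mi y" "c x < c (inv x) \<longleftrightarrow> c y < c (inv y)"
          by (auto split: if_splits) presburger+
        then have "x = y \<or> x = inv y" using mi_eq that by auto
        moreover have "x \<noteq> inv y"
        proof
          assume xy: "x = inv y"
          have "ord y > 2" using ordR[of y] that y2 by auto
          then show False
            using bit[of y] xy \<open>c x < c (inv x) \<longleftrightarrow> c y < c (inv y)\<close> inv_inv[of y] that VG by auto
        qed
        ultimately show ?thesis by blast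
      qed
      show "x = y"
      proof (cases "x \<in> X \<and> y \<in> X")
        case True
        then have "pos x \<in> {0, 1, 2, 3}" "pos y \<in> {0, 1, 2, 3}" using pos(2) x y by auto
        then have "pos x = pos y" using eq True by (auto simp: q_def split: if_splits)
        then show ?thesis using pos(1) x y True by (auto simp: inj_on_def)
      next
        case False
        then show ?thesis using mixed[of x y] mixed[of y x] outside[OF x y] x y eq by auto
      qed
    qed
    show "r x = r y" if "{x, y} \<in> {e \<in> E. e \<subseteq> V}" "{x, y} \<subseteq> ?R" for x y
    proof -
      have xy: "x \<in> V" "y \<in> V" "x \<noteq> \<one>" "y \<noteq> \<one>" "{x, y} \<in> E" "x \<in> ?R" "y \<in> ?R" using that by auto
      show ?thesis
        using chord_cases[OF xy(5,1-4)] rq_inv[OF xy(6)] rq_sq(1)[OF xy(6)] rq_sq(1)[OF xy(7)]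
        by (elim disjE conjE) (simp_all add: r_def)
    qed
    show "q y = Suc (q x) \<or> q x = 2 \<or> q x < 2 \<and> (\<forall>m\<in>?R. r m = r x \<longrightarrow> q m \<le> q y)"
      if "{x, y} \<in> {e \<in> E. e \<subseteq> V}" "{x, y} \<subseteq> ?R" "q x < q y" for x y
    proof -
      have xy: "x \<in> V" "y \<in> V" "x \<noteq> \<one>" "y \<noteq> \<one>" "{x, y} \<in> E" "x \<in> ?R" "y \<in> ?R" using that by auto
      show ?thesis
        using chord_cases[OF xy(5,1-4)]
      proof (elim disjE conjE)
        assume "x \<in> X" "y \<in> X"
        then have p: "pos x \<in> {0, 1, 2, 3}" "pos y \<in> {0, 1, 2, 3}" "\<not> (pos x = 0 \<and> pos y = 2)"
          using pos(2) pos02[of x y] xy by auto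
        have "q m \<le> 2 * n + 6" if "m \<in> ?R" for m
          using q_ge4(2)[of m] pos(2) that by (cases "m \<in> X"; cases "ord m = 2") (auto simp: q_def)
        then show ?thesis using p \<open>x \<in> X\<close> \<open>y \<in> X\<close> that(3) by (auto simp: q_def split: if_splits)
      next
        assume "x \<notin> X" "y = inv x" "ord x \<in> {3, 4}"
        then show ?thesis using rq_inv[OF xy(6)] that(3) by auto
      next
        assume "x \<notin> X" "y = x \<otimes> x" "ord x = 4"
        then show ?thesis using rq_sq[OF xy(6)] that(3) by auto
      next
        assume "y \<notin> X" "x = y \<otimes> y" "ord y = 4"
        then show ?thesis using rq_sq[OF xy(7)] by auto
      qed
    qed
    show "Z = {} \<or> Z = {z} \<and> z \<noteq> \<one> \<and> {u, v, w} \<subseteq> ?R \<and> distinct [u, v, w] \<and>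
        {u, v} \<in> {e \<in> E. e \<subseteq> V} \<and> {v, w} \<in> {e \<in> E. e \<subseteq> V} \<and> {u, w} \<in> {e \<in> E. e \<subseteq> V} \<and>
        (\<forall>y. {z, y} \<in> {e \<in> E. e \<subseteq> V} \<longrightarrow> y \<in> {u, v, w})"
      using Z
    proof (elim disjE conjE)
      assume Z: "Z = {z}" "z \<in> X" "z \<noteq> \<one>" "{u, v, w} \<subseteq> X - {\<one>} - Z" "distinct [u, v, w]"
        "{u, v} \<in> E" "{v, w} \<in> E" "{u, w} \<in> E" "\<forall>y\<in>X. {z, y} \<in> E \<longrightarrow> y \<in> {u, v, w}"
      have "y \<in> {u, v, w}" if y: "{z, y} \<in> E" "y \<in> V" for y
      proof (cases "y \<in> X")
        case False
        then have "y \<noteq> \<one>" using X(3) by auto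
        have "z \<in> V" using Z(2) WV by auto
        have "z = y \<otimes> y" "ord y = 4"
          using chord_cases[OF y(1) \<open>z \<in> V\<close> y(2) Z(3) \<open>y \<noteq> \<one>\<close>] False Z(2) by auto
        then have "ord z = 2" using ord_sq y(2) by auto
        then show ?thesis using involution[OF Z(2)] Z(1) by auto
      qed (use Z y in auto)
      then show ?thesis using Z WV by auto
    qed simp
  qed
  then obtain p \<gamma> where D: "plane_drawing V {e \<in> E. e \<subseteq> V} p \<gamma>" by blast
  have "F \<subseteq> {e \<in> E. e \<subseteq> V}" using F WV by blast
  then show "\<exists>p \<gamma>. plane_drawing W F p \<gamma>" using plane_drawing_subgraph[OF D WV(1)] by blast
qed

end

section \<open>Cliques in power graphs\<close>

lemma planar_mono:
  assumes "planar V E" "F \<subseteq> E"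
  shows "planar V F"
  unfolding planar_def
proof (intro allI impI)
  fix W F' assume "finite W \<and> W \<subseteq> V \<and> F' \<subseteq> F \<and> F' \<subseteq> Pow W"
  then have "finite W \<and> W \<subseteq> V \<and> F' \<subseteq> E \<and> F' \<subseteq> Pow W" using assms(2) by blast
  then show "\<exists>p \<gamma>. plane_drawing W F' p \<gamma>" using assms(1) unfolding planar_def by metis
qed

lemma almost_planarD:
  assumes "almost_planar V E"
  obtains e where "planar V (E - {e})"
  using assms planar_mono[of V E "E - {undefined}"] unfolding almost_planar_def by blast

lemma complete_6_not_almost_planar:
  assumes S: "S \<subseteq> V" "card S = 6" and E: "\<And>x y. x \<in> S \<Longrightarrow> y \<in> S \<Longrightarrow> x \<noteq> y \<Longrightarrow> {x, y} \<in> E"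
  shows "\<not> almost_planar V E"
proof
  assume "almost_planar V E"
  then obtain e where e: "planar V (E - {e})" by (rule almost_planarD)
  have fin: "finite S" "S \<noteq> {}" using S(2) by (auto intro: card_ge_0_finite)
  (* deleting one end of e leaves five vertices that do not involve e *)
  then obtain a where a: "a \<in> S" "e \<inter> S \<noteq> {} \<Longrightarrow> a \<in> e" by blast
  have "\<not> planar V (E - {e})"
  proof (rule complete_5_not_planar)
    show "S - {a} \<subseteq> V" "card (S - {a}) = 5" using S fin a by auto
    show "{x, y} \<in> E - {e}" if "x \<in> S - {a}" "y \<in> S - {a}" "x \<noteq> y" for x y
      using E[of x y] that a(2) by auto
  qed
  then show False using e by blast
qed

context group
begin

lemma pow_eq_pow_iff:
  assumes x: "x \<in> carrier G"
  shows "x [^] (i::nat) = x [^] (j::nat) \<longleftrightarrow> i mod ord x = j mod ord x"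
proof -
  have "x [^] i = x [^] j \<longleftrightarrow> i mod ord x = j mod ord x" if "i \<le> j" for i j :: nat
  proof -
    have "x [^] j = x [^] i \<otimes> x [^] (j - i)" using that x by (simp add: nat_pow_mult)
    then have "x [^] i = x [^] j \<longleftrightarrow> x [^] (j - i) = \<one>"
      using x by (simp add: r_cancel_one' eq_commute)
    also have "\<dots> \<longleftrightarrow> i mod ord x = j mod ord x"
      using mod_eq_dvd_iff_nat[OF that, of "ord x"] by (auto simp: pow_eq_id[OF x])
    finally show ?thesis .
  qed
  then show ?thesis by (metis nle_le)
qed

lemma pow_mem_generate_pow_iff:
  assumes x: "x \<in> carrier G" "ord x \<noteq> 0"
  shows "x [^] (i::nat) \<in> generate G {x [^] (j::nat)} \<longleftrightarrow> (\<exists>k. i mod ord x = (j * k) mod ord x)"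
proof -
  have "(x [^] j) [^] ord x = \<one>" using x(1) by (simp add: nat_pow_pow pow_eq_id)
  then have "ord (x [^] j) dvd ord x" using x(1) by (simp add: pow_eq_id)
  then have "ord (x [^] j) \<noteq> 0" using x(2) by auto
  then have "generate G {x [^] j} = {(x [^] j) [^] k |k. k \<in> (UNIV :: nat set)}"
    using x by (intro generate_pow_nat) auto
  then show ?thesis using x by (auto simp: nat_pow_pow pow_eq_pow_iff)
qed

lemma power_graph_edge_powI:
  assumes "x \<in> carrier G" "i mod ord x \<noteq> j mod ord x" "i mod ord x = (j * k) mod ord x"
  shows "{x [^] (i::nat), x [^] (j::nat)} \<in> power_graph_edges G"
proof -
  have "x [^] i = (x [^] j) [^] k" using assms by (simp add: nat_pow_pow pow_eq_pow_iff)
  then have "x [^] i \<in> generate G {x [^] j}" using pow_mem_generate[of "x [^] j" k] assms(1) by simp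
  then show ?thesis using assms by (simp add: power_graph_edge_iff pow_eq_pow_iff)
qed

lemma power_graph_edge_coprimeI:
  assumes "x \<in> carrier G" "ord x \<noteq> 0" "i mod ord x \<noteq> j mod ord x" "coprime j (ord x)"
  shows "{x [^] (i::nat), x [^] (j::nat)} \<in> power_graph_edges G"
proof -
  obtain l where "[j * l = 1] (mod ord x)"
    using cong_solve_coprime_nat[OF assms(4)] by auto
  then have "[j * (l * i) = i] (mod ord x)"
    using cong_scalar_right[of "j * l" 1 "ord x" i] by (simp add: mult.assoc)
  then show ?thesis using assms by (intro power_graph_edge_powI[where k = "l * i"]) (auto simp: cong_def)
qed

text \<open>
  The powers \<open>x\<close>, \<open>x\<^sup>2\<close>, \<open>x\<^sup>4\<close>, \<open>x\<^sup>8\<close>, \<open>\<dots>\<close> are pairwise adjacent.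
\<close>

lemma infinite_order_not_almost_planar:
  assumes x: "x \<in> carrier G" "ord x = 0"
  shows "\<not> almost_planar (carrier G) (power_graph_edges G)"
proof (rule complete_6_not_almost_planar)
  let ?S = "(\<lambda>i. x [^] (2 ^ i :: nat)) ` {..<6::nat}"
  have eq: "x [^] (2 ^ i :: nat) = x [^] (2 ^ j :: nat) \<longleftrightarrow> i = j" for i j :: nat
    using x by (simp add: pow_eq_pow_iff)
  show "?S \<subseteq> carrier G" using x by auto
  show "card ?S = 6" by (subst card_image) (auto simp: inj_on_def eq)
  have *: "{x [^] (2 ^ i :: nat), x [^] (2 ^ j :: nat)} \<in> power_graph_edges G" if "j < i" for i j :: nat
    using that x by (intro power_graph_edge_powI[where k = "2 ^ (i - j)"]) (auto simp flip: power_add)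
  show "{a, b} \<in> power_graph_edges G" if ab: "a \<in> ?S" "b \<in> ?S" "a \<noteq> b" for a b
  proof -
    obtain i j where ij: "a = x [^] (2 ^ i :: nat)" "b = x [^] (2 ^ j :: nat)" "i \<noteq> j" using ab by blast
    then show ?thesis using *[of i j] *[of j i] by (metis insert_commute nat_neq_iff)
  qed
qed

end

lemma four_coprime_residues:
  assumes "n \<ge> (7::nat)"
  shows "\<exists>U\<subseteq>{1..<n}. card U = 4 \<and> (\<forall>k\<in>U. coprime k n)"
proof -
  have pred: "coprime (m - 1) m" if "m \<ge> 1" for m :: nat
    using that gcd_diff2_nat[of 1 m] by (simp add: coprime_iff_gcd_eq_1)
  then have last: "coprime (n - 1) n" using assms by simp
  consider "odd n" | k where "n = 2 * k" "even k" | k where "n = 2 * k" "odd k" by (metis evenE)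
  then show ?thesis
  proof cases
    case 1
    then have c2: "coprime 2 n" by simp
    then have "coprime (n - 2) n"
      using assms gcd_diff2_nat[of 2 n] by (simp add: coprime_iff_gcd_eq_1)
    then show ?thesis using c2 last assms by (intro exI[of _ "{1, 2, n - 2, n - 1}"]) (auto simp: card_insert_if)
  next
    case (2 k)
    have k: "k \<ge> 4" using 2 assms by (auto elim!: evenE)
    have "coprime (k - 1) k" using k pred[of k] by simp
    moreover have "coprime (k + 1) k" by simp
    moreover have "coprime (k - 1) 2" "coprime (k + 1) 2" using 2 k by (auto simp: coprime_right_2_iff_odd)
    ultimately have "coprime (k - 1) n" "coprime (k + 1) n" unfolding 2(1) by auto
    then show ?thesis using last k 2(1) by (intro exI[of _ "{1, k - 1, k + 1, n - 1}"]) (auto simp: card_insert_if)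
  next
    case (3 k)
    have k: "k \<ge> 5" using 3 assms by (auto elim!: oddE)
    have "coprime 2 k" using 3 by simp
    then have "coprime (k - 2) k" "coprime (k + 2) k"
      using k gcd_diff2_nat[of 2 k] gcd_add1[of 2 k] by (simp_all add: coprime_iff_gcd_eq_1 add.commute)
    moreover have "coprime (k - 2) 2" "coprime (k + 2) 2" using 3 k by (auto simp: coprime_right_2_iff_odd)
    ultimately have "coprime (k - 2) n" "coprime (k + 2) n" unfolding 3(1) by auto
    then show ?thesis using last k 3(1) by (intro exI[of _ "{1, k - 2, k + 2, n - 1}"]) (auto simp: card_insert_if)
  qed
qed

context group
begin

text \<open>
  The generators of a cyclic group are adjacent to all of its elements.  Four generators, the identity
  and any further element are therefore six pairwise adjacent elements.
\<close>

lemma large_order_not_almost_planar: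
  assumes x: "x \<in> carrier G" "ord x \<ge> 7"
  shows "\<not> almost_planar (carrier G) (power_graph_edges G)"
proof -
  obtain U where U: "U \<subseteq> {1..<ord x}" "card U = 4" "\<And>k. k \<in> U \<Longrightarrow> coprime k (ord x)"
    using four_coprime_residues[OF x(2)] by blast
  have fin: "finite U" using U(1) finite_subset by blast
  have "card ({1..<ord x} - U) > 0" using U fin x(2) by (simp add: card_Diff_subset)
  then obtain m where m: "m \<in> {1..<ord x}" "m \<notin> U" by (metis DiffE card_gt_0_iff ex_in_conv)
  define T where "T = insert 0 (insert m U)"
  have "0 \<notin> insert m U" using U(1) m(1) by auto
  then have T: "T \<subseteq> {..<ord x}" "card T = 6" using U fin m x(2) by (auto simp: T_def)
  let ?S = "(\<lambda>i. x [^] i) ` T"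
  have modT: "i mod ord x = j mod ord x \<longleftrightarrow> i = j" if "i \<in> T" "j \<in> T" for i j
  proof -
    have "i < ord x" "j < ord x" using that T(1) by auto
    then show ?thesis by simp
  qed
  have eq: "x [^] i = x [^] j \<longleftrightarrow> i = j" if "i \<in> T" "j \<in> T" for i j
    using modT[OF that] x by (simp add: pow_eq_pow_iff)
  show ?thesis
  proof (rule complete_6_not_almost_planar)
    show "?S \<subseteq> carrier G" using x by auto
    show "card ?S = 6" using T(2) by (subst card_image) (auto simp: inj_on_def eq)
    have *: "{x [^] i, x [^] j} \<in> power_graph_edges G" if "i \<in> T" "j \<in> T" "i \<noteq> j" "i = 0 \<or> j \<in> U" for i j
      using that(4)
    proof
      assume "i = 0"
      then show ?thesis using that modT[OF that(1,2)] x by (intro power_graph_edge_powI[where k = 0]) auto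
    next
      assume "j \<in> U"
      then show ?thesis using that modT x U(3) by (intro power_graph_edge_coprimeI) auto
    qed
    show "{a, b} \<in> power_graph_edges G" if ab: "a \<in> ?S" "b \<in> ?S" "a \<noteq> b" for a b
    proof -
      obtain i j where ij: "a = x [^] i" "b = x [^] j" "i \<in> T" "j \<in> T" using ab by blast
      then have "i \<noteq> j" "i = 0 \<or> j \<in> U \<or> j = 0 \<or> i \<in> U" using ab(3) by (auto simp: T_def)
      then show ?thesis using *[of i j] *[of j i] ij by (metis insert_commute)
    qed
  qed
qed

end

section \<open>Cyclic subgroups of order five and six\<close>

context group
begin

lemma order_5_edges:
  assumes x: "x \<in> carrier G" "ord x = 5" and ij: "i < 5" "j < 5" "i \<noteq> j" "j \<noteq> 0"
  shows "{x [^] i, x [^] (j::nat)} \<in> power_graph_edges G"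
proof -
  have "j = 1 \<or> j = 2 \<or> j = 3 \<or> j = 4" using ij by linarith
  then obtain l where "(j * l) mod 5 = 1"
  proof (elim disjE)
    assume "j = 1" then show ?thesis using that[of 1] by simp
  next
    assume "j = 2" then show ?thesis using that[of 3] by simp
  next
    assume "j = 3" then show ?thesis using that[of 2] by simp
  next
    assume "j = 4" then show ?thesis using that[of 4] by simp
  qed
  then have "i mod 5 = (j * (l * i)) mod 5"
    using mod_mult_left_eq[of "j * l" 5 i] by (simp add: mult.assoc)
  then show ?thesis using x ij by (intro power_graph_edge_powI[where k = "l * i"]) auto
qed

lemma order_5_not_planar:
  assumes x: "x \<in> carrier G" "ord x = 5"
    and E: "\<And>y z. y \<in> generate G {x} \<Longrightarrow> z \<in> generate G {x} \<Longrightarrow> {y, z} \<in> power_graph_edges G \<Longrightarrow> {y, z} \<in> E"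
  shows "\<not> planar (carrier G) E"
proof (rule complete_5_not_planar)
  show "generate G {x} \<subseteq> carrier G" using x by (simp add: generate_singleton_carrier)
  show "card (generate G {x}) = 5" using generate_pow_card x by simp
  show "{y, z} \<in> E" if yz: "y \<in> generate G {x}" "z \<in> generate G {x}" "y \<noteq> z" for y z
  proof (rule E[OF yz(1,2)])
    have gen: "generate G {x} = (\<lambda>k. x [^] k) ` {..<5::nat}" using generate_singleton_eq_pow_image x by simp
    obtain i j :: nat where "y = x [^] i" "z = x [^] j" "i < 5" "j < 5" using yz gen by auto
    then show "{y, z} \<in> power_graph_edges G"
      using order_5_edges[OF x, of i j] order_5_edges[OF x, of j i] yz(3)
      by (metis insert_commute)
  qed
qed

lemma pow_eq_pow_iff_less:
  assumes "x \<in> carrier G" "i < ord x" "j < ord x"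
  shows "x [^] (i::nat) = x [^] (j::nat) \<longleftrightarrow> i = j"
  using assms by (simp add: pow_eq_pow_iff)

lemma order_6_edges:
  assumes x: "x \<in> carrier G" "ord x = 6"
  shows "i < 6 \<Longrightarrow> j < 6 \<Longrightarrow> i \<noteq> j \<Longrightarrow> j = 0 \<or> j = 1 \<or> j = 5 \<Longrightarrow> {x [^] i, x [^] (j::nat)} \<in> power_graph_edges G"
    and "{x [^] (2::nat), x [^] (4::nat)} \<in> power_graph_edges G"
    and "{x [^] (3::nat), x [^] (2::nat)} \<notin> power_graph_edges G"
    and "{x [^] (3::nat), x [^] (4::nat)} \<notin> power_graph_edges G"
proof -
  have o: "ord x \<noteq> 0" using x by simp
  show "{x [^] i, x [^] (j::nat)} \<in> power_graph_edges G" if "i < 6" "j < 6" "i \<noteq> j" "j = 0 \<or> j = 1 \<or> j = 5"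
    using that(4)
  proof (elim disjE)
    assume "j = 0"
    then have "{x [^] j, x [^] i} \<in> power_graph_edges G"
      using that x by (intro power_graph_edge_powI[where k = 0]) auto
    then show ?thesis by (simp add: insert_commute)
  next
    assume "j = 1"
    then show ?thesis using that x by (intro power_graph_edge_powI[where k = i]) auto
  next
    assume "j = 5"
    then have "i mod 6 = (j * (5 * i)) mod 6" by presburger
    then show ?thesis using that x by (intro power_graph_edge_powI[where k = "5 * i"]) auto
  qed
  show "{x [^] (2::nat), x [^] (4::nat)} \<in> power_graph_edges G"
    using x by (intro power_graph_edge_powI[where k = 2]) auto
  have "2 \<noteq> 3 * k mod 6" "3 \<noteq> 2 * k mod 6" "4 \<noteq> 3 * k mod 6" "3 \<noteq> 4 * k mod 6" for k :: nat
    by presburger+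
  then show "{x [^] (3::nat), x [^] (2::nat)} \<notin> power_graph_edges G"
    "{x [^] (3::nat), x [^] (4::nat)} \<notin> power_graph_edges G"
    using x by (simp_all add: power_graph_edge_iff pow_mem_generate_pow_iff)
qed

text \<open>
  The power graph of \<open>\<int>\<^sub>6\<close> contains \<open>K\<^sub>3\<^sub>,\<^sub>3\<close>: the identity and the two generators are adjacent to the
  three other elements.  The edge from the identity to \<open>x\<^sup>2\<close> is replaced here by a walk through elements
  \<open>ys\<close> outside the subgroup.
\<close>

lemma order_6_hexagon_not_planar:
  assumes x: "x \<in> carrier G" "ord x = 6"
    and ys: "set ys \<subseteq> carrier G - generate G {x}" "distinct ys"
    and walk: "walk_edges (\<one> # ys @ [x [^] (2::nat)]) \<subseteq> E"
    and E: "\<And>i j. i < 6 \<Longrightarrow> i \<noteq> 0 \<Longrightarrow> i \<noteq> j \<Longrightarrow> (i, j) \<noteq> (2, 0) \<Longrightarrow> j = 0 \<or> j = 1 \<or> j = 5 \<Longrightarrow>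
      {x [^] i, x [^] (j::nat)} \<in> E"
  shows "\<not> planar (carrier G) E"
proof -
  define p where "p i = x [^] i" for i :: nat
  have p: "p i = p j \<longleftrightarrow> i = j" if "i < 6" "j < 6" for i j
    using that x by (simp add: p_def pow_eq_pow_iff_less)
  have pC: "p i \<in> carrier G" "p i \<notin> set ys" "p i \<in> generate G {x}" for i
    using x ys(1) pow_mem_generate[OF x(1), of i] by (auto simp: p_def)
  have one: "\<one> = p 0" by (simp add: p_def)
  have pE: "{p i, p j} \<in> E" if "i < 6" "i \<noteq> 0" "i \<noteq> j" "(i, j) \<noteq> (2, 0)" "j = 0 \<or> j = 1 \<or> j = 5" for i j
    using E[OF that] by (simp add: p_def)
  show ?thesis
  proof (rule hexagon_with_long_chords_not_planar)
    show "distinct (p 0 # ys @ [p 2, p 1, p 4, p 5, p 3])" using pC ys(2) by (simp add: p)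
    show "set (p 0 # ys @ [p 2, p 1, p 4, p 5, p 3]) \<subseteq> carrier G" using pC ys(1) by auto
    show "walk_edges (p 0 # ys @ [p 2, p 1, p 4, p 5, p 3, p 0]) \<subseteq> E"
      using walk walk_edges_append[of "p 0 # ys" "p 2" "[p 1, p 4, p 5, p 3, p 0]"]
        pE[of 2 1] pE[of 4 1] pE[of 4 5] pE[of 3 5] pE[of 3 0]
      by (simp add: one p_def[symmetric] insert_commute)
    show "{p 0, p 4} \<in> E" "{p 2, p 5} \<in> E" "{p 1, p 3} \<in> E"
      using pE[of 4 0] pE[of 2 5] pE[of 3 1] by (simp_all add: insert_commute)
  qed
qed

lemma order_6_not_planar:
  assumes x: "x \<in> carrier G" "ord x = 6"
    and E: "\<And>i j. i < 6 \<Longrightarrow> i \<noteq> 0 \<Longrightarrow> i \<noteq> j \<Longrightarrow> j = 0 \<or> j = 1 \<or> j = 5 \<Longrightarrow> {x [^] i, x [^] (j::nat)} \<in> E"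
  shows "\<not> planar (carrier G) E"
proof (rule order_6_hexagon_not_planar[OF x, of "[]"])
  show "walk_edges (\<one> # [] @ [x [^] (2::nat)]) \<subseteq> E"
    using E[of 2 0] by (simp add: insert_commute)
qed (use E in auto)

text \<open>
  Apart from the involution \<open>x\<^sup>3\<close>, the elements of \<open>\<int>\<^sub>6\<close> are pairwise adjacent.
\<close>

lemma order_6_complete_5_not_planar:
  assumes x: "x \<in> carrier G" "ord x = 6"
    and E: "\<And>y z. y \<in> generate G {x} \<Longrightarrow> z \<in> generate G {x} \<Longrightarrow> {y, z} \<in> power_graph_edges G \<Longrightarrow>
      {y, z} \<noteq> {\<one>, x [^] (3::nat)} \<Longrightarrow> {y, z} \<in> E"
  shows "\<not> planar (carrier G) E"
proof (rule complete_5_not_planar)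
  let ?S = "(\<lambda>i. x [^] i) ` {0, 1, 2, 4, 5::nat}"
  show "?S \<subseteq> carrier G" using x by auto
  have eq: "x [^] i = x [^] j \<longleftrightarrow> i = j" if "i < 6" "j < 6" for i j :: nat
    using that x by (simp add: pow_eq_pow_iff_less)
  have "inj_on (\<lambda>i. x [^] i) {0, 1, 2, 4, 5::nat}"
  proof (rule inj_onI)
    fix i j assume h: "i \<in> {0, 1, 2, 4, 5::nat}" "j \<in> {0, 1, 2, 4, 5::nat}" "x [^] i = x [^] j"
    then have "i < 6" "j < 6" by auto
    then show "i = j" using eq h(3) by blast
  qed
  then show "card ?S = 5" by (simp only: card_image) simp
  show "{y, z} \<in> E" if yz: "y \<in> ?S" "z \<in> ?S" "y \<noteq> z" for y z
  proof -
    obtain i j :: nat where ij: "y = x [^] i" "z = x [^] j" "i \<in> {0, 1, 2, 4, 5}" "j \<in> {0, 1, 2, 4, 5}" using yz by blast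
    have "x [^] (3::nat) \<noteq> y" "x [^] (3::nat) \<noteq> z" using ij eq[of 3 i] eq[of 3 j] by auto
    then have ne: "{y, z} \<noteq> {\<one>, x [^] (3::nat)}" by (auto simp: doubleton_eq_iff)
    have "i \<noteq> j" using yz ij by auto
    then consider "j = 0 \<or> j = 1 \<or> j = 5" | "i = 0 \<or> i = 1 \<or> i = 5" | "i = 2" "j = 4" | "i = 4" "j = 2"
      using ij by auto
    then have "{y, z} \<in> power_graph_edges G"
    proof cases
      case 1
      then show ?thesis using order_6_edges(1)[OF x, of i j] ij \<open>i \<noteq> j\<close> by auto
    next
      case 2
      then have "{x [^] j, x [^] i} \<in> power_graph_edges G" using order_6_edges(1)[OF x, of j i] ij \<open>i \<noteq> j\<close> by auto
      then show ?thesis using ij by (simp add: insert_commute)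
    next
      case 3
      then show ?thesis using order_6_edges(2)[OF x] ij by simp
    next
      case 4
      then show ?thesis using order_6_edges(2)[OF x] ij by (simp add: insert_commute)
    qed
    then show ?thesis using E[of y z] ne ij pow_mem_generate[OF x(1)] by auto
  qed
qed

lemma generate_eq_of_unit_pow:
  assumes x: "x \<in> carrier G" and kl: "(k * l) mod ord x = 1 mod ord x"
  shows "generate G {x [^] (k::nat)} = generate G {x}"
proof
  have "(x [^] k) [^] l = x [^] (1::nat)"
    unfolding nat_pow_pow[OF x] using kl by (simp only: pow_eq_pow_iff[OF x])
  then have "x \<in> generate G {x [^] k}" using pow_mem_generate[of "x [^] k" l] x by simp
  then show "generate G {x} \<subseteq> generate G {x [^] k}" using x by (intro generate_singleton_subset) auto
  show "generate G {x [^] k} \<subseteq> generate G {x}"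
    by (rule generate_singleton_subset[OF x pow_mem_generate[OF x]])
qed

lemma not_generate_subset:
  assumes x: "x \<in> carrier G" "ord x \<in> {5, 6}" and y: "y \<in> carrier G" "ord y \<in> {5, 6}"
    and ne: "generate G {x} \<noteq> generate G {y}"
  shows "x \<notin> generate G {y}"
proof
  assume xy: "x \<in> generate G {y}"
  have y0: "ord y \<noteq> 0" using y by auto
  obtain k where k: "x = y [^] (k::nat)" using xy generate_singleton_eq_pow_image[OF y(1) y0] by auto
  have "x [^] ord y = \<one>" using k y(1) by (simp add: nat_pow_pow pow_eq_id)
  then have "ord x dvd ord y" using x(1) by (simp add: pow_eq_id)
  then have "ord x = ord y" using x(2) y(2) by auto
  then have "card (generate G {x}) = card (generate G {y})" using generate_pow_card x(1) y(1) by metis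
  then have "generate G {x} = generate G {y}"
    using generate_singleton_subset[OF y(1) xy] finite_generate_singleton[OF y(1) y0]
    by (intro card_subset_eq) auto
  then show False using ne by blast
qed

text \<open>
  If the edge \<open>{\<one>, x\<^sup>2}\<close> is removed but \<open>x\<^sup>2\<close> also lies in another cyclic subgroup \<open>\<langle>y\<rangle>\<close>, then the
  path from \<open>\<one>\<close> through \<open>y\<close> to \<open>x\<^sup>2\<close> takes the place of the removed edge.
\<close>

lemma order_6_reroute_not_planar:
  assumes x: "x \<in> carrier G" "ord x = 6" and y: "y \<in> carrier G" "y \<notin> generate G {x}"
    and x2: "x [^] (2::nat) \<in> generate G {y}"
  shows "\<not> planar (carrier G) (power_graph_edges G - {{\<one>, x [^] (2::nat)}})"
proof (rule order_6_hexagon_not_planar[OF x, of "[y]"])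
  have x2C: "x [^] (2::nat) \<in> generate G {x}" "\<one> \<in> generate G {x}"
    using pow_mem_generate[OF x(1), of 2] generate.one by auto
  then have ne: "y \<noteq> x [^] (2::nat)" "y \<noteq> \<one>" using y(2) by auto
  have "\<one> \<in> generate G {y}" by (rule generate.one)
  then have "{\<one>, y} \<in> power_graph_edges G" "{y, x [^] (2::nat)} \<in> power_graph_edges G"
    using x y x2 ne by (auto simp: power_graph_edge_iff)
  then show "walk_edges (\<one> # [y] @ [x [^] (2::nat)]) \<subseteq> power_graph_edges G - {{\<one>, x [^] (2::nat)}}"
    using ne by (auto simp: doubleton_eq_iff)
  show "{x [^] i, x [^] (j::nat)} \<in> power_graph_edges G - {{\<one>, x [^] (2::nat)}}"
    if ij: "i < 6" "i \<noteq> 0" "i \<noteq> j" "(i, j) \<noteq> (2, 0)" "j = 0 \<or> j = 1 \<or> j = 5" for i j :: nat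
  proof -
    have eq: "x [^] a = x [^] b \<longleftrightarrow> a = b" if "a < 6" "b < 6" for a b :: nat
      using that x by (simp add: pow_eq_pow_iff_less)
    have "{x [^] i, x [^] j} \<noteq> {x [^] (0::nat), x [^] (2::nat)}"
      using ij eq[of i 0] eq[of i 2] eq[of j 0] eq[of j 2] unfolding doubleton_eq_iff by auto
    then show ?thesis using order_6_edges(1)[OF x ij(1) _ ij(3,5)] ij(5) by auto
  qed
qed (use y in auto)

text \<open>
  Both subgroups carry a nonplanar graph, so the removed edge lies in their intersection, a proper
  subgroup of each.  Hence both orders are \<open>6\<close>.  In every remaining case enough of one of the two graphs
  survives: a \<open>K\<^sub>5\<close> if the involution is an end of the edge, a \<open>K\<^sub>3\<^sub>,\<^sub>3\<close> if both ends have order \<open>3\<close>, and a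
  subdivided \<open>K\<^sub>3\<^sub>,\<^sub>3\<close> if the edge joins the identity to an element of order \<open>3\<close>.
\<close>

lemma two_subgroups_not_almost_planar:
  assumes x: "x \<in> carrier G" "ord x \<in> {5, 6}" and y: "y \<in> carrier G" "ord y \<in> {5, 6}"
    and ne: "generate G {x} \<noteq> generate G {y}"
  shows "\<not> almost_planar (carrier G) (power_graph_edges G)"
proof
  assume "almost_planar (carrier G) (power_graph_edges G)"
  then obtain e where pl: "planar (carrier G) (power_graph_edges G - {e})" by (rule almost_planarD)
  have np: "e \<subseteq> generate G {x} \<and> e \<in> power_graph_edges G" if x: "x \<in> carrier G" "ord x \<in> {5, 6}" for x
  proof (rule ccontr)
    assume no: "\<not> ?thesis"
    have E: "{y, z} \<in> power_graph_edges G - {e}"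
      if "y \<in> generate G {x}" "z \<in> generate G {x}" "{y, z} \<in> power_graph_edges G" for y z
      using that no by auto
    have "ord x = 5 \<or> ord x = 6" using x by auto
    then have "\<not> planar (carrier G) (power_graph_edges G - {e})"
    proof
      assume "ord x = 5"
      from order_5_not_planar[OF x(1) this E] show ?thesis .
    next
      assume o: "ord x = 6"
      show ?thesis
      proof (rule order_6_not_planar[OF x(1) o])
        fix i j :: nat assume ij: "i < 6" "i \<noteq> 0" "i \<noteq> j" "j = 0 \<or> j = 1 \<or> j = 5"
        then have "j < 6" by auto
        from order_6_edges(1)[OF x(1) o ij(1) this ij(3,4)]
        show "{x [^] i, x [^] j} \<in> power_graph_edges G - {e}"
          by (rule E[OF pow_mem_generate[OF x(1)] pow_mem_generate[OF x(1)]])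
      qed
    qed
    then show False using pl by blast
  qed
  have nxy: "x \<notin> generate G {y}" "y \<notin> generate G {x}"
    using not_generate_subset[OF x y ne] not_generate_subset[OF y x ne[symmetric]] by auto
  have eD: "e \<subseteq> generate G {x}" "e \<subseteq> generate G {y}" "e \<in> power_graph_edges G"
    using np[OF x] np[OF y] by auto
  obtain a b where e: "e = {a, b}" "a \<noteq> b" using eD(3) unfolding power_graph_edges_def by blast
  have D: "\<And>d. d \<in> generate G {y} \<Longrightarrow> generate G {d} \<subseteq> generate G {y}"
    by (rule generate_singleton_subset[OF y(1)])
  have no_unit: "x [^] (k::nat) \<notin> generate G {y}" if "(k * l) mod ord x = 1 mod ord x" for k l
  proof
    assume k: "x [^] k \<in> generate G {y}"
    have "x \<in> generate G {x [^] k}"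
      using generate_eq_of_unit_pow[OF x(1) that] mem_generate_self by auto
    then show False using D[OF k] nxy by blast
  qed
  have x0: "ord x \<noteq> 0" using x(2) by auto
  obtain i j where ij: "a = x [^] (i::nat)" "b = x [^] (j::nat)" "i < ord x" "j < ord x"
    using eD(1) e generate_singleton_eq_pow_image[OF x(1) x0] by auto
  have iy: "x [^] i \<in> generate G {y}" "x [^] j \<in> generate G {y}" using eD(2) e ij by auto
  have "i \<noteq> j" using e ij by auto
  have o6: "ord x = 6"
  proof (rule ccontr)
    assume "ord x \<noteq> 6"
    then have o5: "ord x = 5" using x(2) by auto
    have "k = 0" if "k < 5" "x [^] k \<in> generate G {y}" for k :: nat
    proof (rule ccontr)
      assume "k \<noteq> 0"
      then have "k = 1 \<or> k = 2 \<or> k = 3 \<or> k = 4" using that(1) by linarith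
      then show False
        using no_unit[of 1 1] no_unit[of 2 3] no_unit[of 3 2] no_unit[of 4 4] that(2) o5 by auto
    qed
    from this[of i] this[of j] show False using ij(3,4) iy \<open>i \<noteq> j\<close> o5 by simp
  qed
  have "i \<notin> {1, 5}" "j \<notin> {1, 5}" using no_unit[of 1 1] no_unit[of 5 5] iy o6 by auto
  then have range: "i \<in> {0, 2, 3, 4}" "j \<in> {0, 2, 3, 4}" using ij(3,4) o6 by auto
  have sub: "subgroup (generate G {y}) G" by (rule generate_is_subgroup) (use y in simp)
  (* with the involution and an element of order 3, the intersection would contain a generator *)
  have no3: False if "x [^] (3::nat) \<in> generate G {y}" "x [^] k \<in> generate G {y}" "k = 2 \<or> k = 4" for k :: nat
  proof -
    have "x [^] (3 + k) \<in> generate G {y}"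
      using subgroup.m_closed[OF sub that(1,2)] x(1) by (simp add: nat_pow_mult)
    then show False using no_unit[of "3 + k" "3 + k"] that(3) o6 by auto
  qed
  have cases: "(p = 0 \<and> q = 2) \<or> (p = 0 \<and> q = 3) \<or> (p = 0 \<and> q = 4) \<or> (p = 2 \<and> q = 4)"
    if "p < q" "p \<in> {0, 2, 3, 4}" "q \<in> {0, 2, 3, 4}" "x [^] p \<in> generate G {y}" "x [^] q \<in> generate G {y}"
    for p q :: nat
    using that no3[of p] no3[of q] by auto
  obtain p q :: nat where pq: "e = {x [^] p, x [^] q}" "x [^] q \<in> generate G {y}"
    "(p = 0 \<and> q = 2) \<or> (p = 0 \<and> q = 3) \<or> (p = 0 \<and> q = 4) \<or> (p = 2 \<and> q = 4)"
  proof (cases "i < j")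
    case True
    then show ?thesis using that[of i j] cases[of i j] range iy e(1) ij(1,2) by simp
  next
    case False
    then have "j < i" using \<open>i \<noteq> j\<close> by simp
    then show ?thesis using that[of j i] cases[of j i] range iy e(1) ij(1,2) by (simp add: insert_commute)
  qed
  have eq: "x [^] a = x [^] b \<longleftrightarrow> a = b" if "a < 6" "b < 6" for a b :: nat
    using that x o6 by (simp add: pow_eq_pow_iff_less)
  from pq(3) show False
  proof (elim disjE conjE)
    assume "p = 0" "q = 2"
    then show False
      using order_6_reroute_not_planar[OF x(1) o6 y(1) nxy(2)] pq pl by simp
  next
    assume p: "p = 0" "q = 3"
    have "\<not> planar (carrier G) (power_graph_edges G - {e})"
      by (rule order_6_complete_5_not_planar[OF x(1) o6]) (use pq p in auto)
    then show False using pl by blast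
  next
    assume p: "p = 0" "q = 4"
    (* with respect to the inverse generator, the fourth power becomes the square *)
    define x' where "x' = x [^] (5::nat)"
    have x': "x' \<in> carrier G" using x by (simp add: x'_def)
    have gen: "generate G {x'} = generate G {x}"
      unfolding x'_def by (rule generate_eq_of_unit_pow[where l = 5]) (use x o6 in auto)
    then have o': "ord x' = 6" using generate_pow_card x' x(1) o6 by metis
    have x'2: "x' [^] (2::nat) = x [^] (4::nat)"
      using x(1) o6 by (simp add: x'_def nat_pow_pow pow_eq_pow_iff)
    show False
      using order_6_reroute_not_planar[OF x' o' y(1)] gen nxy(2) pq p pl x'2 by simp
  next
    assume p: "p = 2" "q = 4"
    have "\<not> planar (carrier G) (power_graph_edges G - {e})"
    proof (rule order_6_not_planar[OF x(1) o6])
      fix i j :: nat assume ij: "i < 6" "i \<noteq> 0" "i \<noteq> j" "j = 0 \<or> j = 1 \<or> j = 5"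
      have "{x [^] i, x [^] j} \<noteq> e"
        using ij eq[of j 2] eq[of j 4] unfolding pq(1) p doubleton_eq_iff by auto
      then show "{x [^] i, x [^] j} \<in> power_graph_edges G - {e}"
        using order_6_edges(1)[OF x(1) o6 ij(1) _ ij(3,4)] ij(4) by auto
    qed
    then show False using pl by blast
  qed
qed

lemma almost_planar_imp_orders:
  assumes "almost_planar (carrier G) (power_graph_edges G)"
  shows "element_orders G \<subseteq> {1, 2, 3, 4} \<or>
    (\<exists>x\<in>carrier G. ord x \<in> {5, 6} \<and> (\<forall>g\<in>carrier G - generate G {x}. ord g \<in> {1, 2, 3, 4}))"
proof -
  have o: "ord g \<in> {1, 2, 3, 4} \<or> ord g \<in> {5, 6}" if "g \<in> carrier G" for g
    using infinite_order_not_almost_planar[OF that] large_order_not_almost_planar[OF that] assms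
    by (simp; linarith)
  show ?thesis
  proof (cases "\<exists>x\<in>carrier G. ord x \<in> {5, 6}")
    case True
    then obtain x where x: "x \<in> carrier G" "ord x \<in> {5, 6}" by blast
    have "ord g \<in> {1, 2, 3, 4}" if g: "g \<in> carrier G - generate G {x}" for g
    proof (rule ccontr)
      assume "ord g \<notin> {1, 2, 3, 4}"
      then have "ord g \<in> {5, 6}" using o[of g] g by blast
      moreover have "generate G {x} \<noteq> generate G {g}" using g mem_generate_self[of g] by auto
      ultimately show False using two_subgroups_not_almost_planar[OF x, of g] g assms by blast
    qed
    then show ?thesis using x by blast
  next
    case False
    then show ?thesis using o unfolding element_orders_def by blast
  qed
qed

lemma small_orders_planar:
  assumes "element_orders G \<subseteq> {1, 2, 3, 4}"
  shows "planar (carrier G) (power_graph_edges G)"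
proof (rule windmill_planar[where X = "{\<one>}" and Z = "{}" and t = \<one> and pos = "\<lambda>_. 0"])
  show "ord g \<in> {1, 2, 3, 4}" if "g \<in> carrier G - {\<one>}" for g
    using assms that unfolding element_orders_def by blast
qed (auto simp: generate_one)

text \<open>
  After removal of the edge \<open>{\<one>, x\<^sup>4}\<close>, the vertex \<open>x\<^sup>4\<close> is drawn inside the triangle of \<open>x\<close>, \<open>x\<^sup>2\<close>, \<open>x\<^sup>3\<close>.
  The block of \<open>\<langle>x\<rangle>\<close> contains no involution, so its place \<open>2\<close> remains empty.
\<close>

lemma order_5_almost_planar:
  assumes x: "x \<in> carrier G" "ord x = 5" and outer: "\<And>g. g \<in> carrier G - generate G {x} \<Longrightarrow> ord g \<in> {1, 2, 3, 4}"
  shows "almost_planar (carrier G) (power_graph_edges G)"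
proof -
  define p where "p i = x [^] i" for i :: nat
  have p: "p i = p j \<longleftrightarrow> i = j" if "i < 5" "j < 5" for i j
    using that x by (simp add: p_def pow_eq_pow_iff_less)
  have one: "\<one> = p 0" by (simp add: p_def)
  have gen: "generate G {x} = {p 0, p 1, p 2, p 3, p 4}"
  proof -
    have "{..<5::nat} = {0, 1, 2, 3, 4}" by auto
    then show ?thesis using generate_singleton_eq_pow_image[OF x(1)] x(2) by (simp add: p_def)
  qed
  note edge = order_5_edges[OF x, folded p_def]
  let ?E = "power_graph_edges G - {{p 0, p 4}}"
  have "planar (carrier G) ?E"
  proof (rule windmill_planar[where X = "generate G {x}" and Z = "{p 4}" and t = "p 1" and z = "p 4"
        and u = "p 1" and v = "p 2" and w = "p 3"
        and pos = "\<lambda>y. if y = p 1 then 0 else if y = p 2 then 1 else 3"])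
    show "generate G {x} \<subseteq> carrier G" "finite (generate G {x})" "\<one> \<in> generate G {x}"
      using x by (simp_all add: generate_singleton_carrier finite_generate_singleton generate.one)
    show "\<And>y. y \<in> generate G {x} \<Longrightarrow> generate G {y} \<subseteq> generate G {x}"
      by (rule generate_singleton_subset[OF x(1)])
    show "p 1 \<in> generate G {x}" by (simp add: gen)
    show "y = p 1 \<and> y \<notin> {p 4} \<and> (if y = p 1 then 0 else if y = p 2 then 1 else 3) = (2::nat)"
      if y: "y \<in> generate G {x}" "ord y = 2" for y
    proof -
      obtain k where k: "y = x [^] (k::nat)" using y(1) generate_singleton_eq_pow_image[OF x(1)] x(2) by auto
      have "y [^] (5::nat) = \<one>" using k x by (simp add: nat_pow_pow pow_eq_id)
      then have "2 dvd (5::nat)" using y k x(1) by (simp add: pow_eq_id)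
      then show ?thesis by simp
    qed
    show "inj_on (\<lambda>y. if y = p 1 then 0 else if y = p 2 then 1 else 3::nat) (generate G {x} - {\<one>} - {p 4})"
      by (auto simp: inj_on_def gen one)
    show "{p 4} = {} \<or> {p 4} = {p 4} \<and> p 4 \<in> generate G {x} \<and> p 4 \<noteq> \<one> \<and>
      {p 1, p 2, p 3} \<subseteq> generate G {x} - {\<one>} - {p 4} \<and> distinct [p 1, p 2, p 3] \<and>
      {p 1, p 2} \<in> ?E \<and> {p 2, p 3} \<in> ?E \<and> {p 1, p 3} \<in> ?E \<and>
      (\<forall>y\<in>generate G {x}. {p 4, y} \<in> ?E \<longrightarrow> y \<in> {p 1, p 2, p 3})"
    proof (intro disjI2 conjI ballI impI)
      show "{p 1, p 2} \<in> ?E" "{p 2, p 3} \<in> ?E" "{p 1, p 3} \<in> ?E"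
        using edge[of 1 2] edge[of 2 3] edge[of 1 3] by (simp_all add: doubleton_eq_iff p)
      show "y \<in> {p 1, p 2, p 3}" if "y \<in> generate G {x}" "{p 4, y} \<in> ?E" for y
        using that by (auto simp: gen power_graph_edge_iff insert_commute)
    qed (simp_all add: gen one p)
  qed (use outer in \<open>auto split: if_splits\<close>)
  moreover have "{p 0, p 4} \<in> power_graph_edges G" using edge[of 0 4] by simp
  ultimately show ?thesis unfolding almost_planar_def by blast
qed

text \<open>
  After removal of the edge \<open>{\<one>, x\<^sup>2}\<close>, the vertex \<open>x\<^sup>2\<close> is drawn inside the triangle of \<open>x\<^sup>4\<close>, \<open>x\<close>, \<open>x\<^sup>5\<close>.
  The block of \<open>\<langle>x\<rangle>\<close> is that of the involution \<open>x\<^sup>3\<close>: first \<open>x\<^sup>4\<close>, \<open>x\<close>, \<open>x\<^sup>3\<close>, then the pairs of elements of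
  order \<open>4\<close> with square \<open>x\<^sup>3\<close>, and finally \<open>x\<^sup>5\<close>.
\<close>

lemma order_6_almost_planar:
  assumes x: "x \<in> carrier G" "ord x = 6" and outer: "\<And>g. g \<in> carrier G - generate G {x} \<Longrightarrow> ord g \<in> {1, 2, 3, 4}"
  shows "almost_planar (carrier G) (power_graph_edges G)"
proof -
  define p where "p i = x [^] i" for i :: nat
  have p: "p i = p j \<longleftrightarrow> i = j" if "i < 6" "j < 6" for i j
    using that x by (simp add: p_def pow_eq_pow_iff_less)
  have one: "\<one> = p 0" by (simp add: p_def)
  have gen: "generate G {x} = {p 0, p 1, p 2, p 3, p 4, p 5}"
  proof -
    have "{..<6::nat} = {0, 1, 2, 3, 4, 5}" by auto
    then show ?thesis using generate_singleton_eq_pow_image[OF x(1)] x(2) by (simp add: p_def)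
  qed
  note edges = order_6_edges[OF x, folded p_def]
  let ?E = "power_graph_edges G - {{p 0, p 2}}"
  let ?pos = "\<lambda>y. if y = p 4 then 0 else if y = p 1 then 1 else if y = p 3 then 2 else 3::nat"
  have "planar (carrier G) ?E"
  proof (rule windmill_planar[where X = "generate G {x}" and Z = "{p 2}" and t = "p 3" and z = "p 2"
        and u = "p 4" and v = "p 1" and w = "p 5" and pos = ?pos])
    show "generate G {x} \<subseteq> carrier G" "finite (generate G {x})" "\<one> \<in> generate G {x}"
      using x by (simp_all add: generate_singleton_carrier finite_generate_singleton generate.one)
    show "\<And>y. y \<in> generate G {x} \<Longrightarrow> generate G {y} \<subseteq> generate G {x}"
      by (rule generate_singleton_subset[OF x(1)])
    show "p 3 \<in> generate G {x}" by (simp add: gen)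
    show "y = p 3 \<and> y \<notin> {p 2} \<and> ?pos y = 2" if y: "y \<in> generate G {x}" "ord y = 2" for y
    proof -
      obtain k where k: "y = x [^] (k::nat)" "k < 6"
        using y(1) generate_singleton_eq_pow_image[OF x(1)] x(2) by auto
      have "y [^] (2::nat) = \<one>" using y k x(1) by (simp add: pow_eq_id)
      then have "6 dvd k * 2" using k x by (simp add: nat_pow_pow pow_eq_id)
      moreover have "k \<noteq> 0" using y k by (metis nat_pow_0 ord_id numeral_One numeral_eq_iff semiring_norm(85))
      ultimately have "k = 3" using k(2) by presburger
      then have "y = p 3" using k by (simp add: p_def)
      then show ?thesis by (simp add: p)
    qed
    show "inj_on ?pos (generate G {x} - {\<one>} - {p 2})"
      by (auto simp: inj_on_def gen one)
    show "{y, z} \<notin> ?E" if "?pos y = 0" "?pos z = 2" for y z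
      using that edges(4) by (auto simp: insert_commute split: if_splits)
    show "{p 2} = {} \<or> {p 2} = {p 2} \<and> p 2 \<in> generate G {x} \<and> p 2 \<noteq> \<one> \<and>
      {p 4, p 1, p 5} \<subseteq> generate G {x} - {\<one>} - {p 2} \<and> distinct [p 4, p 1, p 5] \<and>
      {p 4, p 1} \<in> ?E \<and> {p 1, p 5} \<in> ?E \<and> {p 4, p 5} \<in> ?E \<and>
      (\<forall>y\<in>generate G {x}. {p 2, y} \<in> ?E \<longrightarrow> y \<in> {p 4, p 1, p 5})"
    proof (intro disjI2 conjI ballI impI)
      show "{p 4, p 1} \<in> ?E" "{p 1, p 5} \<in> ?E" "{p 4, p 5} \<in> ?E"
        using edges(1)[of 4 1] edges(1)[of 1 5] edges(1)[of 4 5] by (simp_all add: doubleton_eq_iff p)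
      show "y \<in> {p 4, p 1, p 5}" if "y \<in> generate G {x}" "{p 2, y} \<in> ?E" for y
      proof -
        have "y \<noteq> p 0" "y \<noteq> p 2" "y \<noteq> p 3"
          using that(2) edges(3) by (auto simp: power_graph_edge_iff insert_commute)
        then show ?thesis using that(1) unfolding gen by blast
      qed
    qed (simp_all add: gen one p)
  qed (use outer in \<open>auto split: if_splits\<close>)
  moreover have "{p 0, p 2} \<in> power_graph_edges G" using edges(1)[of 2 0] by (simp add: insert_commute)
  ultimately show ?thesis unfolding almost_planar_def by blast
qed

lemma almost_planar_iff_orders:
  "almost_planar (carrier G) (power_graph_edges G) \<longleftrightarrow>
    element_orders G \<subseteq> {1, 2, 3, 4} \<or>
    (\<exists>x\<in>carrier G. ord x \<in> {5, 6} \<and> (\<forall>g\<in>carrier G - generate G {x}. ord g \<in> {1, 2, 3, 4}))"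
    (is "?L \<longleftrightarrow> ?R")
proof
  show "?L \<Longrightarrow> ?R" by (rule almost_planar_imp_orders)
  assume ?R
  then show ?L
  proof (elim disjE bexE conjE)
    assume "element_orders G \<subseteq> {1, 2, 3, 4}"
    then show ?thesis using small_orders_planar by (simp add: almost_planar_def)
  next
    fix x assume x: "x \<in> carrier G" "ord x \<in> {5, 6}" "\<forall>g\<in>carrier G - generate G {x}. ord g \<in> {1, 2, 3, 4}"
    then show ?thesis using order_5_almost_planar[OF x(1)] order_6_almost_planar[OF x(1)] by blast
  qed
qed

end

section \<open>Recognizing semidirect products\<close>

context group
begin

lemma int_pow_eq_int_pow_iff:
  assumes x: "x \<in> carrier G"
  shows "x [^] (i::int) = x [^] (j::int) \<longleftrightarrow> int (ord x) dvd i - j"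
proof -
  have "x [^] i = x [^] (i - j) \<otimes> x [^] j" using x by (simp flip: int_pow_mult)
  then have "x [^] i = x [^] j \<longleftrightarrow> x [^] (i - j) = \<one>"
    using x by (simp add: l_cancel_one')
  then show ?thesis using int_pow_eq_id[OF x] by simp
qed

lemma int_pow_mod:
  assumes "x \<in> carrier G" "x [^] n = \<one>"
  shows "x [^] (i mod int n) = x [^] i"
proof -
  have "int (ord x) dvd int n" using assms by (simp add: pow_eq_id)
  moreover have "int n dvd i mod int n - i" by (simp add: mod_eq_dvd_iff[symmetric])
  ultimately show ?thesis using int_pow_eq_int_pow_iff[OF assms(1)] dvd_trans by blast
qed

lemma int_pow_mem_generate: "x \<in> carrier G \<Longrightarrow> x [^] (i::int) \<in> generate G {x}"
  using generate_pow[of x] by auto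

lemma conj_hom:
  assumes g: "g \<in> carrier G"
  shows "(\<lambda>a. g \<otimes> a \<otimes> inv g) \<in> hom G G"
proof (rule homI)
  fix a b assume "a \<in> carrier G" "b \<in> carrier G"
  then show "g \<otimes> (a \<otimes> b) \<otimes> inv g = g \<otimes> a \<otimes> inv g \<otimes> (g \<otimes> b \<otimes> inv g)"
    using g by (simp add: m_assoc) (simp flip: m_assoc)
qed (use g in simp)

lemma conj_int_pow:
  assumes g: "g \<in> carrier G" and x: "x \<in> carrier G" and r: "g \<otimes> x = x [^] (r::int) \<otimes> g"
  shows "g \<otimes> x [^] (i::int) = x [^] (r * i) \<otimes> g"
proof -
  from hom_int_pow[OF conj_hom[OF g] x is_group is_group, of i]
  have "g \<otimes> x [^] i \<otimes> inv g = (g \<otimes> x \<otimes> inv g) [^] i" .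
  also have "g \<otimes> x \<otimes> inv g = x [^] r" using r g x by (simp add: m_assoc)
  finally have "g \<otimes> x [^] i \<otimes> inv g = x [^] (r * i)" using x by (simp add: int_pow_pow)
  then show ?thesis using g x by (metis inv_solve_right int_pow_closed m_closed)
qed

lemma conj_int_pow_iterate:
  assumes g: "g \<in> carrier G" and x: "x \<in> carrier G" and r: "g \<otimes> x = x [^] (r::int) \<otimes> g"
  shows "g [^] (t::nat) \<otimes> x [^] (i::int) = x [^] (r ^ t * i) \<otimes> g [^] t"
proof (induction t arbitrary: i)
  case (Suc t)
  have "g [^] Suc t \<otimes> x [^] i = g [^] t \<otimes> (g \<otimes> x [^] i)" using g x by (simp add: m_assoc)
  also have "\<dots> = g [^] t \<otimes> x [^] (r * i) \<otimes> g" using conj_int_pow[OF g x r] g x by (simp add: m_assoc)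
  also have "\<dots> = x [^] (r ^ Suc t * i) \<otimes> g [^] Suc t" using Suc[of "r * i"] g x by (simp add: m_assoc mult.assoc mult.left_commute)
  finally show ?case .
qed (use x in simp)

lemma integer_mod_group_iso:
  assumes x: "x \<in> carrier G" "ord x = n" "n > 0" and gen: "carrier G = generate G {x}"
  shows "G \<cong> integer_mod_group n"
proof -
  have "integer_mod_group n \<cong> G"
  proof -
    have C: "carrier (integer_mod_group n) = {0..<int n}" using x by (simp add: carrier_integer_mod_group)
    have xn: "x [^] n = \<one>" using x(1,2) by (simp add: pow_eq_id)
    have "bij_betw (\<lambda>i::int. x [^] i) {0..<int n} (carrier G)"
      unfolding bij_betw_def
    proof
      show "inj_on (\<lambda>i::int. x [^] i) {0..<int n}"
      proof (rule inj_onI)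
        fix i j assume ij: "i \<in> {0..<int n}" "j \<in> {0..<int n}" "x [^] i = x [^] j"
        then have "i mod int n = j mod int n"
          using int_pow_eq_int_pow_iff[OF x(1), of i j] x(2) unfolding mod_eq_dvd_iff by simp
        then show "i = j" using ij by simp
      qed
      have "x [^] i \<in> (\<lambda>i::int. x [^] i) ` {0..<int n}" for i :: int
        using int_pow_mod[OF x(1) xn, of i] x(3) by (intro image_eqI[of _ _ "i mod int n"]) auto
      then show "(\<lambda>i::int. x [^] i) ` {0..<int n} = carrier G"
        using x(1) unfolding gen generate_pow[OF x(1)] by blast
    qed
    moreover have "(\<lambda>i::int. x [^] i) \<in> hom (integer_mod_group n) G"
      by (rule homI) (use x int_pow_mod[OF x(1) xn] in \<open>auto simp: int_pow_mult\<close>)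
    ultimately have "(\<lambda>i::int. x [^] i) \<in> iso (integer_mod_group n) G" unfolding iso_def C by simp
    then show ?thesis unfolding is_iso_def by blast
  qed
  then show ?thesis by (rule group.iso_sym[OF group_integer_mod_group])
qed

text \<open>
  A recognition criterion: the map \<open>(i, j) \<mapsto> x\<^sup>i y\<^sup>j\<close> is an isomorphism.
\<close>

lemma semidirect_product_iso:
  assumes x: "x \<in> carrier G" "ord x = n" "n > 0" and y: "y \<in> carrier G" "y [^] m = \<one>" "m > 0"
    and sd: "group (semidirect_product (integer_mod_group n) (integer_mod_group m) \<phi>)"
    and comm: "\<And>h b. h \<in> {0..<int m} \<Longrightarrow> b \<in> {0..<int n} \<Longrightarrow> y [^] h \<otimes> x [^] b = x [^] \<phi> h b \<otimes> y [^] h"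
    and disj: "\<And>j. 0 < j \<Longrightarrow> j < m \<Longrightarrow> y [^] (j::nat) \<notin> generate G {x}"
    and surj: "\<And>g. g \<in> carrier G \<Longrightarrow> \<exists>(i::int) (j::int). g = x [^] i \<otimes> y [^] j"
  shows "G \<cong> semidirect_product (integer_mod_group n) (integer_mod_group m) \<phi>" (is "G \<cong> ?H")
proof -
  have C: "carrier ?H = {0..<int n} \<times> {0..<int m}"
    using x y by (simp add: semidirect_product_def carrier_integer_mod_group)
  have xn: "x [^] n = \<one>" using x(1,2) by (simp add: pow_eq_id)
  define f where "f = (\<lambda>(i::int, j::int). x [^] i \<otimes> y [^] j)"
  have "?H \<cong> G"
  proof -
    have "inj_on f (carrier ?H)"
    proof (rule inj_onI, clarify)
      fix i j k l assume ij: "(i, j) \<in> carrier ?H" "(k, l) \<in> carrier ?H" "f (i, j) = f (k, l)"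
      then have eq: "x [^] i \<otimes> y [^] j = x [^] k \<otimes> y [^] l" by (simp add: f_def)
      have "x [^] i = x [^] k \<otimes> x [^] (i - k)" "y [^] l = y [^] (l - j) \<otimes> y [^] j"
        using x(1) y(1) by (simp_all flip: int_pow_mult)
      then have "x [^] k \<otimes> (x [^] (i - k) \<otimes> y [^] j) = x [^] k \<otimes> (y [^] (l - j) \<otimes> y [^] j)"
        using eq x(1) y(1) by (simp add: m_assoc)
      then have eq': "x [^] (i - k) = y [^] (l - j)" using x(1) y(1) by simp
      define d where "d = nat ((l - j) mod int m)"
      have "y [^] d = y [^] (l - j)"
        using int_pow_mod[OF y(1,2), of "l - j"] y(3) by (simp add: d_def flip: int_pow_int)
      then have "y [^] d \<in> generate G {x}" using eq' int_pow_mem_generate[OF x(1)] by metis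
      moreover have "d < m" using y(3) by (simp add: d_def nat_less_iff)
      ultimately have "d = 0" using disj[of d] by blast
      moreover have "0 \<le> (l - j) mod int m" using y(3) by simp
      ultimately have "(l - j) mod int m = 0" by (simp add: d_def)
      then have "l mod int m = j mod int m" by (simp add: mod_eq_dvd_iff dvd_eq_mod_eq_0)
      then have lj: "l = j" using ij by (simp add: C)
      then have "int n dvd i - k" using eq' int_pow_eq_id[OF x(1), of "i - k"] x(2) by simp
      then have "i mod int n = k mod int n" by (simp add: mod_eq_dvd_iff)
      then show "i = k \<and> j = l" using ij lj by (simp add: C)
    qed
    moreover have "f ` carrier ?H = carrier G"
    proof
      show "f ` carrier ?H \<subseteq> carrier G" using x y by (auto simp: f_def)
      show "carrier G \<subseteq> f ` carrier ?H"
      proof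
        fix g assume g: "g \<in> carrier G"
        obtain i j :: int where "g = x [^] i \<otimes> y [^] j" using surj[OF g] by (elim exE)
        then have "g = f (i mod int n, j mod int m)"
          using int_pow_mod[OF x(1) xn] int_pow_mod[OF y(1,2)] by (simp add: f_def)
        moreover have "(i mod int n, j mod int m) \<in> carrier ?H" using x(3) y(3) by (simp add: C)
        ultimately show "g \<in> f ` carrier ?H" by blast
      qed
    qed
    moreover have "f \<in> hom ?H G"
    proof (rule homI)
      fix a b assume "a \<in> carrier ?H" "b \<in> carrier ?H"
      then obtain i j k l where ab: "a = (i, j)" "b = (k, l)" "k \<in> {0..<int n}" "j \<in> {0..<int m}"
        by (auto simp: C)
      have "f (a \<otimes>\<^bsub>?H\<^esub> b) = x [^] (i + \<phi> j k) \<otimes> y [^] (j + l)"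
        unfolding ab by (simp add: f_def semidirect_product_def int_pow_mod[OF x(1) xn] int_pow_mod[OF y(1,2)])
      also have "\<dots> = x [^] i \<otimes> (x [^] \<phi> j k \<otimes> y [^] j) \<otimes> y [^] l"
        using x(1) y(1) by (simp add: int_pow_mult m_assoc)
      also have "\<dots> = f a \<otimes> f b"
        unfolding comm[OF ab(4,3), symmetric] using x(1) y(1) by (simp add: ab f_def m_assoc)
      finally show "f (a \<otimes>\<^bsub>?H\<^esub> b) = f a \<otimes> f b" .
    qed (use x y in \<open>auto simp: f_def\<close>)
    ultimately have "f \<in> iso ?H G" by (simp add: iso_def bij_betw_def)
    then show ?thesis unfolding is_iso_def by blast
  qed
  then show ?thesis by (rule group.iso_sym[OF sd])
qed

end

section \<open>Groups with one cyclic subgroup of order five or six\<close>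

context group
begin

lemma generate_eq_int_pow: "x \<in> carrier G \<Longrightarrow> generate G {x} = range (\<lambda>i::int. x [^] i)"
  using generate_pow[of x] by auto

lemma outer_pow_12:
  assumes "g \<in> carrier G" "ord g \<in> {1, 2, 3, 4}"
  shows "g [^] (12::nat) = \<one>"
  using assms by (auto simp: pow_eq_id)

lemma conj_ord:
  assumes g: "g \<in> carrier G" and x: "x \<in> carrier G"
  shows "ord (g \<otimes> x \<otimes> inv g) = ord x"
proof -
  have "(g \<otimes> x \<otimes> inv g) [^] n = \<one> \<longleftrightarrow> ord x dvd n" for n :: nat
  proof -
    from hom_nat_pow[OF conj_hom[OF g] x is_group is_group, of n]
    have "(g \<otimes> x \<otimes> inv g) [^] n = g \<otimes> x [^] n \<otimes> inv g" by simp
    also have "g \<otimes> x [^] n \<otimes> inv g = \<one> \<longleftrightarrow> x [^] n = \<one>"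
      using g x inv_solve_right[of "\<one>" "g \<otimes> x [^] n" g] by (auto simp: r_cancel_one')
    finally show ?thesis using pow_eq_id[OF x] by simp
  qed
  then show ?thesis using ord_unique[of "g \<otimes> x \<otimes> inv g" "ord x"] g x by simp
qed

lemma conj_mult:
  assumes g: "g \<in> carrier G" "g \<otimes> x = x [^] (r::int) \<otimes> g" and h: "h \<in> carrier G" "h \<otimes> x = x [^] (s::int) \<otimes> h"
    and x: "x \<in> carrier G"
  shows "(g \<otimes> h) \<otimes> x = x [^] (r * s) \<otimes> (g \<otimes> h)"
proof -
  have "(g \<otimes> h) \<otimes> x = g \<otimes> (x [^] s \<otimes> h)" using g h x by (simp add: m_assoc)
  also have "\<dots> = (g \<otimes> x [^] s) \<otimes> h" using g h x by (simp add: m_assoc)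
  also have "\<dots> = x [^] (r * s) \<otimes> (g \<otimes> h)" unfolding conj_int_pow[OF g(1) x g(2)] using g h x by (simp add: m_assoc)
  finally show ?thesis .
qed

lemma mem_generate_conj:
  assumes x: "x \<in> carrier G" and g: "g \<in> generate G {x}" "g \<otimes> x = x [^] (r::int) \<otimes> g"
  shows "int (ord x) dvd r - 1"
proof -
  obtain i :: int where i: "g = x [^] i" using g(1) generate_eq_int_pow[OF x] by auto
  have "x [^] (i + 1) = x [^] (r + i)" using g(2) x unfolding i by (simp add: int_pow_mult)
  then have "int (ord x) dvd (i + 1) - (r + i)" by (simp only: int_pow_eq_int_pow_iff[OF x])
  then show ?thesis by (simp add: dvd_diff_commute)
qed

lemma conj_mem_generate:
  assumes x: "x \<in> carrier G" "ord x \<in> {5, 6}"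
    and outer: "\<And>g. g \<in> carrier G - generate G {x} \<Longrightarrow> ord g \<in> {1, 2, 3, 4}" and g: "g \<in> carrier G"
  obtains k :: nat where "k < ord x" "g \<otimes> x = x [^] int k \<otimes> g" "ord (x [^] k) = ord x"
proof -
  have c: "ord (g \<otimes> x \<otimes> inv g) = ord x" by (rule conj_ord[OF g x(1)])
  then have "ord (g \<otimes> x \<otimes> inv g) \<notin> {1, 2, 3, 4}" using x(2) by auto
  then have "g \<otimes> x \<otimes> inv g \<in> generate G {x}" using outer[of "g \<otimes> x \<otimes> inv g"] g x by blast
  moreover have "ord x \<noteq> 0" using x(2) by auto
  ultimately obtain k where k: "k < ord x" "g \<otimes> x \<otimes> inv g = x [^] (k::nat)"
    using generate_singleton_eq_pow_image[OF x(1)] by auto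
  then have "g \<otimes> x = x [^] int k \<otimes> g"
    using g x by (metis int_pow_int inv_solve_right m_closed nat_pow_closed)
  then show ?thesis using that k c by simp
qed

lemma mem_generate_mult_iff:
  assumes x: "x \<in> carrier G" and g: "g \<in> carrier G" and a: "a \<in> generate G {x}"
  shows "g \<otimes> a \<in> generate G {x} \<longleftrightarrow> g \<in> generate G {x}"
proof -
  have sub: "subgroup (generate G {x}) G" using x by (intro generate_is_subgroup) simp
  have aC: "a \<in> carrier G" using a x generate_singleton_carrier by blast
  show ?thesis
  proof
    assume ga: "g \<otimes> a \<in> generate G {x}"
    have "(g \<otimes> a) \<otimes> inv a \<in> generate G {x}"
      by (rule subgroup.m_closed[OF sub ga subgroup.m_inv_closed[OF sub a]])
    then show "g \<in> generate G {x}" using g aC by (simp add: m_assoc)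
  qed (use subgroup.m_closed[OF sub _ a] in blast)
qed

text \<open>
  A subgroup \<open>\<langle>x\<rangle>\<close> of order \<open>5\<close> or \<open>6\<close> is its own centralizer, since for a commuting element \<open>g\<close> outside
  \<open>\<langle>x\<rangle>\<close> one of the products of \<open>g\<close> with a power of \<open>x\<close> would have an order greater than \<open>4\<close>.
\<close>

lemma commuting_mem_generate:
  assumes x: "x \<in> carrier G" "ord x \<in> {5, 6}"
    and outer: "\<And>g. g \<in> carrier G - generate G {x} \<Longrightarrow> ord g \<in> {1, 2, 3, 4}"
    and g: "g \<in> carrier G" "g \<otimes> x = x \<otimes> g"
  shows "g \<in> generate G {x}"
proof (rule ccontr)
  assume no: "g \<notin> generate G {x}"
  have comm: "g \<otimes> x [^] (j::nat) = x [^] j \<otimes> g" for j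
  proof -
    have "g \<otimes> x = x [^] (1::int) \<otimes> g" using g x by simp
    from conj_int_pow[OF g(1) x(1) this, of "int j"] show ?thesis by (simp add: int_pow_int)
  qed
  have prod: "ord (g \<otimes> x [^] j) \<in> {1, 2, 3, 4}"
    "(g \<otimes> x [^] j) [^] k = g [^] k \<otimes> x [^] (j * k)" for j k :: nat
  proof -
    have "g \<otimes> x [^] j \<in> carrier G - generate G {x}"
      using no mem_generate_mult_iff[OF x(1) g(1) pow_mem_generate[OF x(1)]] g x by auto
    then show "ord (g \<otimes> x [^] j) \<in> {1, 2, 3, 4}" by (rule outer)
    show "(g \<otimes> x [^] j) [^] k = g [^] k \<otimes> x [^] (j * k)"
      using pow_mult_distrib[OF comm[of j]] g x by (simp add: nat_pow_pow)
  qed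
  have og: "ord g \<in> {1, 2, 3, 4}" using no g outer by blast
  have pw: "(g \<otimes> x [^] j) [^] (4::nat) = \<one> \<or> (g \<otimes> x [^] j) [^] (3::nat) = \<one>" for j :: nat
    using prod(1)[of j] g x by (auto simp: pow_eq_id)
  have pg: "g [^] (4::nat) = \<one> \<or> g [^] (3::nat) = \<one>" using og g by (auto simp: pow_eq_id)
  have x_pow: "x [^] (k::nat) = \<one> \<longleftrightarrow> ord x dvd k" for k by (rule pow_eq_id[OF x(1)])
  have g1: "g = \<one>" if "g [^] (4::nat) = \<one>" "g [^] (3::nat) = \<one>"
  proof -
    have "g [^] (4::nat) = g [^] (3::nat) \<otimes> g" by (simp add: numeral_eq_Suc)
    then show ?thesis using that g by simp
  qed
  have gne: "g \<noteq> \<one>" using no generate.one by blast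
  show False
  proof (cases "ord x = 5")
    case True
    have "(g \<otimes> x) [^] (12::nat) = \<one>" "g [^] (12::nat) = \<one>"
      using outer_pow_12[OF _ prod(1)[of 1]] outer_pow_12[OF g(1) og] g x by simp_all
    then have "x [^] (12::nat) = \<one>" using prod(2)[of 1 12] x by simp
    then show False using x_pow[of 12] True by simp
  next
    case False
    then have o6: "ord x = 6" using x(2) by simp
    from pg show False
    proof
      assume g4: "g [^] (4::nat) = \<one>"
      then have "(g \<otimes> x [^] (2::nat)) [^] (4::nat) = x [^] (8::nat)" using prod(2)[of 2 4] x by simp
      then have "(g \<otimes> x [^] (2::nat)) [^] (3::nat) = \<one>" using pw[of 2] x_pow[of 8] o6 by simp
      then have "g [^] (3::nat) = \<one>" using prod(2)[of 2 3] x_pow[of 6] o6 g by simp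
      then show False using g1 g4 gne by blast
    next
      assume g3: "g [^] (3::nat) = \<one>"
      then have "(g \<otimes> x [^] (3::nat)) [^] (3::nat) = x [^] (9::nat)" using prod(2)[of 3 3] x by simp
      then have "(g \<otimes> x [^] (3::nat)) [^] (4::nat) = \<one>" using pw[of 3] x_pow[of 9] o6 by simp
      then have "g [^] (4::nat) = \<one>" using prod(2)[of 3 4] x_pow[of 12] o6 g by simp
      then show False using g1 g3 gne by blast
    qed
  qed
qed

lemma mult_pow_mem_generate_imp:
  assumes x: "x \<in> carrier G" and y: "y \<in> carrier G" and g: "g \<in> carrier G" "g \<otimes> y [^] (t::nat) \<in> generate G {x}"
  shows "\<exists>(i::int) (j::int). g = x [^] i \<otimes> y [^] j"
proof -
  obtain i :: int where "g \<otimes> y [^] t = x [^] i" using g(2) generate_eq_int_pow[OF x] by auto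
  then have "g = x [^] i \<otimes> y [^] (- int t)" using g(1) x y
    by (metis int_pow_closed int_pow_neg_int inv_solve_right nat_pow_closed)
  then show ?thesis by blast
qed

lemma inversion_action_commutation:
  assumes x: "x \<in> carrier G" "ord x = n" "n > 0" and y: "y \<in> carrier G" "y \<otimes> x = x [^] (-1::int) \<otimes> y"
    and h: "h \<ge> 0" and b: "b \<in> {0..<int n}"
  shows "y [^] h \<otimes> x [^] b = x [^] inversion_action n h b \<otimes> y [^] h"
proof -
  have bC: "b \<in> carrier (integer_mod_group n)" using b x by (simp add: carrier_integer_mod_group)
  have xn: "x [^] n = \<one>" using x(1,2) by (simp add: pow_eq_id)
  obtain t where t: "h = int t" using h nonneg_int_cases by blast
  have "y [^] h \<otimes> x [^] b = x [^] ((-1) ^ t * b) \<otimes> y [^] h"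
    using conj_int_pow_iterate[OF y(1) x(1) y(2)] by (simp add: t int_pow_int)
  also have "x [^] ((-1) ^ t * b) = x [^] inversion_action n h b"
    using int_pow_mod[OF x(1) xn, of "- b"] bC by (cases "even t") (simp_all add: t inversion_action_def)
  finally show ?thesis .
qed

text \<open>
  The group acts by conjugation on \<open>\<langle>x\<rangle> \<cong> \<int>\<^sub>5\<close> with kernel \<open>\<langle>x\<rangle>\<close>, so that its quotient by \<open>\<langle>x\<rangle>\<close> embeds
  into the cyclic automorphism group of order \<open>4\<close>.  The image of this action decides between the three groups.
\<close>

lemma order_5_classification:
  assumes x: "x \<in> carrier G" "ord x = 5"
    and outer: "\<And>g. g \<in> carrier G - generate G {x} \<Longrightarrow> ord g \<in> {1, 2, 3, 4}"
  shows "G \<cong> integer_mod_group 5 \<or> G \<cong> dihedral_group 5 \<or> G \<cong> frobenius_group_20"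
proof -
  have o: "ord x \<in> {5, 6}" using x by simp
  have xeq: "x [^] (i::int) = x [^] (j::int) \<longleftrightarrow> 5 dvd i - j" for i j
    using int_pow_eq_int_pow_iff[OF x(1)] x(2) by simp
  have act: "\<exists>k\<in>{1, 2, 3, 4}. g \<otimes> x = x [^] (k::int) \<otimes> g" if g: "g \<in> carrier G" for g
  proof -
    obtain k :: nat where k: "k < 5" "g \<otimes> x = x [^] int k \<otimes> g" "ord (x [^] k) = 5"
      using conj_mem_generate[OF x(1) o outer g] x(2) by metis
    have "k \<noteq> 0" using k(3) by (cases k) auto
    then have "k = 1 \<or> k = 2 \<or> k = 3 \<or> k = 4" using k(1) by linarith
    then have "int k \<in> {1, 2, 3, 4}" by auto
    then show ?thesis using k(2) by blast
  qed
  have cent: "g \<in> generate G {x}" if "g \<in> carrier G" "g \<otimes> x = x [^] (k::int) \<otimes> g" "5 dvd k - 1" for g k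
  proof -
    have "x [^] k = x" using xeq[of k 1] that(3) x(1) by simp
    then show ?thesis using commuting_mem_generate[OF x(1) o outer that(1)] that(2) by simp
  qed
  have torsion: "a = \<one>" if a: "a \<in> generate G {x}" "a [^] (6::nat) = \<one>" for a
  proof -
    obtain i :: int where i: "a = x [^] i" using a(1) generate_eq_int_pow[OF x(1)] by auto
    have "a [^] (6::nat) = x [^] (i * 6)" using int_pow_int[of G a 6] x(1) i by (simp add: int_pow_pow)
    then have "5 dvd i * 6" using a(2) xeq[of "i * 6" 0] by simp
    then have "5 dvd i" by presburger
    then show ?thesis using xeq[of i 0] i by simp
  qed
  have y_pow: "y [^] (t::nat) \<otimes> x = x [^] (r ^ t) \<otimes> y [^] t"
    if "y \<in> carrier G" "y \<otimes> x = x [^] (r::int) \<otimes> y" for y r t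
    using conj_int_pow_iterate[OF that(1) x(1) that(2), of t 1] x(1) by simp
  have y12: "y [^] (12::nat) = \<one>" if "y \<in> carrier G" "y \<notin> generate G {x}" for y
    using outer_pow_12[OF that(1)] outer that by blast
  have Zx: "x \<in> carrier G" "ord x = 5" "(0::nat) < 5" using x by simp_all
  consider (cyclic) "carrier G = generate G {x}"
    | (four) y k where "y \<in> carrier G" "k \<in> {2, 3}" "y \<otimes> x = x [^] (k::int) \<otimes> y"
    | (two) y where "y \<in> carrier G" "y \<notin> generate G {x}"
        "\<And>g. g \<in> carrier G \<Longrightarrow> \<exists>k\<in>{1, 4}. g \<otimes> x = x [^] (k::int) \<otimes> g"
  proof (cases "\<exists>y\<in>carrier G. \<exists>k\<in>{2, 3}. y \<otimes> x = x [^] (k::int) \<otimes> y")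
    case False
    then have *: "\<exists>k\<in>{1, 4}. g \<otimes> x = x [^] (k::int) \<otimes> g" if "g \<in> carrier G" for g
      using act[OF that] that by auto
    have "carrier G = generate G {x} \<or> (\<exists>y\<in>carrier G. y \<notin> generate G {x})"
      using generate_singleton_carrier[OF x(1)] by blast
    then show ?thesis using that(1,3) * by blast
  qed (use that(2) in blast)
  then show ?thesis
  proof cases
    case cyclic
    then show ?thesis using integer_mod_group_iso[OF Zx] by blast
  next
    case (two y)
    have y4: "y \<otimes> x = x [^] (4::int) \<otimes> y"
      using two(3)[OF two(1)] cent[OF two(1), of 1] two(2) by auto
    have ym: "y \<otimes> x = x [^] (-1::int) \<otimes> y" using y4 xeq[of 4 "-1"] by simp
    have "y [^] (2::nat) \<in> generate G {x}"
      using cent[OF _ y_pow[OF two(1) y4, of 2]] two(1) by simp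
    moreover have "(y [^] (2::nat)) [^] (6::nat) = \<one>" using y12[OF two(1,2)] two(1) by (simp add: nat_pow_pow)
    ultimately have y2: "y [^] (2::nat) = \<one>" by (rule torsion)
    have "G \<cong> dihedral_group 5"
      unfolding dihedral_group_def
    proof (rule semidirect_product_iso[OF Zx two(1) y2])
      show "group (semidirect_product (integer_mod_group 5) (integer_mod_group 2) (inversion_action 5))"
        using group_dihedral_group[of 5] by (simp add: dihedral_group_def)
      show "y [^] h \<otimes> x [^] b = x [^] inversion_action 5 h b \<otimes> y [^] h"
        if "h \<in> {0..<int 2}" "b \<in> {0..<int 5}" for h b
        using that by (intro inversion_action_commutation[OF Zx two(1) ym]) auto
      show "y [^] j \<notin> generate G {x}" if "0 < j" "j < 2" for j :: nat
      proof -
        have "j = 1" using that by simp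
        then show ?thesis using two(1,2) by simp
      qed
      show "\<exists>(i::int) (j::int). g = x [^] i \<otimes> y [^] j" if g: "g \<in> carrier G" for g
      proof -
        obtain k :: int where k: "k \<in> {1, 4}" "g \<otimes> x = x [^] k \<otimes> g" using two(3)[OF g] by blast
        have "g \<otimes> y [^] t \<in> generate G {x}" if "5 dvd k * 4 ^ t - 1" for t :: nat
          using cent[OF _ conj_mult[OF g k(2) _ y_pow[OF two(1) y4] x(1)] that] g two(1) by simp
        moreover have "5 dvd k * 4 ^ 0 - 1 \<or> 5 dvd k * 4 ^ 1 - 1" using k(1) by auto
        ultimately have "\<exists>t::nat. g \<otimes> y [^] t \<in> generate G {x}" by metis
        then show ?thesis using mult_pow_mem_generate_imp[OF x(1) two(1) g] by blast
      qed
    qed simp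
    then show ?thesis by blast
  next
    case (four z l)
    obtain y where y: "y \<in> carrier G" "y \<otimes> x = x [^] (2::int) \<otimes> y"
    proof (cases "l = 2")
      case False
      then have "l = 3" using four(2) by simp
      (* 3 ^ 3 is 2 modulo 5 *)
      then have "z [^] (3::nat) \<otimes> x = x [^] (27::int) \<otimes> z [^] (3::nat)"
        using y_pow[OF four(1,3), of 3] by simp
      then show ?thesis using that[of "z [^] (3::nat)"] four(1) xeq[of 27 2] by simp
    qed (use four that in blast)
    have out: "y [^] j \<notin> generate G {x}" if "0 < j" "j < 4" for j :: nat
    proof
      assume "y [^] j \<in> generate G {x}"
      from mem_generate_conj[OF x(1) this y_pow[OF y]] have "5 dvd (2::int) ^ j - 1" using x(2) by simp
      moreover have "j = 1 \<or> j = 2 \<or> j = 3" using that by linarith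
      ultimately show False by auto
    qed
    have "y [^] (4::nat) \<in> generate G {x}"
      using cent[OF _ y_pow[OF y, of 4]] y(1) by simp
    moreover have "y [^] (12::nat) = \<one>" using y12[OF y(1)] out[of 1] y(1) by simp
    then have "ord y dvd 12 * 2" using y(1) by (intro dvd_mult2) (simp add: pow_eq_id)
    then have "y [^] (24::nat) = \<one>" using y(1) by (simp add: pow_eq_id)
    then have "(y [^] (4::nat)) [^] (6::nat) = \<one>" using y(1) by (simp add: nat_pow_pow)
    ultimately have y4: "y [^] (4::nat) = \<one>" by (rule torsion)
    have "G \<cong> frobenius_group_20"
      unfolding frobenius_group_20_def
    proof (rule semidirect_product_iso[OF Zx y(1) y4])
      show "group (semidirect_product (integer_mod_group 5) (integer_mod_group 4) frobenius_action_5_4)"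
        using group_frobenius_group_20 by (simp add: frobenius_group_20_def)
      show "y [^] h \<otimes> x [^] b = x [^] frobenius_action_5_4 h b \<otimes> y [^] h"
        if h: "h \<in> {0..<int 4}" for h b
      proof -
        have "h = int (nat h)" using h by simp
        then obtain t where t: "h = int t" by blast
        have "x [^] frobenius_action_5_4 h b = x [^] (2 ^ t * b)"
          unfolding frobenius_action_5_4_def t xeq by (simp add: mod_eq_dvd_iff[symmetric])
        then show ?thesis using conj_int_pow_iterate[OF y(1) x(1) y(2), of t b] by (simp add: t int_pow_int)
      qed
      show "\<exists>(i::int) (j::int). g = x [^] i \<otimes> y [^] j" if g: "g \<in> carrier G" for g
      proof -
        obtain k :: int where k: "k \<in> {1, 2, 3, 4}" "g \<otimes> x = x [^] k \<otimes> g" using act[OF g] by blast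
        have "g \<otimes> y [^] t \<in> generate G {x}" if "5 dvd k * 2 ^ t - 1" for t :: nat
          using cent[OF _ conj_mult[OF g k(2) _ y_pow[OF y] x(1)] that] g y(1) by simp
        moreover have "5 dvd k * 2 ^ 0 - 1 \<or> 5 dvd k * 2 ^ 1 - 1 \<or> 5 dvd k * 2 ^ 2 - 1 \<or> 5 dvd k * 2 ^ 3 - 1"
          using k(1) by auto
        ultimately have "\<exists>t::nat. g \<otimes> y [^] t \<in> generate G {x}" by metis
        then show ?thesis using mult_pow_mem_generate_imp[OF x(1) y(1) g] by blast
      qed
    qed (use out in simp_all)
    then show ?thesis by blast
  qed
qed

text \<open>
  Conjugation fixes or inverts \<open>x\<close>, and the elements that fix it form \<open>\<langle>x\<rangle>\<close>.  If \<open>y\<close> inverts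
  \<open>x\<close>, then \<open>y\<^sup>2\<close> is a power of \<open>x\<close> that is both fixed and inverted by \<open>y\<close>, so it is \<open>\<one>\<close> or the involution
  \<open>x\<^sup>3\<close>.
\<close>

lemma order_6_classification:
  assumes x: "x \<in> carrier G" "ord x = 6"
    and outer: "\<And>g. g \<in> carrier G - generate G {x} \<Longrightarrow> ord g \<in> {1, 2, 3, 4}"
  shows "G \<cong> integer_mod_group 6 \<or> G \<cong> dihedral_group 6 \<or> G \<cong> dicyclic_group_12"
proof -
  have o: "ord x \<in> {5, 6}" using x by simp
  have Zx: "x \<in> carrier G" "ord x = 6" "(0::nat) < 6" using x by simp_all
  have xeq: "x [^] (i::int) = x [^] (j::int) \<longleftrightarrow> 6 dvd i - j" for i j
    using int_pow_eq_int_pow_iff[OF x(1)] x(2) by simp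
  have act: "\<exists>k\<in>{1, -1}. g \<otimes> x = x [^] (k::int) \<otimes> g" if g: "g \<in> carrier G" for g
  proof -
    obtain k :: nat where k: "k < 6" "g \<otimes> x = x [^] int k \<otimes> g" "ord (x [^] k) = 6"
      using conj_mem_generate[OF x(1) o outer g] x(2) by metis
    have "(x [^] k) [^] (2::nat) \<noteq> \<one>" "(x [^] k) [^] (3::nat) \<noteq> \<one>"
      using k(3) x(1) by (simp_all add: pow_eq_id)
    then have "\<not> 6 dvd k * 2" "\<not> 6 dvd k * 3"
      using x by (simp_all add: nat_pow_pow pow_eq_id)
    then have "k = 1 \<or> k = 5" using k(1) by presburger
    then have "x [^] int k = x [^] (1::int) \<or> x [^] int k = x [^] (-1::int)" by (auto simp: xeq)
    then show ?thesis using k(2) by auto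
  qed
  have cent: "g \<in> generate G {x}" if "g \<in> carrier G" "g \<otimes> x = x [^] (1::int) \<otimes> g" for g
    using commuting_mem_generate[OF x(1) o outer that(1)] that(2) x(1) by simp
  consider (cyclic) "carrier G = generate G {x}" | (two) y where "y \<in> carrier G" "y \<notin> generate G {x}"
    using generate_singleton_carrier[OF x(1)] by blast
  then show ?thesis
  proof cases
    case cyclic
    then show ?thesis using integer_mod_group_iso[OF Zx] by blast
  next
    case (two y)
    have y: "y \<otimes> x = x [^] (-1::int) \<otimes> y"
      using act[OF two(1)] cent[OF two(1)] two(2) by auto
    have "(y \<otimes> y) \<otimes> x = x [^] (1::int) \<otimes> (y \<otimes> y)"
      using conj_mult[OF two(1) y two(1) y x(1)] by simp
    then have "y \<otimes> y \<in> generate G {x}" using cent two(1) by simp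
    then obtain i :: int where i: "y \<otimes> y = x [^] i" using generate_eq_int_pow[OF x(1)] by auto
    have "y \<otimes> x [^] i = x [^] i \<otimes> y" using two(1) by (simp flip: i add: m_assoc)
    then have "x [^] (- i) \<otimes> y = x [^] i \<otimes> y" using conj_int_pow[OF two(1) x(1) y, of i] by simp
    then have "x [^] (- i) = x [^] i" using two(1) x(1) by simp
    then have "6 dvd 2 * i" using xeq[of "- i" i] by presburger
    then have "6 dvd i - 0 \<or> 6 dvd i - 3" by presburger
    then have y2: "y [^] (2::nat) = \<one> \<or> y [^] (2::nat) = x [^] (3::int)"
      using i xeq[of i 0] xeq[of i 3] two(1) by (auto simp: numeral_2_eq_2)
    have coset: "\<exists>(i::int) (j::int). g = x [^] i \<otimes> y [^] j" if g: "g \<in> carrier G" for g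
    proof -
      obtain k :: int where k: "k \<in> {1, -1}" "g \<otimes> x = x [^] k \<otimes> g" using act[OF g] by blast
      have "g \<otimes> y [^] (0::nat) \<in> generate G {x} \<or> g \<otimes> y [^] (1::nat) \<in> generate G {x}"
      proof (cases "k = 1")
        case True
        then show ?thesis using cent[OF g] k(2) g by simp
      next
        case False
        then have "(g \<otimes> y) \<otimes> x = x [^] (1::int) \<otimes> (g \<otimes> y)"
          using conj_mult[OF g k(2) two(1) y x(1)] k(1) by simp
        then show ?thesis using cent[of "g \<otimes> y"] g two(1) by simp
      qed
      then show ?thesis using mult_pow_mem_generate_imp[OF x(1) two(1) g] by blast
    qed
    from y2 show ?thesis
    proof
      assume y2: "y [^] (2::nat) = \<one>"
      have "G \<cong> dihedral_group 6"
        unfolding dihedral_group_def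
      proof (rule semidirect_product_iso[OF Zx two(1) y2])
        show "group (semidirect_product (integer_mod_group 6) (integer_mod_group 2) (inversion_action 6))"
          using group_dihedral_group[of 6] by (simp add: dihedral_group_def)
        show "y [^] h \<otimes> x [^] b = x [^] inversion_action 6 h b \<otimes> y [^] h"
          if "h \<in> {0..<int 2}" "b \<in> {0..<int 6}" for h b
          using that by (intro inversion_action_commutation[OF Zx two(1) y]) auto
        show "y [^] j \<notin> generate G {x}" if "0 < j" "j < 2" for j :: nat
        proof -
          have "j = 1" using that by simp
          then show ?thesis using two(1,2) by simp
        qed
      qed (use coset in simp_all)
      then show ?thesis by blast
    next
      assume y2: "y [^] (2::nat) = x [^] (3::int)"
      define w where "w = x [^] (2::int)"
      have w_pow: "w [^] (i::int) = x [^] (2 * i)" for i using x(1) by (simp add: w_def int_pow_pow)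
      have w: "w \<in> carrier G" "ord w = 3" "(0::nat) < 3"
        using x ord_pow[OF x(1), of 2] int_pow_int[of G x 2] by (simp_all add: w_def)
      have y_even: "y [^] (2 * j :: int) = x [^] (3 * j)" for j
      proof -
        have "y [^] (2::int) = x [^] (3::int)" using y2 int_pow_int[of G y 2] by simp
        then show ?thesis using int_pow_pow[OF two(1), of 2 j] int_pow_pow[OF x(1), of 3 j] by simp
      qed
      have y4: "y [^] (4::nat) = \<one>"
        using y_even[of 2] xeq[of 6 0] int_pow_int[of G y 4] by simp
      have yw: "y \<otimes> w = w [^] (-1::int) \<otimes> y"
        unfolding w_pow unfolding w_def using conj_int_pow[OF two(1) x(1) y, of 2] by simp
      have "G \<cong> dicyclic_group_12"
        unfolding dicyclic_group_12_def
      proof (rule semidirect_product_iso[OF w two(1) y4])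
        show "group (semidirect_product (integer_mod_group 3) (integer_mod_group 4) (inversion_action 3))"
          using group_dicyclic_group_12 by (simp add: dicyclic_group_12_def)
        show "y [^] h \<otimes> w [^] b = w [^] inversion_action 3 h b \<otimes> y [^] h"
          if "h \<in> {0..<int 4}" "b \<in> {0..<int 3}" for h b
          using that by (intro inversion_action_commutation[OF w two(1) yw]) auto
        show "y [^] j \<notin> generate G {w}" if j: "0 < j" "j < 4" for j :: nat
        proof
          assume "y [^] j \<in> generate G {w}"
          then obtain i :: int where i: "y [^] j = x [^] (2 * i)"
            using generate_eq_int_pow[OF w(1)] by (auto simp: w_pow)
          have "j = 1 \<or> j = 2 \<or> j = 3" using j by linarith
          then show False
          proof (elim disjE)
            assume "j = 1"
            then have "y = x [^] (2 * i)" using i two(1) by simp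
            then show False using two(2) int_pow_mem_generate[OF x(1)] by metis
          next
            assume "j = 2"
            then have "6 dvd 3 - 2 * i" using i y2 xeq by simp
            then show False by presburger
          next
            assume "j = 3"
            then have "x [^] (3::int) \<otimes> y = x [^] (2 * i)" using i y2 by (simp add: numeral_eq_Suc)
            then have "x [^] (3::int) \<otimes> y = x [^] (3::int) \<otimes> x [^] (2 * i - 3)" using x(1) by (simp flip: int_pow_mult)
            then have "y = x [^] (2 * i - 3)" using x(1) two(1) by simp
            then show False using two(2) int_pow_mem_generate[OF x(1)] by metis
          qed
        qed
        show "\<exists>(i::int) (j::int). g = w [^] i \<otimes> y [^] j" if g: "g \<in> carrier G" for g
        proof -
          obtain i j :: int where ij: "g = x [^] i \<otimes> y [^] j" using coset[OF g] by blast
          (* x = w^-1 y^2, because the square of y is the cube of x *)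
          have "x [^] i = w [^] (- i) \<otimes> y [^] (2 * i)"
            unfolding w_pow y_even using x(1) by (simp flip: int_pow_mult)
          then have "g = w [^] (- i) \<otimes> y [^] (2 * i + j)"
            using ij w(1) two(1) by (simp add: m_assoc int_pow_mult)
          then show ?thesis by blast
        qed
      qed simp
      then show ?thesis by blast
    qed
  qed
qed

end

section \<open>Orders of elements in the listed groups\<close>

text \<open>
  The condition on the orders of elements is transported along an isomorphism.  The element \<open>x\<close> of \<open>H\<close>
  has order \<open>n\<close>, and every element of \<open>H\<close> that is not a power of \<open>x\<close> has an order dividing \<open>4\<close>.
\<close>

lemma orders_of_isomorphic_group:
  assumes G: "group G" and H: "group H" and iso: "G \<cong> H"
    and x: "x \<in> carrier H" "\<And>k. x [^]\<^bsub>H\<^esub> (k::nat) = \<one>\<^bsub>H\<^esub> \<longleftrightarrow> n dvd k"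
    and outer: "\<And>g. g \<in> carrier H \<Longrightarrow> g [^]\<^bsub>H\<^esub> (4::nat) = \<one>\<^bsub>H\<^esub> \<or> (\<exists>k::nat. g = x [^]\<^bsub>H\<^esub> k)"
  shows "\<exists>x\<in>carrier G. group.ord G x = n \<and> (\<forall>g\<in>carrier G - generate G {x}. group.ord G g \<in> {1, 2, 3, 4})"
proof -
  interpret G: group G by fact
  interpret H: group H by fact
  obtain f where f: "f \<in> hom G H" "bij_betw f (carrier G) (carrier H)"
    using iso unfolding is_iso_def iso_def by blast
  interpret f: group_hom G H f by unfold_locales (rule f(1))
  have inj: "f a = f b \<longleftrightarrow> a = b" if "a \<in> carrier G" "b \<in> carrier G" for a b
    using f(2) that by (auto simp: bij_betw_def inj_on_def)
  have pow_1: "a [^]\<^bsub>G\<^esub> (k::nat) = \<one>\<^bsub>G\<^esub> \<longleftrightarrow> f a [^]\<^bsub>H\<^esub> k = \<one>\<^bsub>H\<^esub>" if "a \<in> carrier G" for a k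
    using inj[of "a [^]\<^bsub>G\<^esub> k" "\<one>\<^bsub>G\<^esub>"] that by (simp add: f.hom_nat_pow)
  have "x \<in> f ` carrier G" using f(2) x(1) by (simp add: bij_betw_def)
  then obtain y where y: "y \<in> carrier G" "f y = x" by blast
  have "G.ord y = n" using G.ord_unique[OF y(1), of n] pow_1[OF y(1)] x(2) y(2) by simp
  moreover have "G.ord g \<in> {1, 2, 3, 4}" if g: "g \<in> carrier G - generate G {y}" for g
  proof -
    have "f g \<noteq> x [^]\<^bsub>H\<^esub> k" for k :: nat
    proof
      assume "f g = x [^]\<^bsub>H\<^esub> k"
      then have "f g = f (y [^]\<^bsub>G\<^esub> k)" using y by (simp add: f.hom_nat_pow)
      then have "g = y [^]\<^bsub>G\<^esub> k" using inj[of g "y [^]\<^bsub>G\<^esub> k"] g y by simp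
      then show False using g G.pow_mem_generate[OF y(1)] by simp
    qed
    moreover have "f g \<in> carrier H" using g by simp
    ultimately have "f g [^]\<^bsub>H\<^esub> (4::nat) = \<one>\<^bsub>H\<^esub>" using outer by metis
    then have dvd: "G.ord g dvd 4" using pow_1[of g 4] g by (simp add: G.pow_eq_id)
    then have "G.ord g \<noteq> 0" by (intro notI) simp
    moreover have "G.ord g \<le> 4" using dvd by (rule dvd_imp_le) simp
    ultimately have "G.ord g = 1 \<or> G.ord g = 2 \<or> G.ord g = 3 \<or> G.ord g = 4" by linarith
    then show ?thesis by auto
  qed
  ultimately show ?thesis using y by blast
qed

lemma integer_mod_group_orders:
  assumes "group G" "G \<cong> integer_mod_group n" "n > 1"
  shows "\<exists>x\<in>carrier G. group.ord G x = n \<and> (\<forall>g\<in>carrier G - generate G {x}. group.ord G g \<in> {1, 2, 3, 4})"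
proof (rule orders_of_isomorphic_group[OF assms(1) group_integer_mod_group assms(2), of 1])
  show "1 \<in> carrier (integer_mod_group n)" using assms(3) by simp
  show "1 [^]\<^bsub>integer_mod_group n\<^esub> k = \<one>\<^bsub>integer_mod_group n\<^esub> \<longleftrightarrow> n dvd k" for k :: nat
    by (simp add: dvd_eq_mod_eq_0[symmetric] flip: zmod_int)
  show "g [^]\<^bsub>integer_mod_group n\<^esub> (4::nat) = \<one>\<^bsub>integer_mod_group n\<^esub> \<or> (\<exists>k::nat. g = 1 [^]\<^bsub>integer_mod_group n\<^esub> k)"
    if "g \<in> carrier (integer_mod_group n)" for g
    using that assms(3) by (intro disjI2 exI[of _ "nat g"]) (simp add: carrier_integer_mod_group)
qed

lemma semidirect_product_pow:
  assumes "n > 1" "\<phi> 0 1 = 1"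
  shows "(1, 0) [^]\<^bsub>semidirect_product (integer_mod_group n) (integer_mod_group m) \<phi>\<^esub> (k::nat) = (int k mod int n, 0)"
proof (induction k)
  case (Suc k)
  have "(int k mod int n + 1) mod int n = (1 + int k) mod int n" by (simp add: mod_simps add.commute)
  then show ?case using Suc assms by (simp add: semidirect_product_def)
qed (simp add: semidirect_product_def)

lemma dihedral_group_orders:
  assumes "group G" "G \<cong> dihedral_group n" "n > 1"
  shows "\<exists>x\<in>carrier G. group.ord G x = n \<and> (\<forall>g\<in>carrier G - generate G {x}. group.ord G g \<in> {1, 2, 3, 4})"
proof (rule orders_of_isomorphic_group[OF assms(1) group_dihedral_group assms(2), of "(1, 0)"])
  have pow: "(1, 0) [^]\<^bsub>dihedral_group n\<^esub> k = (int k mod int n, 0)" for k :: nat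
    unfolding dihedral_group_def by (rule semidirect_product_pow) (use assms(3) in \<open>simp_all add: inversion_action_def\<close>)
  have C: "carrier (dihedral_group n) = {0..<int n} \<times> {0..<2}"
    and one: "\<one>\<^bsub>dihedral_group n\<^esub> = (0, 0)"
    using assms(3) by (simp_all add: dihedral_group_def semidirect_product_def carrier_integer_mod_group)
  show "(1, 0) \<in> carrier (dihedral_group n)" using assms(3) by (simp add: C)
  show "(1, 0) [^]\<^bsub>dihedral_group n\<^esub> k = \<one>\<^bsub>dihedral_group n\<^esub> \<longleftrightarrow> n dvd k" for k :: nat
    by (simp add: pow one dvd_eq_mod_eq_0[symmetric] flip: zmod_int)
  show "g [^]\<^bsub>dihedral_group n\<^esub> (4::nat) = \<one>\<^bsub>dihedral_group n\<^esub> \<or> (\<exists>k::nat. g = (1, 0) [^]\<^bsub>dihedral_group n\<^esub> k)"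
    if gH: "g \<in> carrier (dihedral_group n)" for g
  proof -
    obtain a s where g: "g = (a, s)" "a \<in> {0..<int n}" "s \<in> {0..<2}" using gH C by auto
    then have "s = 0 \<or> s = 1" by auto
    then show ?thesis
    proof
      assume "s = 0"
      then have "g = (1, 0) [^]\<^bsub>dihedral_group n\<^esub> nat a" using g by (simp add: pow)
      then show ?thesis by blast
    next
      assume s: "s = 1"
      have "g \<otimes>\<^bsub>dihedral_group n\<^esub> g = \<one>\<^bsub>dihedral_group n\<^esub>"
        using g s assms(3) by (simp add: dihedral_group_def semidirect_product_def inversion_action_def
            carrier_integer_mod_group mod_simps)
      then have "g [^]\<^bsub>dihedral_group n\<^esub> (4::nat) = \<one>\<^bsub>dihedral_group n\<^esub>"
        using gH group.is_monoid[OF group_dihedral_group[of n]]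
        by (simp add: numeral_eq_Suc monoid.l_one monoid.one_closed)
      then show ?thesis by blast
    qed
  qed
qed

lemma frobenius_group_20_orders:
  assumes "group G" "G \<cong> frobenius_group_20"
  shows "\<exists>x\<in>carrier G. group.ord G x = 5 \<and> (\<forall>g\<in>carrier G - generate G {x}. group.ord G g \<in> {1, 2, 3, 4})"
proof (rule orders_of_isomorphic_group[OF assms(1) group_frobenius_group_20 assms(2), of "(1, 0)"])
  have pow: "(1, 0) [^]\<^bsub>frobenius_group_20\<^esub> k = (int k mod int 5, 0)" for k :: nat
    unfolding frobenius_group_20_def by (rule semidirect_product_pow) (simp_all add: frobenius_action_5_4_def)
  have C: "carrier frobenius_group_20 = {0..<5} \<times> {0..<4}" and one: "\<one>\<^bsub>frobenius_group_20\<^esub> = (0, 0)"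
    by (simp_all add: frobenius_group_20_def semidirect_product_def carrier_integer_mod_group)
  have mult: "(a, h) \<otimes>\<^bsub>frobenius_group_20\<^esub> (b, k) = ((a + frobenius_action_5_4 h b) mod 5, (h + k) mod 4)" for a h b k
    by (simp add: frobenius_group_20_def semidirect_product_def)
  show "(1, 0) \<in> carrier frobenius_group_20" by (simp add: C)
  show "(1, 0) [^]\<^bsub>frobenius_group_20\<^esub> k = \<one>\<^bsub>frobenius_group_20\<^esub> \<longleftrightarrow> 5 dvd k" for k :: nat
    unfolding pow one by simp presburger
  show "g [^]\<^bsub>frobenius_group_20\<^esub> (4::nat) = \<one>\<^bsub>frobenius_group_20\<^esub> \<or> (\<exists>k::nat. g = (1, 0) [^]\<^bsub>frobenius_group_20\<^esub> k)"
    if gH: "g \<in> carrier frobenius_group_20" for g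
  proof -
    obtain a s where g: "g = (a, s)" "a \<in> {0..<5}" "s \<in> {0..<4}" using gH C by auto
    then have "s = 0 \<or> s \<in> {1, 2, 3}" by auto
    then show ?thesis
    proof
      assume "s = 0"
      then have "g = (1, 0) [^]\<^bsub>frobenius_group_20\<^esub> nat a" using g by (simp add: pow)
      then show ?thesis by blast
    next
      assume s: "s \<in> {1, 2, 3}"
      have "a \<in> {0, 1, 2, 3, 4}" using g by auto
      with s have "g \<otimes>\<^bsub>frobenius_group_20\<^esub> g \<otimes>\<^bsub>frobenius_group_20\<^esub> g \<otimes>\<^bsub>frobenius_group_20\<^esub> g = \<one>\<^bsub>frobenius_group_20\<^esub>"
        unfolding g(1) one by (elim insertE emptyE; simp add: mult frobenius_action_5_4_def)
      then have "g [^]\<^bsub>frobenius_group_20\<^esub> (4::nat) = \<one>\<^bsub>frobenius_group_20\<^esub>"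
        using gH group.is_monoid[OF group_frobenius_group_20] by (simp add: numeral_eq_Suc monoid.l_one)
      then show ?thesis by blast
    qed
  qed
qed

lemma dicyclic_group_12_orders:
  assumes "group G" "G \<cong> dicyclic_group_12"
  shows "\<exists>x\<in>carrier G. group.ord G x = 6 \<and> (\<forall>g\<in>carrier G - generate G {x}. group.ord G g \<in> {1, 2, 3, 4})"
proof (rule orders_of_isomorphic_group[OF assms(1) group_dicyclic_group_12 assms(2), of "(1, 2)"])
  (* (1, 2) is the product of an element of order 3 and the central involution *)
  have C: "carrier dicyclic_group_12 = {0..<3} \<times> {0..<4}" and one: "\<one>\<^bsub>dicyclic_group_12\<^esub> = (0, 0)"
    by (simp_all add: dicyclic_group_12_def semidirect_product_def carrier_integer_mod_group)
  have mult: "(a, h) \<otimes>\<^bsub>dicyclic_group_12\<^esub> (b, k) = ((a + inversion_action 3 h b) mod 3, (h + k) mod 4)" for a h b k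
    by (simp add: dicyclic_group_12_def semidirect_product_def)
  have pow: "(1, 2) [^]\<^bsub>dicyclic_group_12\<^esub> k = (int k mod 3, 2 * int k mod 4)" for k :: nat
  proof (induction k)
    case (Suc k)
    have "even (2 * int k mod 4)" by presburger
    moreover have "(int k mod 3 + 1) mod 3 = (1 + int k) mod 3" "(2 * int k mod 4 + 2) mod 4 = (2 + 2 * int k) mod 4"
      by presburger+
    ultimately show ?case using Suc by (simp add: mult inversion_action_def)
  qed (simp add: one)
  show "(1, 2) \<in> carrier dicyclic_group_12" by (simp add: C)
  show "(1, 2) [^]\<^bsub>dicyclic_group_12\<^esub> k = \<one>\<^bsub>dicyclic_group_12\<^esub> \<longleftrightarrow> 6 dvd k" for k :: nat
    unfolding pow one by simp presburger
  show "g [^]\<^bsub>dicyclic_group_12\<^esub> (4::nat) = \<one>\<^bsub>dicyclic_group_12\<^esub> \<or> (\<exists>k::nat. g = (1, 2) [^]\<^bsub>dicyclic_group_12\<^esub> k)"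
    if gH: "g \<in> carrier dicyclic_group_12" for g
  proof -
    obtain a s where g: "g = (a, s)" "a \<in> {0..<3}" "s \<in> {0..<4}" using gH C by auto
    have fourth: "g [^]\<^bsub>dicyclic_group_12\<^esub> (4::nat) = \<one>\<^bsub>dicyclic_group_12\<^esub>"
      if "g [^]\<^bsub>dicyclic_group_12\<^esub> (2::nat) = (0, 2)"
    proof -
      have "g [^]\<^bsub>dicyclic_group_12\<^esub> (2 + 2::nat) = (0, 2) \<otimes>\<^bsub>dicyclic_group_12\<^esub> (0, 2)"
        using monoid.nat_pow_mult[OF group.is_monoid[OF group_dicyclic_group_12], of g 2 2]
          gH that by simp
      then show ?thesis by (simp add: mult one inversion_action_def)
    qed
    from g have a: "a = 0 \<or> a = 1 \<or> a = 2" and s: "s = 0 \<or> s = 2 \<or> (s = 1 \<or> s = 3)" by auto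
    from s show ?thesis
    proof (elim disjE)
      assume "s = 0"
      then have "g = (1, 2) [^]\<^bsub>dicyclic_group_12\<^esub> nat (4 * a)"
        using g(1) a by (elim disjE) (simp_all add: pow one)
      then show ?thesis by blast
    next
      assume "s = 2"
      then have "g = (1, 2) [^]\<^bsub>dicyclic_group_12\<^esub> nat (4 * a + 3)"
        using g(1) a by (elim disjE) (simp_all add: pow one)
      then show ?thesis by blast
    next
      assume s: "s = 1"
      have "g \<otimes>\<^bsub>dicyclic_group_12\<^esub> g = (0, 2)"
        unfolding g(1) s using a
        by (elim disjE) (simp_all add: mult inversion_action_def carrier_integer_mod_group)
      then have "g [^]\<^bsub>dicyclic_group_12\<^esub> (2::nat) = (0, 2)"
        using gH group.is_monoid[OF group_dicyclic_group_12] by (simp add: numeral_2_eq_2 monoid.l_one)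
      then show ?thesis using fourth by blast
    next
      assume s: "s = 3"
      have "g \<otimes>\<^bsub>dicyclic_group_12\<^esub> g = (0, 2)"
        unfolding g(1) s using a
        by (elim disjE) (simp_all add: mult inversion_action_def carrier_integer_mod_group)
      then have "g [^]\<^bsub>dicyclic_group_12\<^esub> (2::nat) = (0, 2)"
        using gH group.is_monoid[OF group_dicyclic_group_12] by (simp add: numeral_2_eq_2 monoid.l_one)
      then show ?thesis using fourth by blast
    qed
  qed
qed

theorem theorem2p12:
  fixes G :: "('a, 'b) monoid_scheme"
  assumes "group G"
  shows "almost_planar (carrier G) (power_graph_edges G) \<longleftrightarrow>
           element_orders G \<subseteq> {1, 2, 3, 4} \<or>
           G \<cong> integer_mod_group 5 \<or>
           G \<cong> integer_mod_group 6 \<or>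
           G \<cong> dihedral_group 5 \<or>
           G \<cong> dihedral_group 6 \<or>
           G \<cong> dicyclic_group_12 \<or>
           G \<cong> frobenius_group_20"
proof -
  interpret group G by fact
  let ?P = "\<lambda>n. \<exists>x\<in>carrier G. ord x = n \<and> (\<forall>g\<in>carrier G - generate G {x}. ord g \<in> {1, 2, 3, 4})"
  have "almost_planar (carrier G) (power_graph_edges G) \<longleftrightarrow> element_orders G \<subseteq> {1, 2, 3, 4} \<or> ?P 5 \<or> ?P 6"
    unfolding almost_planar_iff_orders by blast
  moreover have "?P 5 \<longleftrightarrow> G \<cong> integer_mod_group 5 \<or> G \<cong> dihedral_group 5 \<or> G \<cong> frobenius_group_20"
  proof
    assume "?P 5"
    then show "G \<cong> integer_mod_group 5 \<or> G \<cong> dihedral_group 5 \<or> G \<cong> frobenius_group_20"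
      using order_5_classification by blast
  next
    assume "G \<cong> integer_mod_group 5 \<or> G \<cong> dihedral_group 5 \<or> G \<cong> frobenius_group_20"
    then show "?P 5"
      using integer_mod_group_orders[OF assms, of 5] dihedral_group_orders[OF assms, of 5]
        frobenius_group_20_orders[OF assms] by (elim disjE) simp_all
  qed
  moreover have "?P 6 \<longleftrightarrow> G \<cong> integer_mod_group 6 \<or> G \<cong> dihedral_group 6 \<or> G \<cong> dicyclic_group_12"
  proof
    assume "?P 6"
    then show "G \<cong> integer_mod_group 6 \<or> G \<cong> dihedral_group 6 \<or> G \<cong> dicyclic_group_12"
      using order_6_classification by blast
  next
    assume "G \<cong> integer_mod_group 6 \<or> G \<cong> dihedral_group 6 \<or> G \<cong> dicyclic_group_12"
    then show "?P 6"
      using integer_mod_group_orders[OF assms, of 6] dihedral_group_orders[OF assms, of 6]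
        dicyclic_group_12_orders[OF assms] by (elim disjE) simp_all
  qed
  ultimately show ?thesis by argo
qed

end
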